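(* There exists a constant $K_0\in(0,\infty)$ depending only on the dimension $d$ such that the following holds. Let $M>0$, $\delta\in(0,M/2]$, let $Z=(z_k)_{k\in(M\mathbb{Z})^d}$ be an $(M,\delta)$-equidistributed sequence, let $V\colon\mathbb{R}^d\to\mathbb{R}$ be measurable and bounded, let $E\in\mathbb{R}$, and let $\varphi\in W^{2,2}(\mathbb{R}^d)$ be real-valued with $\lvert\Delta\varphi\rvert\le\lvert(V-E)\varphi\rvert$ almost everywhere on $\mathbb{R}^d$. Then \[ \left(\frac{\delta}{M}\right)^{K_0\left(1+M^{4/3}\lVert V-E\rVert_\infty^{2/3}\right)}\lVert\varphi\rVert\le\lVert W_{\delta,Z}\varphi\rVert\le\lVert\varphi\rVert . \]
   Context: For $M>0$ and $k\in\mathbb{R}^d$ let $\Lambda_M(k):=k+(-M/2,M/2)^d$, and let $B(z,\delta)=\{x\in\mathbb{R}^d:\lvert x-z\rvert_2<\delta\}$. Given $M,\delta>0$, a sequence $Z=(z_k)_{k\in(M\mathbb{Z})^d}\subset\mathbb{R}^d$ is called $(M,\delta)$-equidistributed if $B(z_k,\delta)\subset\Lambda_M(k)$ for all $k\in(M\mathbb{Z})^d$. For such $Z$ set $S_{\delta,Z}=\bigcup_{k\in(M\mathbb{Z})^d}B(z_k,\delta)$ and $W_{\delta,Z}=\chi_{S_{\delta,Z}}$ (indicator function, acting as a multiplication operator). $\lVert\cdot\rVert$ denotes the $L^2(\mathbb{R}^d)$-norm and $\lVert\cdot\rVert_\infty$ the sup-norm. *)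

theory Defs
  imports "HOL-Analysis.Analysis"
begin

fun deriv_iter :: "'a::euclidean_space list \<Rightarrow> ('a \<Rightarrow> real) \<Rightarrow> 'a \<Rightarrow> real" where
  "deriv_iter [] f = f"
| "deriv_iter (b # bs) f = (\<lambda>x. frechet_derivative (deriv_iter bs f) (at x) b)"

definition smooth_fun :: "('a::euclidean_space \<Rightarrow> real) \<Rightarrow> bool" where
  "smooth_fun f \<longleftrightarrow> (\<forall>bs. set bs \<subseteq> Basis \<longrightarrow> (\<forall>x. deriv_iter bs f differentiable at x))"

definition test_fun :: "('a::euclidean_space \<Rightarrow> real) \<Rightarrow> bool" where
  "test_fun \<psi> \<longleftrightarrow> smooth_fun \<psi> \<and> compact (closure {x. \<psi> x \<noteq> 0})"

definition L2 :: "('a::euclidean_space \<Rightarrow> real) \<Rightarrow> bool" where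
  "L2 f \<longleftrightarrow> f \<in> borel_measurable lebesgue \<and> integrable lebesgue (\<lambda>x. (f x)\<^sup>2)"

definition L2norm :: "('a::euclidean_space \<Rightarrow> real) \<Rightarrow> real" where
  "L2norm f = sqrt (\<integral>x. (f x)\<^sup>2 \<partial>lebesgue)"

definition weak_deriv :: "'a::euclidean_space list \<Rightarrow> ('a \<Rightarrow> real) \<Rightarrow> ('a \<Rightarrow> real) \<Rightarrow> bool" where
  "weak_deriv bs f g \<longleftrightarrow> (\<forall>\<psi>. test_fun \<psi> \<longrightarrow>
     (\<integral>x. f x * deriv_iter bs \<psi> x \<partial>lebesgue) = (-1) ^ length bs * (\<integral>x. g x * \<psi> x \<partial>lebesgue))"

definition sobolev22 :: "('a::euclidean_space \<Rightarrow> real) \<Rightarrow> bool" where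
  "sobolev22 f \<longleftrightarrow> L2 f \<and>
     (\<forall>bs. set bs \<subseteq> Basis \<and> length bs \<le> 2 \<longrightarrow> (\<exists>g. L2 g \<and> weak_deriv bs f g))"

definition lattice :: "real \<Rightarrow> 'a::euclidean_space set" where
  "lattice M = {k. \<forall>i\<in>Basis. \<exists>n::int. k \<bullet> i = M * of_int n}"

definition cube :: "real \<Rightarrow> 'a::euclidean_space \<Rightarrow> 'a set" where
  "cube M k = box (k - (M/2) *\<^sub>R One) (k + (M/2) *\<^sub>R One)"

definition equidistributed :: "real \<Rightarrow> real \<Rightarrow> ('a::euclidean_space \<Rightarrow> 'a) \<Rightarrow> bool" where
  "equidistributed M \<delta> Z \<longleftrightarrow> (\<forall>k\<in>lattice M. ball (Z k) \<delta> \<subseteq> cube M k)"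

definition S_set :: "real \<Rightarrow> real \<Rightarrow> ('a::euclidean_space \<Rightarrow> 'a) \<Rightarrow> 'a set" where
  "S_set M \<delta> Z = (\<Union>k\<in>lattice M. ball (Z k) \<delta>)"

end

(* The heart of the matter is a Carleman estimate with the weight |x|^(-2 alpha) exp(2 alpha b |x|^2).
   In the variable t = log |x| the exponent -t + b e^(2t) is convex, and the commutator of the symmetric
   and antisymmetric parts of the conjugated Laplacian contains no tangential derivatives; this gives a
   factor alpha^3 on the left-hand side. Applied to a cutoff of phi that vanishes near z_k and far away,
   the estimate bounds the mass of phi on the cube of k by (C M / delta)^(2 alpha + 2) times the mass on
   B(z_k, delta) plus C 3^(-alpha) times the mass on a ball of radius comparable to M; Caccioppoli's
   inequality removes the gradients produced by the cutoff. The potential is absorbed as soon as alpha^3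
   exceeds a multiple of M^4 |V - E|^2, whence the exponent 2/3. Upon summation over the lattice the large
   balls overlap boundedly often, so their contribution is absorbed once alpha exceeds a dimensional
   constant. The estimates are proved for mollifications of phi and passed to the limit, which is possible
   because, the gradients being eliminated, they involve only phi and its Laplacian. *)
theory Submission
  imports Defs
begin

section \<open>The divergence theorem for compactly supported fields\<close>

text \<open>The theorem has no constant in front of the power of delta / M, yet every estimate
  leading to it produces dimensional constants. Since M / delta is at least 2, a constant x is at
  most (M / delta)^(2x) and moves into the exponent. Lengths enter squared, because cutoffs and
  weights are functions of s = |x|^2: the inner scale is a = delta^2 / 8, the cube scale rho = d
  M^2, with ratio 8 d (M / delta)^2. The condition on alpha becomes alpha^3 >= 512 rho^2 N^2, where
  N bounds |V - E|, and so M^4 N^2 appears under the cube root. Two obstacles shape the argument. A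
  mollification of phi does not satisfy the differential inequality, so the estimates for smooth
  functions keep the function and its Laplacian as separate quantities, and the inequality is
  inserted only in the limit. And \<open>weak_deriv\<close> does not determine its candidate, since
  nonintegrable products have integral 0 by convention; a candidate either agrees almost everywhere
  with the square integrable derivative or forces phi to vanish almost everywhere.\<close>

lemma integrable_continuous_compact_support:
  fixes f :: "'a::euclidean_space \<Rightarrow> 'b::euclidean_space"
  assumes "continuous_on UNIV f" and "\<And>x. norm x > R \<Longrightarrow> f x = 0"
  shows "integrable lborel f"
proof -
  have "integrable lborel (\<lambda>x. indicator (cball 0 R) x *\<^sub>R f x)"
    by (rule borel_integrable_compact) (use assms(1) in \<open>auto intro: continuous_on_subset\<close>)
  also have "(\<lambda>x. indicator (cball 0 R) x *\<^sub>R f x) = f"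
    using assms(2) by (auto simp: indicator_def fun_eq_iff)
  finally show ?thesis .
qed

lemma lborel_integral_translate:
  fixes f :: "'a::euclidean_space \<Rightarrow> 'b::{banach, second_countable_topology}"
  assumes "f \<in> borel_measurable borel"
  shows "(\<integral>x. f (x + c) \<partial>lborel) = (\<integral>x. f x \<partial>lborel)"
proof -
  have "(\<integral>x. f x \<partial>lborel) = (\<integral>x. f x \<partial>distr lborel borel ((+) c))"
    by (simp add: lborel_distr_plus)
  also have "\<dots> = (\<integral>x. f (c + x) \<partial>lborel)"
    by (rule integral_distr) (use assms in auto)
  finally show ?thesis by (simp add: add.commute)
qed

lemma lborel_integrable_translate:
  fixes f :: "'a::euclidean_space \<Rightarrow> 'b::{banach, second_countable_topology}"
  assumes "integrable lborel f"
  shows "integrable lborel (\<lambda>x. f (x + c))"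
proof -
  have "integrable (distr lborel borel ((+) c)) f"
    using assms by (simp add: lborel_distr_plus)
  then have "integrable lborel (\<lambda>x. f (c + x))"
    by (subst (asm) integrable_distr_eq) (use assms in auto)
  then show ?thesis by (simp add: add.commute)
qed

text \<open>By translation invariance every difference quotient has integral zero, and dominated
  convergence transfers this to the derivative. Step lengths are at most 1, so the quotients vanish
  outside the ball of radius R + 1, and by the mean value theorem a bound for the derivative on the
  ball of radius R + 2 dominates them.\<close>

lemma integral_partial_derivative_eq_0:
  fixes f :: "'a::euclidean_space \<Rightarrow> real"
  assumes der: "\<And>x. (f has_derivative f' x) (at x)"
    and cont: "continuous_on UNIV (\<lambda>x. f' x i)"
    and supp: "\<And>x. norm x > R \<Longrightarrow> f x = 0"
    and i: "norm i = 1"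
  shows "integrable lborel (\<lambda>x. f' x i)" "(\<integral>x. f' x i \<partial>lborel) = 0"
proof -
  define t where "t n = 1 / real (Suc n)" for n
  have t: "0 < t n" "t n \<le> 1" for n by (auto simp: t_def)
  have t0: "t \<longlonglongrightarrow> 0" unfolding t_def by (rule LIMSEQ_Suc[OF lim_1_over_n])
  have line: "((\<lambda>s. f (x + s *\<^sub>R i)) has_real_derivative f' (x + s *\<^sub>R i) i) (at s)" for x s
  proof -
    have "((\<lambda>s. f (x + s *\<^sub>R i)) has_derivative (\<lambda>h. f' (x + s *\<^sub>R i) (h *\<^sub>R i))) (at s)"
      by (rule has_derivative_compose[OF _ der]) (auto intro!: derivative_eq_intros)
    moreover have "f' y (h *\<^sub>R i) = f' y i * h" for y h
      using has_derivative_linear[OF der, of y] by (simp add: linear_cmul)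
    ultimately show ?thesis by (simp add: has_field_derivative_def)
  qed
  have contf: "continuous_on UNIV f"
    using der by (meson has_derivative_continuous continuous_at_imp_continuous_on)
  have "compact ((\<lambda>x. f' x i) ` cball 0 (R + 2))"
    by (rule compact_continuous_image) (use cont in \<open>auto intro: continuous_on_subset\<close>)
  then obtain B where B: "B > 0" "\<And>x. norm x \<le> R + 2 \<Longrightarrow> \<bar>f' x i\<bar> \<le> B"
    by (auto dest!: compact_imp_bounded simp: bounded_pos)
  define q where "q n x = (f (x + t n *\<^sub>R i) - f x) / t n" for n x
  have lim: "(\<lambda>n. q n x) \<longlonglongrightarrow> f' x i" for x
  proof -
    have "((\<lambda>h. (f (x + h *\<^sub>R i) - f x) / h) \<longlongrightarrow> f' x i) (at 0)"
      using line[of x 0] by (simp add: has_field_derivative_iff)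
    moreover have "filterlim t (at 0) sequentially"
      using t0 t(1) by (auto simp: filterlim_at intro!: always_eventually less_imp_neq[THEN not_sym])
    ultimately show ?thesis unfolding q_def
      by (rule filterlim_compose)
  qed
  have dom: "norm (q n x) \<le> B * indicator (cball 0 (R + 1)) x" for n x
  proof (cases "norm x \<le> R + 1")
    case False
    have "norm (t n *\<^sub>R i) \<le> 1" using t i by (simp add: less_imp_le)
    then have "norm (x + t n *\<^sub>R i) > R"
      using False norm_triangle_ineq4[of "x + t n *\<^sub>R i" "t n *\<^sub>R i"] by simp
    then show ?thesis using False supp by (simp add: q_def)
  next
    case True
    obtain z where z: "0 < z" "z < t n" "f (x + t n *\<^sub>R i) - f (x + 0 *\<^sub>R i) = (t n - 0) * f' (x + z *\<^sub>R i) i"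
      using MVT2[of 0 "t n" "\<lambda>s. f (x + s *\<^sub>R i)" "\<lambda>s. f' (x + s *\<^sub>R i) i"] t(1) line by auto
    have "norm (z *\<^sub>R i) \<le> 1" using t(2)[of n] z i by simp
    then have "norm (x + z *\<^sub>R i) \<le> R + 2"
      using True norm_triangle_ineq[of x "z *\<^sub>R i"] by simp
    from B(2)[OF this] show ?thesis using z(3) True t(1)[of n] by (simp add: q_def)
  qed
  have intf: "integrable lborel f"
    by (rule integrable_continuous_compact_support[OF contf supp])
  have mq: "q n \<in> borel_measurable lborel" for n
    unfolding q_def using lborel_integrable_translate[OF intf] intf by simp
  have int_q: "(\<integral>x. q n x \<partial>lborel) = 0" for n
    unfolding q_def using lborel_integrable_translate[OF intf, of "t n *\<^sub>R i"] intf
    by (simp add: lborel_integral_translate)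
  have mf: "(\<lambda>x. f' x i) \<in> borel_measurable lborel"
    using borel_measurable_continuous_onI[OF cont] by simp
  have w: "integrable lborel (\<lambda>x. B * indicator (cball 0 (R + 1)) x :: real)"
    by (intro integrable_mult_right integrable_real_indicator emeasure_lborel_cball_finite) auto
  note dc = mf mq w AE_I2[OF lim] AE_I2[OF dom]
  show "integrable lborel (\<lambda>x. f' x i)"
    by (rule integrable_dominated_convergence[OF dc])
  have "(\<lambda>n. \<integral>x. q n x \<partial>lborel) \<longlonglongrightarrow> (\<integral>x. f' x i \<partial>lborel)"
    by (rule integral_dominated_convergence[OF dc])
  then show "(\<integral>x. f' x i \<partial>lborel) = 0"
    by (simp add: int_q LIMSEQ_const_iff)
qed

section \<open>Functions of class C^1 and C^2 with explicit derivatives, and the calculus of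
  divergences\<close>

definition C1_fun :: "('a::euclidean_space \<Rightarrow> real) \<Rightarrow> ('a \<Rightarrow> 'a) \<Rightarrow> bool" where
  "C1_fun f g \<longleftrightarrow> (\<forall>x. (f has_derivative (\<lambda>h. g x \<bullet> h)) (at x)) \<and> continuous_on UNIV g"

text \<open>Symmetry of the Hessian is part of the notion: it is checked for each construction
  (radial functions, products, mollifications) instead of being derived from continuity. Continuity
  is asked direction by direction, which in finite dimension suffices for applying the Hessian to a
  continuous field.\<close>

definition C2_fun :: "('a::euclidean_space \<Rightarrow> real) \<Rightarrow> ('a \<Rightarrow> 'a) \<Rightarrow> ('a \<Rightarrow> 'a \<Rightarrow> 'a) \<Rightarrow> bool" where
  "C2_fun f g H \<longleftrightarrow> (\<forall>x. (f has_derivative (\<lambda>h. g x \<bullet> h)) (at x)) \<and>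
     (\<forall>x. (g has_derivative H x) (at x)) \<and> (\<forall>x h k. H x h \<bullet> k = h \<bullet> H x k) \<and>
     (\<forall>h. continuous_on UNIV (\<lambda>x. H x h))"

definition trace_op :: "('a::euclidean_space \<Rightarrow> 'a) \<Rightarrow> real" where
  "trace_op A = (\<Sum>i\<in>Basis. A i \<bullet> i)"

text \<open>The derivative of the field is hidden so that divergences are assembled by rules alone,
  for sums, constant multiples and products with C^1 functions. The long divergence identities are
  generated this way and only then simplified pointwise.\<close>

definition has_div :: "('a::euclidean_space \<Rightarrow> 'a) \<Rightarrow> ('a \<Rightarrow> real) \<Rightarrow> bool" where
  "has_div Y d \<longleftrightarrow> (\<exists>Y'. \<forall>x. (Y has_derivative Y' x) (at x) \<and> d x = trace_op (Y' x) \<and>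
     (\<forall>h. continuous_on UNIV (\<lambda>x. Y' x h)))"

lemma has_div_integral:
  assumes "has_div Y d" and "\<And>x. norm x > R \<Longrightarrow> Y x = 0"
  shows "integrable lborel d" "(\<integral>x. d x \<partial>lborel) = 0"
proof -
  obtain Y' where Y: "\<And>x. (Y has_derivative Y' x) (at x)" "\<And>x. d x = (\<Sum>i\<in>Basis. Y' x i \<bullet> i)"
    "\<And>h. continuous_on UNIV (\<lambda>x. Y' x h)"
    using assms(1) unfolding has_div_def trace_op_def by metis
  have *: "integrable lborel (\<lambda>x. Y' x i \<bullet> i) \<and> (\<integral>x. Y' x i \<bullet> i \<partial>lborel) = 0" if "i \<in> Basis" for i
  proof -
    have "((\<lambda>x. Y x \<bullet> i) has_derivative (\<lambda>h. Y' x h \<bullet> i)) (at x)" for x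
      by (intro has_derivative_inner_left Y)
    moreover have "continuous_on UNIV (\<lambda>x. Y' x i \<bullet> i)" by (intro continuous_intros Y)
    ultimately show ?thesis
      using integral_partial_derivative_eq_0[of "\<lambda>x. Y x \<bullet> i" "\<lambda>x h. Y' x h \<bullet> i" i R] assms(2) that by simp
  qed
  have d: "d = (\<lambda>x. \<Sum>i\<in>Basis. Y' x i \<bullet> i)" using Y(2) by auto
  show "integrable lborel d" unfolding d using * by (intro Bochner_Integration.integrable_sum) auto
  show "(\<integral>x. d x \<partial>lborel) = 0" unfolding d using * by (subst Bochner_Integration.integral_sum) auto
qed

lemma C1_funD:
  assumes "C1_fun f g"
  shows "(f has_derivative (\<lambda>h. g x \<bullet> h)) (at x)" "continuous_on A g" "continuous_on A f"
  using assms unfolding C1_fun_def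
  by (auto intro: continuous_on_subset continuous_at_imp_continuous_on has_derivative_continuous)

lemma C2_fun_imp_C1_fun: "C2_fun f g H \<Longrightarrow> C1_fun f g"
  unfolding C1_fun_def C2_fun_def
  by (auto intro: continuous_at_imp_continuous_on has_derivative_continuous)

lemma C2_funD:
  assumes "C2_fun f g H"
  shows "(f has_derivative (\<lambda>h. g x \<bullet> h)) (at x)" "(g has_derivative H x) (at x)"
    "H x h \<bullet> k = h \<bullet> H x k" "continuous_on A (\<lambda>x. H x h)" "linear (H x)"
    "continuous_on A g" "continuous_on A f"
  using assms C1_funD[OF C2_fun_imp_C1_fun[OF assms]] unfolding C2_fun_def
  by (auto intro: continuous_on_subset has_derivative_linear)

lemma C2_fun_continuous_hessian_apply:
  assumes "C2_fun f g H" "continuous_on A v"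
  shows "continuous_on A (\<lambda>x. H x (v x))"
proof -
  have "H x (v x) = (\<Sum>i\<in>Basis. (v x \<bullet> i) *\<^sub>R H x i)" for x
    using C2_funD(5)[OF assms(1), of x]
    by (subst (1) euclidean_representation[of "v x", symmetric]) (simp only: linear_sum linear_cmul)
  then show ?thesis using assms(2) C2_funD(4)[OF assms(1)]
    by (simp add: continuous_intros)
qed

lemma C2_fun_continuous_trace:
  assumes "C2_fun f g H"
  shows "continuous_on A (\<lambda>x. trace_op (H x))"
  unfolding trace_op_def by (intro continuous_intros C2_funD[OF assms])

lemma has_div_id: "has_div (\<lambda>x::'a::euclidean_space. x) (\<lambda>_. DIM('a))"
  unfolding has_div_def
  by (intro exI[of _ "\<lambda>_ h. h"]) (auto simp: trace_op_def inner_Basis intro!: derivative_eq_intros)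

lemma has_div_grad: "C2_fun f g H \<Longrightarrow> has_div g (\<lambda>x. trace_op (H x))"
  unfolding has_div_def using C2_funD by blast

lemma has_div_add:
  assumes "has_div X d" "has_div Y e"
  shows "has_div (\<lambda>x. X x + Y x) (\<lambda>x. d x + e x)"
proof -
  obtain X' where X: "\<forall>x. (X has_derivative X' x) (at x) \<and> d x = trace_op (X' x) \<and> (\<forall>h. continuous_on UNIV (\<lambda>x. X' x h))"
    using assms(1) unfolding has_div_def by blast
  obtain Y' where Y: "\<forall>x. (Y has_derivative Y' x) (at x) \<and> e x = trace_op (Y' x) \<and> (\<forall>h. continuous_on UNIV (\<lambda>x. Y' x h))"
    using assms(2) unfolding has_div_def by blast
  show ?thesis unfolding has_div_def
    by (rule exI[of _ "\<lambda>x h. X' x h + Y' x h"])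
      (use X Y in \<open>auto intro!: derivative_eq_intros continuous_intros simp: trace_op_def inner_add_left sum.distrib\<close>)
qed

lemma has_div_scale:
  assumes f: "C1_fun f g" and X: "has_div X d"
  shows "has_div (\<lambda>x. f x *\<^sub>R X x) (\<lambda>x. g x \<bullet> X x + f x * d x)"
proof -
  obtain X' where X: "\<And>x. (X has_derivative X' x) (at x)" "\<And>x. d x = trace_op (X' x)"
    "\<And>h. continuous_on UNIV (\<lambda>x. X' x h)"
    using X unfolding has_div_def by metis
  have cX: "continuous_on UNIV X"
    using X(1) by (meson has_derivative_continuous continuous_at_imp_continuous_on)
  show ?thesis unfolding has_div_def
  proof (intro exI[of _ "\<lambda>x h. f x *\<^sub>R X' x h + (g x \<bullet> h) *\<^sub>R X x"] allI conjI)
    fix x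
    show "((\<lambda>x. f x *\<^sub>R X x) has_derivative (\<lambda>h. f x *\<^sub>R X' x h + (g x \<bullet> h) *\<^sub>R X x)) (at x)"
      by (rule has_derivative_scaleR[OF C1_funD(1)[OF f] X(1)])
    have "(\<Sum>i\<in>Basis. (g x \<bullet> i) * (X x \<bullet> i)) = g x \<bullet> X x"
      by (rule euclidean_inner[symmetric])
    then show "g x \<bullet> X x + f x * d x = trace_op (\<lambda>h. f x *\<^sub>R X' x h + (g x \<bullet> h) *\<^sub>R X x)"
      by (simp add: trace_op_def X(2) inner_add_left sum.distrib sum_distrib_left)
  next
    fix h show "continuous_on UNIV (\<lambda>x. f x *\<^sub>R X' x h + (g x \<bullet> h) *\<^sub>R X x)"
      by (intro continuous_intros C1_funD[OF f] X cX)
  qed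
qed

lemma C1_fun_mult:
  assumes "C1_fun f g" "C1_fun f2 g2"
  shows "C1_fun (\<lambda>x. f x * f2 x) (\<lambda>x. f x *\<^sub>R g2 x + f2 x *\<^sub>R g x)"
  unfolding C1_fun_def
  by (auto intro!: derivative_eq_intros continuous_intros C1_funD[OF assms(1)] C1_funD[OF assms(2)]
      simp: inner_add_left)

text \<open>Weights and cutoffs are written as functions of |x|^2 rather than |x|, because |x|^2 is
  smooth at the origin.\<close>

lemma C1_fun_radial:
  assumes "\<And>s. (q has_real_derivative q' s) (at s)" "continuous_on UNIV q'"
  shows "C1_fun (\<lambda>x. q (x \<bullet> x)) (\<lambda>x. (2 * q' (x \<bullet> x)) *\<^sub>R x)"
proof -
  have "((\<lambda>x. q (x \<bullet> x)) has_derivative (\<lambda>h. (2 * q' (x \<bullet> x)) *\<^sub>R x \<bullet> h)) (at x)" for x :: 'a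
  proof -
    have "((\<lambda>x. q (x \<bullet> x)) has_derivative (\<lambda>h. q' (x \<bullet> x) * (x \<bullet> h + h \<bullet> x))) (at x)"
      by (rule has_derivative_compose[OF _ assms(1)[unfolded has_field_derivative_def]])
        (auto intro!: derivative_eq_intros)
    then show ?thesis by (simp add: inner_commute algebra_simps)
  qed
  moreover have "continuous_on UNIV (\<lambda>x::'a. (2 * q' (x \<bullet> x)) *\<^sub>R x)"
    by (intro continuous_intros continuous_on_compose2[OF assms(2)]) auto
  ultimately show ?thesis unfolding C1_fun_def by blast
qed

lemma C2_fun_radial:
  assumes q: "\<And>s. (q has_real_derivative q' s) (at s)" and q': "\<And>s. (q' has_real_derivative q'' s) (at s)"
    and c: "continuous_on UNIV q''"
  shows "C2_fun (\<lambda>x. q (x \<bullet> x)) (\<lambda>x. (2 * q' (x \<bullet> x)) *\<^sub>R x)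
     (\<lambda>x h. (2 * q' (x \<bullet> x)) *\<^sub>R h + (4 * q'' (x \<bullet> x) * (x \<bullet> h)) *\<^sub>R x)"
proof -
  have cq': "continuous_on UNIV q'" using q' by (meson DERIV_continuous continuous_at_imp_continuous_on)
  note 1 = C1_funD[OF C1_fun_radial[OF q cq']]
  note 2 = C1_funD[OF C1_fun_radial[OF q' c]]
  have "((\<lambda>x::'a. (2 * q' (x \<bullet> x)) *\<^sub>R x) has_derivative
     (\<lambda>h. (2 * q' (x \<bullet> x)) *\<^sub>R h + (4 * q'' (x \<bullet> x) * (x \<bullet> h)) *\<^sub>R x)) (at x)" for x
    by (rule has_derivative_eq_rhs[OF has_derivative_scaleR[OF has_derivative_mult_right[OF 2(1)] has_derivative_ident]]) auto
  moreover have "continuous_on UNIV (\<lambda>x::'a. (2 * q' (x \<bullet> x)) *\<^sub>R h + (4 * q'' (x \<bullet> x) * (x \<bullet> h)) *\<^sub>R x)" for h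
    by (intro continuous_intros continuous_on_compose2[OF c] continuous_on_compose2[OF cq']) auto
  moreover have "((2 * q' (x \<bullet> x)) *\<^sub>R h + (4 * q'' (x \<bullet> x) * (x \<bullet> h)) *\<^sub>R x) \<bullet> k =
     h \<bullet> ((2 * q' (x \<bullet> x)) *\<^sub>R k + (4 * q'' (x \<bullet> x) * (x \<bullet> k)) *\<^sub>R x)" for x h k :: 'a
    by (simp add: inner_add_left inner_add_right inner_commute[of h x])
  ultimately show ?thesis unfolding C2_fun_def using 1(1) by blast
qed

text \<open>With c = 2 q' and e = 4 q'' this is the Laplacian of q(|x|^2), by
  \<open>C2_fun_radial\<close>.\<close>

lemma trace_op_radial:
  fixes c e :: real and x :: "'a::euclidean_space"
  shows "trace_op (\<lambda>h. c *\<^sub>R h + (e * (x \<bullet> h)) *\<^sub>R x) = real DIM('a) * c + e * (x \<bullet> x)"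
proof -
  have "(\<Sum>i\<in>Basis. (x \<bullet> i) * (x \<bullet> i)) = x \<bullet> x" by (rule euclidean_inner[symmetric])
  then have "(\<Sum>i\<in>Basis. e * (x \<bullet> i) * (x \<bullet> i)) = e * (x \<bullet> x)"
    by (simp add: sum_distrib_left[symmetric] mult.assoc)
  then show ?thesis
    by (simp add: trace_op_def inner_add_left sum.distrib inner_Basis)
qed

lemma C2_fun_mult:
  assumes f: "C2_fun f g H" and f2: "C2_fun f2 g2 H2"
  shows "C2_fun (\<lambda>x. f x * f2 x) (\<lambda>x. f x *\<^sub>R g2 x + f2 x *\<^sub>R g x)
     (\<lambda>x h. f x *\<^sub>R H2 x h + f2 x *\<^sub>R H x h + (g x \<bullet> h) *\<^sub>R g2 x + (g2 x \<bullet> h) *\<^sub>R g x)"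
  unfolding C2_fun_def
proof (intro conjI allI)
  note C1 = C1_fun_mult[OF f[THEN C2_fun_imp_C1_fun] f2[THEN C2_fun_imp_C1_fun]]
  fix x
  show "((\<lambda>x. f x * f2 x) has_derivative (\<bullet>) (f x *\<^sub>R g2 x + f2 x *\<^sub>R g x)) (at x)"
    by (rule C1_funD(1)[OF C1])
  show "((\<lambda>x. f x *\<^sub>R g2 x + f2 x *\<^sub>R g x) has_derivative
     (\<lambda>h. f x *\<^sub>R H2 x h + f2 x *\<^sub>R H x h + (g x \<bullet> h) *\<^sub>R g2 x + (g2 x \<bullet> h) *\<^sub>R g x)) (at x)"
    by (rule has_derivative_eq_rhs[OF has_derivative_add[OF has_derivative_scaleR has_derivative_scaleR]])
      (use C2_funD[OF f] C2_funD[OF f2] in \<open>auto simp: algebra_simps\<close>)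
  show "(f x *\<^sub>R H2 x h + f2 x *\<^sub>R H x h + (g x \<bullet> h) *\<^sub>R g2 x + (g2 x \<bullet> h) *\<^sub>R g x) \<bullet> k =
       h \<bullet> (f x *\<^sub>R H2 x k + f2 x *\<^sub>R H x k + (g x \<bullet> k) *\<^sub>R g2 x + (g2 x \<bullet> k) *\<^sub>R g x)" for h k
    using C2_funD(3)[OF f, of x h k] C2_funD(3)[OF f2, of x h k]
    by (simp add: inner_add_left inner_add_right inner_commute algebra_simps)
next
  fix h show "continuous_on UNIV
          (\<lambda>x. f x *\<^sub>R H2 x h + f2 x *\<^sub>R H x h + (g x \<bullet> h) *\<^sub>R g2 x + (g2 x \<bullet> h) *\<^sub>R g x)"
    by (intro continuous_intros C2_funD[OF f] C2_funD[OF f2])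
qed

text \<open>The operator is the Hessian produced by \<open>C2_fun_mult\<close>, so this is the
  product rule for the Laplacian.\<close>

lemma trace_op_mult:
  "trace_op (\<lambda>h. a *\<^sub>R H2 h + b *\<^sub>R H h + (g \<bullet> h) *\<^sub>R g2 + (g2 \<bullet> h) *\<^sub>R g)
     = a * trace_op H2 + b * trace_op H + 2 * (g \<bullet> g2)"
proof -
  have "(\<Sum>i\<in>Basis. (g \<bullet> i) * (g2 \<bullet> i)) = g \<bullet> g2" "(\<Sum>i\<in>Basis. (g2 \<bullet> i) * (g \<bullet> i)) = g \<bullet> g2"
    by (metis euclidean_inner inner_commute)+
  then show ?thesis
    by (simp add: trace_op_def inner_add_left sum.distrib flip: sum_distrib_left)
qed

text \<open>These two scalars multiply the vector fields in the Rellich-type identity behind the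
  Carleman estimate. Symmetry of the Hessian is used to move it from the increment onto x and onto
  the gradient.\<close>

lemma C1_fun_inner_grad:
  assumes f: "C2_fun f g H"
  shows "C1_fun (\<lambda>x. x \<bullet> g x) (\<lambda>x. g x + H x x)" "C1_fun (\<lambda>x. g x \<bullet> g x) (\<lambda>x. 2 *\<^sub>R H x (g x))"
proof -
  note f' = C2_funD[OF f]
  show "C1_fun (\<lambda>x. x \<bullet> g x) (\<lambda>x. g x + H x x)" unfolding C1_fun_def
    by (auto intro!: derivative_eq_intros f' continuous_intros C2_fun_continuous_hessian_apply[OF f]
        simp: inner_add_left f'(3) inner_commute[of _ "g _"] fun_eq_iff) (metis f'(3) inner_commute)
  have "((\<lambda>x. g x \<bullet> g x) has_derivative (\<bullet>) (2 *\<^sub>R H x (g x))) (at x)" for x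
    by (rule has_derivative_eq_rhs[OF has_derivative_inner[OF f'(2) f'(2)]])
      (auto simp: f'(3) fun_eq_iff inner_commute[of _ "g _"])
  then show "C1_fun (\<lambda>x. g x \<bullet> g x) (\<lambda>x. 2 *\<^sub>R H x (g x))" unfolding C1_fun_def
    by (auto intro!: f' continuous_intros C2_fun_continuous_hessian_apply[OF f])
qed

section \<open>The Carleman estimate\<close>

lemma C1_fun_zero_on_open:
  assumes "C1_fun f g" "open S" "\<And>y. y \<in> S \<Longrightarrow> f y = 0" "x \<in> S"
  shows "g x = 0"
proof -
  have "(f has_derivative (\<lambda>h. 0)) (at x)"
    by (rule has_derivative_transform_within_open[of "\<lambda>_. 0" _ _ _ S]) (use assms in auto)
  then have "(\<lambda>h. g x \<bullet> h) = (\<lambda>h. 0)"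
    using C1_funD(1)[OF assms(1)] has_derivative_unique by blast
  then show ?thesis by (metis inner_eq_zero_iff)
qed

lemma C2_fun_zero_on_open:
  assumes f: "C2_fun f g H" and S: "open S" "\<And>y. y \<in> S \<Longrightarrow> f y = 0" "x \<in> S"
  shows "g x = 0" "H x h = 0" "trace_op (H x) = 0"
proof -
  have g0: "g y = 0" if "y \<in> S" for y
    using C1_fun_zero_on_open[OF C2_fun_imp_C1_fun[OF f] S(1) S(2) that] by simp
  then show "g x = 0" using S by simp
  have "(g has_derivative (\<lambda>h. 0)) (at x)"
    by (rule has_derivative_transform_within_open[of "\<lambda>_. 0" _ _ _ S]) (use S g0 in auto)
  then have *: "H x = (\<lambda>h. 0)"
    using C2_funD(2)[OF f] has_derivative_unique by blast
  then show "H x h = 0" "trace_op (H x) = 0" by (simp_all add: trace_op_def)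
qed

lemma C1_fun_const: "C1_fun (\<lambda>_. c) (\<lambda>_. 0)"
  unfolding C1_fun_def by (auto intro!: derivative_eq_intros)

lemma has_div_cmult:
  assumes "has_div X d"
  shows "has_div (\<lambda>x. c *\<^sub>R X x) (\<lambda>x. c * d x)"
  using has_div_scale[OF C1_fun_const assms, of c] by simp

lemma integrable_continuous_bounded_support:
  fixes f :: "'a::euclidean_space \<Rightarrow> real"
  assumes "continuous_on UNIV f" "\<And>x. x \<bullet> x > L \<Longrightarrow> f x = 0"
  shows "integrable lborel f"
proof (rule integrable_continuous_compact_support[OF assms(1), of "sqrt L"])
  fix x :: 'a assume "norm x > sqrt L"
  then have "x \<bullet> x > L"
    by (simp add: norm_eq_sqrt_inner)
  then show "f x = 0" by (rule assms(2))
qed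

text \<open>Integrates the divergence of z F grad F - (1/2) F^2 grad z, in which the terms with grad
  z . grad F cancel. Both derivatives fall on the cutoff, so no gradient of F is left on the
  right-hand side; the price is that z has to be C^2.\<close>

lemma caccioppoli_identity:
  fixes F :: "'a::euclidean_space \<Rightarrow> real"
  assumes F: "C2_fun F g H" and z: "C2_fun z gz Hz" and supp: "\<And>x. x \<bullet> x > L \<Longrightarrow> z x = 0"
  shows "(\<integral>x. z x * (g x \<bullet> g x) \<partial>lborel) =
     (\<integral>x. (1/2) * (F x)\<^sup>2 * trace_op (Hz x) - z x * F x * trace_op (H x) \<partial>lborel)"
    and "integrable lborel (\<lambda>x. z x * (g x \<bullet> g x))"
    and "integrable lborel (\<lambda>x. (1/2) * (F x)\<^sup>2 * trace_op (Hz x) - z x * F x * trace_op (H x))"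
proof -
  note zero = C2_fun_zero_on_open[OF z, of "{x. x \<bullet> x > L}"]
  have op: "open {x::'a. x \<bullet> x > L}" by (intro open_Collect_less continuous_intros)
  note F1 = F[THEN C2_fun_imp_C1_fun] and z1 = z[THEN C2_fun_imp_C1_fun]
  have d: "has_div (\<lambda>x. (z x * F x) *\<^sub>R g x + (-1/2) *\<^sub>R (F x * F x) *\<^sub>R gz x)
     (\<lambda>x. ((z x *\<^sub>R g x + F x *\<^sub>R gz x) \<bullet> g x + (z x * F x) * trace_op (H x)) +
       (-1/2) * ((F x *\<^sub>R g x + F x *\<^sub>R g x) \<bullet> gz x + (F x * F x) * trace_op (Hz x)))"
    by (intro has_div_add has_div_cmult has_div_scale C1_fun_mult F1 z1 has_div_grad[OF F] has_div_grad[OF z])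
  have d0: "(z x * F x) *\<^sub>R g x + (-1/2) *\<^sub>R (F x * F x) *\<^sub>R gz x = 0" if "norm x > sqrt L" for x :: 'a
  proof -
    have "x \<bullet> x > L" using that by (simp add: norm_eq_sqrt_inner)
    then show ?thesis using supp zero(1)[OF op] by auto
  qed
  have eq: "((z x *\<^sub>R g x + F x *\<^sub>R gz x) \<bullet> g x + (z x * F x) * trace_op (H x)) +
       (-1/2) * ((F x *\<^sub>R g x + F x *\<^sub>R g x) \<bullet> gz x + (F x * F x) * trace_op (Hz x))
      = z x * (g x \<bullet> g x) - ((1/2) * (F x)\<^sup>2 * trace_op (Hz x) - z x * F x * trace_op (H x))" for x
    by (simp add: inner_add_left inner_add_right algebra_simps power2_eq_square inner_commute)
  show i1: "integrable lborel (\<lambda>x. z x * (g x \<bullet> g x))"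
    by (rule integrable_continuous_bounded_support[of _ L])
      (use supp in \<open>auto intro!: continuous_intros C2_funD[OF F] C2_funD[OF z]\<close>)
  show i2: "integrable lborel (\<lambda>x. (1/2) * (F x)\<^sup>2 * trace_op (Hz x) - z x * F x * trace_op (H x))"
    by (rule integrable_continuous_bounded_support[of _ L])
      (use supp zero(3)[OF op] in \<open>auto intro!: continuous_intros C2_funD[OF F] C2_funD[OF z]
         C2_fun_continuous_trace[OF F] C2_fun_continuous_trace[OF z]\<close>)
  from has_div_integral(2)[OF d d0] show "(\<integral>x. z x * (g x \<bullet> g x) \<partial>lborel) =
     (\<integral>x. (1/2) * (F x)\<^sup>2 * trace_op (Hz x) - z x * F x * trace_op (H x) \<partial>lborel)"
    unfolding eq using i1 i2 by simp
qed

text \<open>Each formula is required to be differentiable only on its own closed half-line; equal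
  values and slopes at \<open>a\<close> make the one-sided difference quotients agree. This yields
  the C^2 extension of the logarithm and the truncated cubes.\<close>

lemma has_real_derivative_glue:
  fixes f g :: "real \<Rightarrow> real"
  assumes f: "\<And>s. s \<ge> a \<Longrightarrow> (f has_real_derivative f' s) (at s)"
    and g: "\<And>s. s \<le> a \<Longrightarrow> (g has_real_derivative g' s) (at s)"
    and eq: "f a = g a" "f' a = g' a"
  shows "((\<lambda>s. if s \<ge> a then f s else g s) has_real_derivative (if s \<ge> a then f' s else g' s)) (at s)"
proof (cases s a rule: linorder_cases)
  case less
  have "((\<lambda>s. if s \<ge> a then f s else g s) has_real_derivative g' s) (at s)"
    by (rule has_field_derivative_transform_within_open[OF g, of _ "{..<a}"]) (use less in auto)
  then show ?thesis using less by simp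
next
  case greater
  have "((\<lambda>s. if s \<ge> a then f s else g s) has_real_derivative f' s) (at s)"
    by (rule has_field_derivative_transform_within_open[OF f, of _ "{a<..}"]) (use greater in auto)
  then show ?thesis using greater by simp
next
  case equal
  let ?h = "\<lambda>s. if s \<ge> a then f s else g s"
  have F: "((\<lambda>y. (f y - f a) / (y - a)) \<longlongrightarrow> f' a) (at a)" and G: "((\<lambda>y. (g y - g a) / (y - a)) \<longlongrightarrow> f' a) (at a)"
    using f[of a] g[of a] eq by (auto simp: has_field_derivative_iff LIM_offset_zero_iff intro: tendsto_eq_rhs)
  have "((\<lambda>y. (?h y - ?h a) / (y - a)) \<longlongrightarrow> f' a) (at a)"
  proof (rule filterlim_split_at)
    show "((\<lambda>y. (?h y - ?h a) / (y - a)) \<longlongrightarrow> f' a) (at_left a)"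
      by (rule Lim_transform_eventually[OF filterlim_mono[OF G order_refl at_le]])
        (use eq in \<open>auto simp: eventually_at_filter intro!: always_eventually\<close>)
    show "((\<lambda>y. (?h y - ?h a) / (y - a)) \<longlongrightarrow> f' a) (at_right a)"
      by (rule Lim_transform_eventually[OF filterlim_mono[OF F order_refl at_le]])
        (use eq in \<open>auto simp: eventually_at_filter intro!: always_eventually\<close>)
  qed
  then show ?thesis using equal by (simp add: has_field_derivative_iff LIM_offset_zero_iff)
qed

text \<open>\<open>ln_ext a\<close> is a \<open>C\<^sup>2\<close> extension of \<open>ln\<close> from \<open>[a, \<infinity>)\<close> to the real line, and \<open>inv_ext a\<close> is its
  derivative. For functions vanishing on \<open>\<bar>x\<bar>\<^sup>2 < a\<close> they turn the weights into globally smooth ones.\<close>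
definition inv_ext :: "real \<Rightarrow> real \<Rightarrow> real" where
  "inv_ext a s = (if s \<ge> a then 1 / s else 2 / a - s / a\<^sup>2)"

definition ln_ext :: "real \<Rightarrow> real \<Rightarrow> real" where
  "ln_ext a s = (if s \<ge> a then ln s else ln a - 3/2 + 2 * s / a - s\<^sup>2 / (2 * a\<^sup>2))"

lemma inv_ext_deriv:
  assumes "a > 0"
  shows "(inv_ext a has_real_derivative - 1 / (max a s)\<^sup>2) (at s)"
proof -
  have "((\<lambda>s. if s \<ge> a then 1 / s else 2 / a - s / a\<^sup>2) has_real_derivative
     (if s \<ge> a then - 1 / s\<^sup>2 else - 1 / a\<^sup>2)) (at s)"
    by (rule has_real_derivative_glue)
      (use assms in \<open>auto intro!: derivative_eq_intros simp: power2_eq_square field_simps\<close>)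
  then show ?thesis by (simp add: inv_ext_def[abs_def] max_def split: if_splits)
qed

lemma inv_ext_continuous: "a > 0 \<Longrightarrow> continuous_on A (inv_ext a)"
  by (meson inv_ext_deriv DERIV_isCont continuous_at_imp_continuous_on)

lemma ln_ext_deriv:
  assumes "a > 0"
  shows "(ln_ext a has_real_derivative inv_ext a s) (at s)"
proof -
  have "((\<lambda>s. if s \<ge> a then ln s else ln a - 3/2 + 2 * s / a - s\<^sup>2 / (2 * a\<^sup>2)) has_real_derivative
     (if s \<ge> a then 1 / s else 2 / a - s / a\<^sup>2)) (at s)"
    by (rule has_real_derivative_glue)
      (use assms in \<open>auto intro!: derivative_eq_intros simp: power2_eq_square field_simps\<close>)
  then show ?thesis by (simp add: ln_ext_def[abs_def] inv_ext_def)
qed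

text \<open>For \<open>w = e\<^sup>\<tau> u\<close> with \<open>\<tau> = - (\<alpha>/2) ln s + \<alpha> b s\<close> and \<open>s = \<bar>x\<bar>\<^sup>2\<close>, the function \<open>Q\<close> is \<open>s e\<^sup>\<tau> \<Delta>u\<close>, and
  \<open>p\<close> and \<open>k\<close> come from \<open>s \<nabla>\<tau> = p x\<close> and \<open>s \<Delta>\<tau> = k\<close>. With respect to the measure \<open>dx / s\<close> it splits into
  a symmetric part \<open>s \<Delta>w + p\<^sup>2 w\<close> and an antisymmetric part \<open>- 2 p x\<cdot>\<nabla>w - k w\<close>. Twice their product is a
  divergence plus \<open>16 \<alpha> b (x\<cdot>\<nabla>w)\<^sup>2\<close> plus the left-hand integrand: the terms in \<open>\<bar>\<nabla>w\<bar>\<^sup>2\<close> cancel.\<close>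
lemma carleman_conjugated:
  fixes w :: "'a::euclidean_space \<Rightarrow> real" and \<alpha> b :: real
  defines "(p :: 'a \<Rightarrow> real) \<equiv> \<lambda>x::'a. \<alpha> * (2 * b * (x \<bullet> x) - 1)"
  defines "(k :: 'a \<Rightarrow> real) \<equiv> \<lambda>x::'a. (real DIM('a) - 2) * p x + 4 * \<alpha> * b * (x \<bullet> x)"
  defines "(Q :: ('a \<Rightarrow> 'a) \<Rightarrow> ('a \<Rightarrow> 'a \<Rightarrow> 'a) \<Rightarrow> 'a \<Rightarrow> real) \<equiv> \<lambda>g H x. (x \<bullet> x) * trace_op (H x) - 2 * p x * (x \<bullet> g x) + ((p x)\<^sup>2 - k x) * w x"
  assumes w: "C2_fun w g H" and a: "a > 0" and b: "b \<ge> 0" and \<alpha>: "\<alpha> \<ge> 0"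
    and in0: "\<And>x. x \<bullet> x < a \<Longrightarrow> w x = 0" and out0: "\<And>x. x \<bullet> x > L \<Longrightarrow> w x = 0"
  shows "integrable lborel (\<lambda>x. 4 * \<alpha> * b * (4 * (p x)\<^sup>2 - (real DIM('a))\<^sup>2) * (w x)\<^sup>2)"
    and "integrable lborel (\<lambda>x. 1 / (x \<bullet> x) * (Q g H x)\<^sup>2)"
    and "(\<integral>x. 4 * \<alpha> * b * (4 * (p x)\<^sup>2 - (real DIM('a))\<^sup>2) * (w x)\<^sup>2 \<partial>lborel)
      \<le> (\<integral>x. 1 / (x \<bullet> x) * (Q g H x)\<^sup>2 \<partial>lborel)"
proof -
  define d where "d = real DIM('a)"
  have k_eq: "k x = (d - 2) * p x + 4 * \<alpha> * b * (x \<bullet> x)" for x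
    by (simp add: k_def d_def)
  define \<kappa> where "\<kappa> = inv_ext a"
  have op_in: "open {x::'a. x \<bullet> x < a}" and op_out: "open {x::'a. x \<bullet> x > L}"
    by (intro open_Collect_less continuous_intros)+
  note z_in = C2_fun_zero_on_open[OF w op_in, simplified, OF in0]
  note z_out = C2_fun_zero_on_open[OF w op_out, simplified, OF out0]
  note w1 = w[THEN C2_fun_imp_C1_fun]
  have p1: "C1_fun p (\<lambda>x. (4 * \<alpha> * b) *\<^sub>R x)"
  proof -
    have "C1_fun (\<lambda>x::'a. \<alpha> * (2 * b * (x \<bullet> x) - 1)) (\<lambda>x. (2 * (\<alpha> * (2 * b))) *\<^sub>R x)"
      by (rule C1_fun_radial[of "\<lambda>s. \<alpha> * (2 * b * s - 1)" "\<lambda>_. \<alpha> * (2 * b)"])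
        (auto intro!: derivative_eq_intros)
    then show ?thesis by (simp add: p_def mult_ac)
  qed
  have k1: "C1_fun k (\<lambda>x. (4 * d * \<alpha> * b) *\<^sub>R x)"
  proof -
    have "C1_fun (\<lambda>x::'a. (d - 2) * (\<alpha> * (2 * b * (x \<bullet> x) - 1)) + 4 * \<alpha> * b * (x \<bullet> x)) (\<lambda>x. (2 * (2 * d * \<alpha> * b)) *\<^sub>R x)"
      by (rule C1_fun_radial[of "\<lambda>s. (d - 2) * (\<alpha> * (2 * b * s - 1)) + 4 * \<alpha> * b * s" "\<lambda>_. 2 * d * \<alpha> * b"])
       (auto intro!: derivative_eq_intros simp: algebra_simps)
    then show ?thesis by (simp add: k_def p_def d_def mult_ac)
  qed
  \<comment> \<open>Equals p^3 / |x|^2 where |x|^2 >= a, that is, wherever w can be nonzero; the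
    extended reciprocal makes it C^1 on the whole space.\<close>
  define r where "r x = (p x) ^ 3 * \<kappa> (x \<bullet> x)" for x
  define r' where "r' x = 3 * (p x)\<^sup>2 * (2 * \<alpha> * b) * \<kappa> (x \<bullet> x) + (p x) ^ 3 * (- 1 / (max a (x \<bullet> x))\<^sup>2)" for x
  have r1: "C1_fun r (\<lambda>x. (2 * r' x) *\<^sub>R x)"
  proof -
    have "C1_fun (\<lambda>x::'a. (\<alpha> * (2 * b * (x \<bullet> x) - 1)) ^ 3 * \<kappa> (x \<bullet> x))
       (\<lambda>x. (2 * (3 * (\<alpha> * (2 * b * (x \<bullet> x) - 1))\<^sup>2 * (2 * \<alpha> * b) * \<kappa> (x \<bullet> x) + (\<alpha> * (2 * b * (x \<bullet> x) - 1)) ^ 3 * (- 1 / (max a (x \<bullet> x))\<^sup>2))) *\<^sub>R x)"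
      by (rule C1_fun_radial[of "\<lambda>s. (\<alpha> * (2 * b * s - 1)) ^ 3 * \<kappa> s"
         "\<lambda>s. 3 * (\<alpha> * (2 * b * s - 1))\<^sup>2 * (2 * \<alpha> * b) * \<kappa> s + (\<alpha> * (2 * b * s - 1)) ^ 3 * (- 1 / (max a s)\<^sup>2)"])
       (use a in \<open>auto intro!: derivative_eq_intros continuous_intros inv_ext_deriv inv_ext_continuous
          simp: \<kappa>_def power2_eq_square\<close>)
    then show ?thesis by (simp add: r_def[abs_def] r'_def[abs_def] p_def)
  qed
  note wg = C1_fun_inner_grad[OF w]
  \<comment> \<open>The first two summands integrate -4 p (x . grad w) times the Laplacian by parts,
    as in Rellich's identity. The third and fourth do so for -2 k w times the Laplacian, using grad
    k = 4 d alpha b x. The last rewrites -4 r w (x . grad w) as -2 r x . grad (w^2).\<close>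
  define Y where "Y x = (-4) *\<^sub>R ((p x * (x \<bullet> g x)) *\<^sub>R g x) + (2 *\<^sub>R ((p x * (g x \<bullet> g x)) *\<^sub>R x) +
     ((-2) *\<^sub>R ((k x * w x) *\<^sub>R g x) + ((4 * d * \<alpha> * b) *\<^sub>R ((w x * w x) *\<^sub>R x) + (-2) *\<^sub>R ((r x * (w x * w x)) *\<^sub>R x))))" for x
  define D where "D x = (-4) * ((p x *\<^sub>R (g x + H x x) + (x \<bullet> g x) *\<^sub>R ((4 * \<alpha> * b) *\<^sub>R x)) \<bullet> g x + (p x * (x \<bullet> g x)) * trace_op (H x))
    + (2 * ((p x *\<^sub>R (2 *\<^sub>R H x (g x)) + (g x \<bullet> g x) *\<^sub>R ((4 * \<alpha> * b) *\<^sub>R x)) \<bullet> x + (p x * (g x \<bullet> g x)) * real DIM('a))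
    + ((-2) * ((k x *\<^sub>R g x + w x *\<^sub>R ((4 * d * \<alpha> * b) *\<^sub>R x)) \<bullet> g x + (k x * w x) * trace_op (H x))
    + ((4 * d * \<alpha> * b) * ((w x *\<^sub>R g x + w x *\<^sub>R g x) \<bullet> x + (w x * w x) * real DIM('a))
    + (-2) * ((r x *\<^sub>R (w x *\<^sub>R g x + w x *\<^sub>R g x) + (w x * w x) *\<^sub>R ((2 * r' x) *\<^sub>R x)) \<bullet> x + (r x * (w x * w x)) * real DIM('a)))))" for x
  have div: "has_div Y D" unfolding Y_def[abs_def] D_def[abs_def]
    by (intro has_div_add has_div_cmult has_div_scale C1_fun_mult p1 w1 k1 r1 wg has_div_grad[OF w] has_div_id)
  have Y0: "Y x = 0" if "norm x > sqrt L" for x :: 'a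
  proof -
    have "x \<bullet> x > L" using that by (simp add: norm_eq_sqrt_inner)
    then show ?thesis using out0 z_out by (simp add: Y_def)
  qed
  note iD = has_div_integral[OF div Y0]
  note cw = C2_funD[OF w] and cp = C1_funD(3)[OF p1] and ck = C1_funD(3)[OF k1]
  have cL: "continuous_on UNIV (\<lambda>x. trace_op (H x))" by (rule C2_fun_continuous_trace[OF w])
  show i1: "integrable lborel (\<lambda>x. 4 * \<alpha> * b * (4 * (p x)\<^sup>2 - (real DIM('a))\<^sup>2) * (w x)\<^sup>2)"
    by (rule integrable_continuous_bounded_support[of _ L])
      (use out0 in \<open>auto intro!: continuous_intros cw cp\<close>)
  have c\<kappa>: "continuous_on UNIV (\<lambda>x::'a. \<kappa> (x \<bullet> x))"
    by (rule continuous_on_compose2[of UNIV \<kappa>])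
      (auto intro!: continuous_intros inv_ext_continuous a simp: \<kappa>_def)
  \<comment> \<open>Near the origin \<open>Q g H\<close> vanishes together with w, so the singular
    factor, including its default value at x = 0, may be replaced by a continuous one.\<close>
  have \<kappa>Q: "1 / (x \<bullet> x) * (Q g H x)\<^sup>2 = \<kappa> (x \<bullet> x) * (Q g H x)\<^sup>2" for x
    using z_in[of x] in0[of x] by (cases "x \<bullet> x < a") (auto simp: Q_def \<kappa>_def inv_ext_def)
  have "integrable lborel (\<lambda>x. \<kappa> (x \<bullet> x) * (Q g H x)\<^sup>2)"
    by (rule integrable_continuous_bounded_support[of _ L])
      (use out0 z_out in \<open>auto intro!: continuous_intros cw cp ck cL c\<kappa> simp: Q_def\<close>)
  then show i2: "integrable lborel (\<lambda>x. 1 / (x \<bullet> x) * (Q g H x)\<^sup>2)" unfolding \<kappa>Q .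
  have key: "4 * \<alpha> * b * (4 * (p x)\<^sup>2 - (real DIM('a))\<^sup>2) * (w x)\<^sup>2 + D x \<le> 1 / (x \<bullet> x) * (Q g H x)\<^sup>2" for x
  proof (cases "x \<bullet> x < a")
    case True
    then show ?thesis using z_in[of x] in0[of x] by (simp add: D_def)
  next
    case False
    define s where "s = x \<bullet> x"
    have s: "s \<ge> a" "s > 0" using False a by (auto simp: s_def)
    define G Dw L xHg where "G = g x \<bullet> g x" and "Dw = x \<bullet> g x" and "L = trace_op (H x)" and "xHg = x \<bullet> H x (g x)"
    have e: "H x x \<bullet> g x = xHg" "H x (g x) \<bullet> x = xHg" "g x \<bullet> x = Dw"
      using cw(3) by (auto simp: xHg_def Dw_def inner_commute)
    have \<kappa>1: "\<kappa> s = 1 / s" "max a s = s" using s by (auto simp: \<kappa>_def inv_ext_def)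
    define P where "P = p x"
    have Pb: "2 * \<alpha> * b * s = P + \<alpha>" by (simp add: P_def p_def s_def algebra_simps)
    define K where "K = (d - 2) * P + 4 * \<alpha> * b * s"
    have KK: "k x = K" by (simp add: k_eq K_def P_def s_def)
    define W where "W = w x"
    have "D x = (-4) * (P * (G + xHg) + 4 * \<alpha> * b * Dw\<^sup>2 + P * Dw * L)
       + 2 * (P * 2 * xHg + G * (4 * \<alpha> * b) * s + P * G * d)
       - 2 * (K * G + W * (4 * d * \<alpha> * b) * Dw + K * W * L)
       + 4 * d * \<alpha> * b * (2 * W * Dw + W\<^sup>2 * d)
       - 2 * (P ^ 3 / s * 2 * W * Dw + W\<^sup>2 * (2 * (3 * P\<^sup>2 * (2 * \<alpha> * b) / s - P ^ 3 / s\<^sup>2)) * s + P ^ 3 / s * W\<^sup>2 * d)"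
      unfolding D_def r_def r'_def KK
      unfolding s_def[symmetric] P_def[symmetric] W_def[symmetric] \<kappa>1
      by (simp add: inner_add_left e Dw_def[symmetric] G_def[symmetric] L_def[symmetric] s_def[symmetric]
          d_def[symmetric] power2_eq_square algebra_simps)
    note Dx = this
    \<comment> \<open>The coefficient of |grad w|^2 is 4 p - 8 alpha b s - 2 d p + 2 k, which
      vanishes by the form of k. In the coefficient of w^2 the multiples of p^3 / s cancel too; 24
      alpha b p^2 from the divergence of r x and -8 alpha b p^2 from k leave 16 alpha b p^2, and -4
      d^2 alpha b comes from the fourth summand of \<open>Y\<close>.\<close>
    have "4 * \<alpha> * b * (4 * P\<^sup>2 - d\<^sup>2) * W\<^sup>2 + D x + 16 * \<alpha> * b * Dw\<^sup>2
         = 2 * (L + P\<^sup>2 / s * W) * (- 2 * P * Dw - K * W)"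
    proof -
      define e where "e = P\<^sup>2 / s"
      have "P ^ 3 / s = P * e" "(2 * (3 * P\<^sup>2 * (2 * \<alpha> * b) / s - P ^ 3 / s\<^sup>2)) * s = 12 * \<alpha> * b * P\<^sup>2 - 2 * P * e"
        "P\<^sup>2 / s = e"
        using s by (simp_all add: e_def field_simps power2_eq_square power3_eq_cube)
      note e = this
      have se: "s * e = P * P" using s by (simp add: e_def power2_eq_square)
      have "W\<^sup>2 * (2 * (3 * P\<^sup>2 * (2 * \<alpha> * b) / s - P ^ 3 / s\<^sup>2)) * s = W\<^sup>2 * (12 * \<alpha> * b * P\<^sup>2 - 2 * P * e)"
        by (simp only: mult.assoc[of "W\<^sup>2"] e(2))
      note D = Dx[unfolded this e]
      have seX: "s * (e * X) = P * P * X" for X using se by (metis mult.assoc)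
      have seX2: "e * (s * X) = P * P * X" for X using se by (metis mult.assoc mult.commute)
      show ?thesis unfolding D K_def e
        by (simp add: algebra_simps power2_eq_square se seX seX2)
    qed
    also have "\<dots> = 1 / s * (2 * (s * L + P\<^sup>2 * W) * (- 2 * P * Dw - K * W))"
      using s by (simp add: field_simps)
    also have "\<dots> \<le> 1 / s * (s * L - 2 * P * Dw + (P\<^sup>2 - K) * W)\<^sup>2"
    proof (rule mult_left_mono)
      have "(s * L - 2 * P * Dw + (P\<^sup>2 - K) * W)\<^sup>2 - 2 * (s * L + P\<^sup>2 * W) * (- 2 * P * Dw - K * W)
        = (s * L + P\<^sup>2 * W)\<^sup>2 + (- 2 * P * Dw - K * W)\<^sup>2" by (simp add: power2_eq_square algebra_simps)
      then show "2 * (s * L + P\<^sup>2 * W) * (- 2 * P * Dw - K * W) \<le> (s * L - 2 * P * Dw + (P\<^sup>2 - K) * W)\<^sup>2"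
        by (metis diff_ge_0_iff_ge sum_power2_ge_zero)
    qed (use s in auto)
    also have "(s * L - 2 * P * Dw + (P\<^sup>2 - K) * W) = Q g H x"
      by (simp add: Q_def KK s_def L_def P_def Dw_def W_def)
    finally have "4 * \<alpha> * b * (4 * P\<^sup>2 - d\<^sup>2) * W\<^sup>2 + D x + 16 * \<alpha> * b * Dw\<^sup>2 \<le> 1 / s * (Q g H x)\<^sup>2" .
    moreover have "16 * \<alpha> * b * Dw\<^sup>2 \<ge> 0" using \<alpha> b by simp
    ultimately show ?thesis by (simp add: P_def W_def s_def d_def)
  qed
  have "(\<integral>x. 4 * \<alpha> * b * (4 * (p x)\<^sup>2 - (real DIM('a))\<^sup>2) * (w x)\<^sup>2 \<partial>lborel)
     = (\<integral>x. 4 * \<alpha> * b * (4 * (p x)\<^sup>2 - (real DIM('a))\<^sup>2) * (w x)\<^sup>2 + D x \<partial>lborel)"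
    using i1 iD by simp
  also have "\<dots> \<le> (\<integral>x. 1 / (x \<bullet> x) * (Q g H x)\<^sup>2 \<partial>lborel)"
    using i1 iD i2 key by (intro integral_mono) auto
  finally show "(\<integral>x. 4 * \<alpha> * b * (4 * (p x)\<^sup>2 - (real DIM('a))\<^sup>2) * (w x)\<^sup>2 \<partial>lborel)
      \<le> (\<integral>x. 1 / (x \<bullet> x) * (Q g H x)\<^sup>2 \<partial>lborel)" .
qed

text \<open>For s > 0 this is e^(2 tau). At s = 0 \<open>powr\<close> returns 0, which is harmless
  because the functions integrated against the weight vanish near the origin.\<close>

definition carleman_weight :: "real \<Rightarrow> real \<Rightarrow> real \<Rightarrow> real" where
  "carleman_weight \<alpha> b s = s powr (-\<alpha>) * exp (2 * \<alpha> * b * s)"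

text \<open>The conjugated estimate is applied to w = e^tau u. On the support of u the condition on
  b L gives 1 - 2 b |x|^2 >= 1/2, hence 4 p^2 >= alpha^2, while alpha >= 2 d makes d^2 at most a
  quarter of alpha^2. So the coefficient 4 alpha b (4 p^2 - d^2) is at least 2 alpha^3 b.\<close>

lemma carleman_estimate:
  fixes u :: "'a::euclidean_space \<Rightarrow> real" and \<alpha> b :: real
  defines "(E :: 'a \<Rightarrow> real) \<equiv> \<lambda>x. carleman_weight \<alpha> b (x \<bullet> x)"
  assumes u: "C2_fun u g H" and a: "a > 0" and b: "b \<ge> 0" and \<alpha>: "\<alpha> \<ge> 2 * real DIM('a)"
    and in0: "\<And>x. x \<bullet> x < a \<Longrightarrow> u x = 0" and out0: "\<And>x. x \<bullet> x > L \<Longrightarrow> u x = 0"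
    and bL: "4 * b * L \<le> 1"
  shows "integrable lborel (\<lambda>x. E x * (u x)\<^sup>2)"
    and "integrable lborel (\<lambda>x. (x \<bullet> x) * E x * (trace_op (H x))\<^sup>2)"
    and "2 * \<alpha> ^ 3 * b * (\<integral>x. E x * (u x)\<^sup>2 \<partial>lborel)
      \<le> (\<integral>x. (x \<bullet> x) * E x * (trace_op (H x))\<^sup>2 \<partial>lborel)"
proof -
  define d where "d = real DIM('a)"
  have d: "d \<ge> 1" by (simp add: d_def Suc_leI)
  have \<alpha>0: "\<alpha> \<ge> 2 * d" "\<alpha> > 0" using \<alpha> d unfolding d_def by linarith+
  have "open {x::'a. x \<bullet> x < a}" "open {x::'a. x \<bullet> x > L}"
    by (intro open_Collect_less continuous_intros)+
  note z_in = C2_fun_zero_on_open[OF u this(1), simplified, OF in0]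
   and z_out = C2_fun_zero_on_open[OF u this(2), simplified, OF out0]
  \<comment> \<open>This is e^tau with the logarithm replaced by its extension, hence C^2
    everywhere; u vanishes where the two differ.\<close>
  define W where "W s = exp (- (\<alpha>/2) * ln_ext a s + \<alpha> * b * s)" for s
  define t where "t s = - (\<alpha>/2) * inv_ext a s + \<alpha> * b" for s
  define t' where "t' s = (\<alpha>/2) / (max a s)\<^sup>2" for s
  have W1: "(W has_real_derivative W s * t s) (at s)" for s
    unfolding W_def t_def by (auto intro!: derivative_eq_intros ln_ext_deriv a simp: algebra_simps)
  have t1: "(t has_real_derivative t' s) (at s)" for s
    unfolding t_def t'_def by (auto intro!: derivative_eq_intros inv_ext_deriv a)
  have W2: "((\<lambda>s. W s * t s) has_real_derivative W s * ((t s)\<^sup>2 + t' s)) (at s)" for s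
    by (auto intro!: derivative_eq_intros W1 t1 simp: algebra_simps power2_eq_square)
  have cont: "continuous_on UNIV W" "continuous_on UNIV t"
    using W1 t1 by (meson DERIV_isCont continuous_at_imp_continuous_on)+
  have cont': "continuous_on UNIV t'"
    unfolding t'_def using a by (intro continuous_intros) (auto simp: max_def split: if_splits)
  have R: "C2_fun (\<lambda>x::'a. W (x \<bullet> x)) (\<lambda>x. (2 * (W (x \<bullet> x) * t (x \<bullet> x))) *\<^sub>R x)
     (\<lambda>x h. (2 * (W (x \<bullet> x) * t (x \<bullet> x))) *\<^sub>R h + (4 * (W (x \<bullet> x) * ((t (x \<bullet> x))\<^sup>2 + t' (x \<bullet> x))) * (x \<bullet> h)) *\<^sub>R x)"
    by (rule C2_fun_radial[OF W1 W2]) (intro continuous_intros cont cont')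
  note w = C2_fun_mult[OF R u]
  define w where "w x = W (x \<bullet> x) * u x" for x
  define gw where "gw x = W (x \<bullet> x) *\<^sub>R g x + u x *\<^sub>R ((2 * (W (x \<bullet> x) * t (x \<bullet> x))) *\<^sub>R x)" for x
  define Hw where "Hw x h = W (x \<bullet> x) *\<^sub>R H x h + u x *\<^sub>R ((2 * (W (x \<bullet> x) * t (x \<bullet> x))) *\<^sub>R h + (4 * (W (x \<bullet> x) * ((t (x \<bullet> x))\<^sup>2 + t' (x \<bullet> x))) * (x \<bullet> h)) *\<^sub>R x)
    + ((2 * (W (x \<bullet> x) * t (x \<bullet> x))) *\<^sub>R x \<bullet> h) *\<^sub>R g x + (g x \<bullet> h) *\<^sub>R ((2 * (W (x \<bullet> x) * t (x \<bullet> x))) *\<^sub>R x)" for x h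
  have C2w: "C2_fun w gw Hw"
    using w unfolding w_def[abs_def] gw_def[abs_def] Hw_def[abs_def] .
  have w_in: "w x = 0" if "x \<bullet> x < a" for x using in0 that by (simp add: w_def)
  have w_out: "w x = 0" if "x \<bullet> x > L" for x using out0 that by (simp add: w_def)
  have lap: "trace_op (Hw x) = W (x \<bullet> x) * trace_op (H x) +
      u x * (d * (2 * (W (x \<bullet> x) * t (x \<bullet> x))) + 4 * (W (x \<bullet> x) * ((t (x \<bullet> x))\<^sup>2 + t' (x \<bullet> x))) * (x \<bullet> x))
      + 2 * (2 * (W (x \<bullet> x) * t (x \<bullet> x)) * (x \<bullet> g x))" for x
    unfolding Hw_def[abs_def] trace_op_mult d_def by (simp add: trace_op_radial)
  define p where "p x = \<alpha> * (2 * b * (x \<bullet> x) - 1)" for x :: 'a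
  define k where "k x = (d - 2) * p x + 4 * \<alpha> * b * (x \<bullet> x)" for x :: 'a
  define Q where "Q x = (x \<bullet> x) * trace_op (Hw x) - 2 * p x * (x \<bullet> gw x) + ((p x)\<^sup>2 - k x) * w x" for x
  have E: "E x = (W (x \<bullet> x))\<^sup>2" if "x \<bullet> x \<ge> a" for x
  proof -
    have "x \<bullet> x > 0" using that a by linarith
    then show ?thesis using that
      by (simp add: E_def carleman_weight_def W_def ln_ext_def powr_def exp_add[symmetric] exp_double[symmetric] algebra_simps)
  qed
  have Ew: "(w x)\<^sup>2 = E x * (u x)\<^sup>2" for x
    using in0[of x] E[of x] by (cases "x \<bullet> x < a") (auto simp: w_def power_mult_distrib)
  have QE: "1 / (x \<bullet> x) * (Q x)\<^sup>2 = (x \<bullet> x) * E x * (trace_op (H x))\<^sup>2" for x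
  proof (cases "x \<bullet> x < a")
    case True
    then show ?thesis using in0[of x] z_in[of x] by (simp add: Q_def lap w_def gw_def)
  next
    case False
    define s where "s = x \<bullet> x"
    have s: "s \<ge> a" "s > 0" using False a by (auto simp: s_def)
    have ts: "t s = p x / (2 * s)" "t' s = \<alpha> / (2 * s\<^sup>2)"
      using s by (auto simp: t_def t'_def p_def s_def[symmetric] inv_ext_def max_def field_simps)
    define P where "P = p x"
    have P: "P = \<alpha> * (2 * b * s - 1)" by (simp add: P_def p_def s_def)
    define Dg where "Dg = x \<bullet> g x"
    define T where "T = trace_op (H x)"
    have "Q x = s * (W s * T + u x * (d * (2 * (W s * (P / (2 * s)))) + 4 * (W s * ((P / (2 * s))\<^sup>2 + \<alpha> / (2 * s\<^sup>2))) * s)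
      + 2 * (2 * (W s * (P / (2 * s))) * Dg)) - 2 * P * (W s * Dg + u x * (2 * (W s * (P / (2 * s)))) * s)
      + (P\<^sup>2 - ((d - 2) * P + 4 * \<alpha> * b * s)) * (W s * u x)"
      unfolding Q_def lap gw_def w_def k_def unfolding s_def[symmetric] ts P_def[symmetric]
      by (simp add: inner_add_right s_def[symmetric] Dg_def[symmetric] T_def[symmetric] P_def[symmetric])
    also have "\<dots> = W s * (s * T)"
      using s unfolding P by (simp add: field_simps power2_eq_square)
    finally have "1 / s * (Q x)\<^sup>2 = s * (W s)\<^sup>2 * T\<^sup>2"
      using s by (simp add: power2_eq_square)
    then show ?thesis using E[of x] False by (simp add: s_def T_def)
  qed
  note C = carleman_conjugated[OF C2w a b less_imp_le[OF \<alpha>0(2)] w_in w_out, folded d_def p_def, folded k_def, folded Q_def]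
  show i2: "integrable lborel (\<lambda>x. (x \<bullet> x) * E x * (trace_op (H x))\<^sup>2)"
    using C(2) unfolding QE .
  have iw: "integrable lborel (\<lambda>x. (w x)\<^sup>2)"
    by (rule integrable_continuous_bounded_support[of _ L])
      (use w_out in \<open>auto intro!: continuous_intros C2_funD[OF C2w]\<close>)
  then show i1: "integrable lborel (\<lambda>x. E x * (u x)\<^sup>2)" unfolding Ew .
  have "2 * \<alpha> ^ 3 * b * (\<integral>x. E x * (u x)\<^sup>2 \<partial>lborel) = (\<integral>x. 2 * \<alpha> ^ 3 * b * (w x)\<^sup>2 \<partial>lborel)"
    unfolding Ew by simp
  also have "\<dots> \<le> (\<integral>x. 4 * \<alpha> * b * (4 * (p x)\<^sup>2 - d\<^sup>2) * (w x)\<^sup>2 \<partial>lborel)"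
  proof (rule integral_mono[OF _ C(1)])
    show "integrable lborel (\<lambda>x. 2 * \<alpha> ^ 3 * b * (w x)\<^sup>2)" using iw by simp
    fix x
    show "2 * \<alpha> ^ 3 * b * (w x)\<^sup>2 \<le> 4 * \<alpha> * b * (4 * (p x)\<^sup>2 - d\<^sup>2) * (w x)\<^sup>2"
    proof (cases "x \<bullet> x > L")
      case False
      have "4 * b * (x \<bullet> x) \<le> 4 * b * L" using False b by (intro mult_left_mono) auto
      then have "1/2 \<le> 1 - 2 * b * (x \<bullet> x)" using bL by linarith
      then have "(\<alpha> * (1/2))\<^sup>2 \<le> (\<alpha> * (1 - 2 * b * (x \<bullet> x)))\<^sup>2"
        using \<alpha>0 by (intro power_mono mult_left_mono) auto
      moreover have "(\<alpha> * (1 - 2 * b * (x \<bullet> x)))\<^sup>2 = (p x)\<^sup>2"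
        by (simp add: p_def power2_eq_square algebra_simps)
      ultimately have p4: "\<alpha>\<^sup>2 \<le> 4 * (p x)\<^sup>2" by (simp add: power2_eq_square)
      have "(2 * d)\<^sup>2 \<le> \<alpha>\<^sup>2" using \<alpha>0 d by (intro power_mono) auto
      then have "4 * d\<^sup>2 \<le> \<alpha>\<^sup>2" by (simp add: power_mult_distrib)
      then have "\<alpha>\<^sup>2 / 2 \<le> 4 * (p x)\<^sup>2 - d\<^sup>2" using p4 zero_le_power2[of d] by linarith
      then have "4 * \<alpha> * b * (w x)\<^sup>2 * (\<alpha>\<^sup>2 / 2) \<le> 4 * \<alpha> * b * (w x)\<^sup>2 * (4 * (p x)\<^sup>2 - d\<^sup>2)"
        using \<alpha>0 b by (intro mult_left_mono) auto
      then show ?thesis by (simp add: power2_eq_square power3_eq_cube algebra_simps)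
    qed (simp add: w_out)
  qed
  also have "\<dots> \<le> (\<integral>x. (x \<bullet> x) * E x * (trace_op (H x))\<^sup>2 \<partial>lborel)"
    using C(3) unfolding QE .
  finally show "2 * \<alpha> ^ 3 * b * (\<integral>x. E x * (u x)\<^sup>2 \<partial>lborel)
      \<le> (\<integral>x. (x \<bullet> x) * E x * (trace_op (H x))\<^sup>2 \<partial>lborel)" .
qed

section \<open>Cutoff functions and Caccioppoli's inequality\<close>

definition cube_plus :: "real \<Rightarrow> real" where "cube_plus t = (if t \<ge> 0 then t ^ 3 else 0)"

lemma cube_plus_deriv: "(cube_plus has_real_derivative 3 * (max 0 t)\<^sup>2) (at t)"
proof -
  have "((\<lambda>t. if t \<ge> 0 then t ^ 3 else 0) has_real_derivative (if t \<ge> 0 then 3 * t\<^sup>2 else 0)) (at t)"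
    by (rule has_real_derivative_glue) (auto intro!: derivative_eq_intros)
  then show ?thesis by (simp add: cube_plus_def[abs_def] max_def split: if_splits)
qed

lemma square_plus_deriv: "((\<lambda>t. 3 * (max 0 t)\<^sup>2) has_real_derivative 6 * max 0 t) (at t)"
proof -
  have "((\<lambda>t. if t \<ge> 0 then 3 * t\<^sup>2 else 0) has_real_derivative (if t \<ge> 0 then 6 * t else 0)) (at t)"
    by (rule has_real_derivative_glue) (auto intro!: derivative_eq_intros)
  moreover have "(\<lambda>t. if t \<ge> 0 then 3 * t\<^sup>2 else 0) = (\<lambda>t::real. 3 * (max 0 t)\<^sup>2)"
    by (auto simp: max_def fun_eq_iff)
  ultimately show ?thesis by (simp add: max_def split: if_splits)
qed

text \<open>On [0, 1] this is 1 - (1 - t^3)^3: the inner truncated cube flattens the transition to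
  second order at 0, the outer one at 1. A piecewise polynomial gives explicit bounds for the
  derivatives.\<close>

definition step :: "real \<Rightarrow> real" where "step t = 1 - cube_plus (1 - cube_plus t)"
definition step' :: "real \<Rightarrow> real" where
  "step' t = 3 * (max 0 (1 - cube_plus t))\<^sup>2 * (3 * (max 0 t)\<^sup>2)"
definition step'' :: "real \<Rightarrow> real" where
  "step'' t = 3 * (max 0 (1 - cube_plus t))\<^sup>2 * (6 * max 0 t)
     - 6 * max 0 (1 - cube_plus t) * (3 * (max 0 t)\<^sup>2)\<^sup>2"

lemma step_deriv: "(step has_real_derivative step' t) (at t)"
  unfolding step_def[abs_def] step'_def
  by (auto intro!: derivative_eq_intros DERIV_chain2[OF cube_plus_deriv] cube_plus_deriv)

lemma step'_deriv: "(step' has_real_derivative step'' t) (at t)"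
proof -
  have "((\<lambda>t. 1 - cube_plus t) has_real_derivative - (3 * (max 0 t)\<^sup>2)) (at t)"
    by (auto intro!: derivative_eq_intros cube_plus_deriv)
  from DERIV_mult[OF DERIV_chain2[OF square_plus_deriv this] square_plus_deriv]
  show ?thesis unfolding step'_def[abs_def] step''_def
    by (rule DERIV_cong) (simp add: algebra_simps power2_eq_square)
qed

lemma step''_continuous: "continuous_on A step''"
proof -
  have "continuous_on A cube_plus"
    by (meson cube_plus_deriv DERIV_isCont continuous_at_imp_continuous_on)
  then show ?thesis unfolding step''_def[abs_def] by (intro continuous_intros)
qed

lemma step_eq_0: "t \<le> 0 \<Longrightarrow> step t = 0" "t \<le> 0 \<Longrightarrow> step' t = 0" "t \<le> 0 \<Longrightarrow> step'' t = 0"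
  by (auto simp: step_def step'_def step''_def cube_plus_def)

lemma step_eq_1:
  assumes "t \<ge> 1"
  shows "step t = 1" "step' t = 0" "step'' t = 0"
proof -
  have "cube_plus t \<ge> 1" using assms by (simp add: cube_plus_def one_le_power)
  then show "step t = 1" "step' t = 0" "step'' t = 0"
    by (auto simp: step_def step'_def step''_def cube_plus_def[of "1 - _"])
qed

lemma step_bounds: "0 \<le> step t" "step t \<le> 1" "\<bar>step' t\<bar> \<le> 9" "\<bar>step'' t\<bar> \<le> 72"
proof -
  have "0 \<le> step t \<and> step t \<le> 1 \<and> \<bar>step' t\<bar> \<le> 9 \<and> \<bar>step'' t\<bar> \<le> 72"
  proof (cases "0 < t \<and> t < 1")
    case False
    then show ?thesis using step_eq_0[of t] step_eq_1[of t] by auto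
  next
    case True
    define r where "r = 1 - t ^ 3"
    have t: "0 \<le> t" "t \<le> 1" using True by auto
    have r: "0 \<le> r" "r \<le> 1" using t by (auto simp: r_def power_le_one)
    have cp: "cube_plus t = t ^ 3" "cube_plus r = r ^ 3" using t r by (auto simp: cube_plus_def)
    \<comment> \<open>On (0, 1) no truncation is active. As r and t lie in [0, 1], the coefficients
      give the bounds 9 and 18 + 54 = 72.\<close>
    have e: "step t = 1 - r ^ 3" "step' t = 9 * (r\<^sup>2 * t\<^sup>2)" "step'' t = 18 * (r\<^sup>2 * t) - 54 * (r * t ^ 4)"
      using t r cp by (auto simp: step_def step'_def step''_def r_def[symmetric] max_def power2_eq_square power4_eq_xxxx)
    have "0 \<le> r\<^sup>2 * t\<^sup>2" "r\<^sup>2 * t\<^sup>2 \<le> 1" "0 \<le> r\<^sup>2 * t" "r\<^sup>2 * t \<le> 1" "0 \<le> r * t ^ 4" "r * t ^ 4 \<le> 1" "0 \<le> r ^ 3" "r ^ 3 \<le> 1"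
      using t r by (auto intro!: mult_le_one power_le_one)
    then show ?thesis unfolding e abs_le_iff by linarith
  qed
  then show "0 \<le> step t" "step t \<le> 1" "\<bar>step' t\<bar> \<le> 9" "\<bar>step'' t\<bar> \<le> 72" by auto
qed

text \<open>The variable is s = |x|^2, so c is a squared radius. The substitution 2 - s / c reverses
  orientation and lets \<open>step\<close> descend from 1 at c to 0 at 2 c.\<close>

lemma outer_cutoff:
  assumes "c > 0"
  obtains q q' q'' :: "real \<Rightarrow> real" where
    "\<And>s. (q has_real_derivative q' s) (at s)" "\<And>s. (q' has_real_derivative q'' s) (at s)"
    "continuous_on UNIV q''" "\<And>s. 0 \<le> q s" "\<And>s. q s \<le> 1" "\<And>s. s \<ge> 2 * c \<Longrightarrow> q s = 0"
    "\<And>s. s \<le> c \<Longrightarrow> q s = 1" "\<And>s. \<bar>q' s\<bar> \<le> 9 / c" "\<And>s. \<bar>q'' s\<bar> \<le> 72 / c\<^sup>2"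
    "\<And>s. s \<le> c \<or> s \<ge> 2 * c \<Longrightarrow> q' s = 0" "\<And>s. s \<le> c \<or> s \<ge> 2 * c \<Longrightarrow> q'' s = 0"
proof
  define u where "u s = 2 - s / c" for s
  have u: "(u has_real_derivative - 1 / c) (at s)" for s
    unfolding u_def using assms by (auto intro!: derivative_eq_intros)
  have u0: "u s \<le> 0 \<longleftrightarrow> s \<ge> 2 * c" and u1: "u s \<ge> 1 \<longleftrightarrow> s \<le> c" for s using assms by (auto simp: u_def field_simps)
  show "((\<lambda>s. step (u s)) has_real_derivative - step' (u s) / c) (at s)" for s
    using DERIV_chain2[OF step_deriv u] by simp
  show "((\<lambda>s. - step' (u s) / c) has_real_derivative step'' (u s) / c\<^sup>2) (at s)" for s
    using DERIV_cdivide[OF DERIV_minus[OF DERIV_chain2[OF step'_deriv u]], of c s] by (simp add: power2_eq_square)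
  show "continuous_on UNIV (\<lambda>s. step'' (u s) / c\<^sup>2)"
    unfolding u_def using assms by (intro continuous_intros continuous_on_compose2[OF step''_continuous[of UNIV]]) auto
  show "0 \<le> step (u s)" "step (u s) \<le> 1" for s by (rule step_bounds)+
  show "\<bar>- step' (u s) / c\<bar> \<le> 9 / c" "\<bar>step'' (u s) / c\<^sup>2\<bar> \<le> 72 / c\<^sup>2" for s
    using step_bounds[of "u s"] assms by (auto intro!: divide_right_mono)
  show "s \<ge> 2 * c \<Longrightarrow> step (u s) = 0" for s by (simp add: step_eq_0 u0)
  show "s \<le> c \<Longrightarrow> step (u s) = 1" for s by (simp add: step_eq_1 u1)
  show "s \<le> c \<or> s \<ge> 2 * c \<Longrightarrow> - step' (u s) / c = 0" "s \<le> c \<or> s \<ge> 2 * c \<Longrightarrow> step'' (u s) / c\<^sup>2 = 0" for s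
    using u0[of s] u1[of s] by (auto simp: step_eq_0 step_eq_1)
qed

text \<open>The difference of the outer cutoffs at the scales c and a. Because 2 a <= c, the
  transition zones do not overlap, so the difference stays in [0, 1] and the derivatives on each
  zone feel one scale only.\<close>

lemma annular_cutoff:
  assumes "a > 0" "2 * a \<le> c"
  obtains q q' q'' :: "real \<Rightarrow> real" where
    "\<And>s. (q has_real_derivative q' s) (at s)" "\<And>s. (q' has_real_derivative q'' s) (at s)"
    "continuous_on UNIV q''" "\<And>s. 0 \<le> q s" "\<And>s. q s \<le> 1" "\<And>s. s \<le> a \<or> s \<ge> 2 * c \<Longrightarrow> q s = 0"
    "\<And>s. 2 * a \<le> s \<Longrightarrow> s \<le> c \<Longrightarrow> q s = 1"
    "\<And>s. s < c \<Longrightarrow> \<bar>q' s\<bar> \<le> 9 / a \<and> \<bar>q'' s\<bar> \<le> 72 / a\<^sup>2"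
    "\<And>s. s \<ge> c \<Longrightarrow> \<bar>q' s\<bar> \<le> 9 / c \<and> \<bar>q'' s\<bar> \<le> 72 / c\<^sup>2"
    "\<And>s. s \<le> a \<or> 2 * a \<le> s \<and> s \<le> c \<or> s \<ge> 2 * c \<Longrightarrow> q' s = 0 \<and> q'' s = 0"
proof -
  have c: "c > 0" using assms by linarith
  obtain p p' p'' :: "real \<Rightarrow> real" where p:
    "\<And>s. (p has_real_derivative p' s) (at s)" "\<And>s. (p' has_real_derivative p'' s) (at s)"
    "continuous_on UNIV p''" "\<And>s. 0 \<le> p s" "\<And>s. p s \<le> 1" "\<And>s. s \<ge> 2 * a \<Longrightarrow> p s = 0"
    "\<And>s. s \<le> a \<Longrightarrow> p s = 1" "\<And>s. \<bar>p' s\<bar> \<le> 9 / a" "\<And>s. \<bar>p'' s\<bar> \<le> 72 / a\<^sup>2"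
    "\<And>s. s \<le> a \<or> s \<ge> 2 * a \<Longrightarrow> p' s = 0" "\<And>s. s \<le> a \<or> s \<ge> 2 * a \<Longrightarrow> p'' s = 0"
    using outer_cutoff[OF assms(1)] by blast
  obtain r r' r'' :: "real \<Rightarrow> real" where r:
    "\<And>s. (r has_real_derivative r' s) (at s)" "\<And>s. (r' has_real_derivative r'' s) (at s)"
    "continuous_on UNIV r''" "\<And>s. 0 \<le> r s" "\<And>s. r s \<le> 1" "\<And>s. s \<ge> 2 * c \<Longrightarrow> r s = 0"
    "\<And>s. s \<le> c \<Longrightarrow> r s = 1" "\<And>s. \<bar>r' s\<bar> \<le> 9 / c" "\<And>s. \<bar>r'' s\<bar> \<le> 72 / c\<^sup>2"
    "\<And>s. s \<le> c \<or> s \<ge> 2 * c \<Longrightarrow> r' s = 0" "\<And>s. s \<le> c \<or> s \<ge> 2 * c \<Longrightarrow> r'' s = 0"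
    using outer_cutoff[OF c] by blast
  have disj: "p s = 0 \<and> p' s = 0 \<and> p'' s = 0 \<or> r s = 1 \<and> r' s = 0 \<and> r'' s = 0" for s
    using p(6,10,11)[of s] r(7,10,11)[of s] assms by linarith
  show thesis
  proof (rule that[of "\<lambda>s. r s - p s" "\<lambda>s. r' s - p' s" "\<lambda>s. r'' s - p'' s"])
    show "((\<lambda>s. r s - p s) has_real_derivative r' s - p' s) (at s)"
      "((\<lambda>s. r' s - p' s) has_real_derivative r'' s - p'' s) (at s)" for s
      by (auto intro!: derivative_eq_intros p r)
    show "continuous_on UNIV (\<lambda>s. r'' s - p'' s)" by (intro continuous_intros p r)
    show "0 \<le> r s - p s" "r s - p s \<le> 1" for s
      using disj[of s] p(4,5)[of s] r(4,5)[of s] by auto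
    show "s \<le> a \<or> s \<ge> 2 * c \<Longrightarrow> r s - p s = 0" for s
      using p(6,7)[of s] r(6,7)[of s] assms by auto
    show "2 * a \<le> s \<Longrightarrow> s \<le> c \<Longrightarrow> r s - p s = 1" for s
      using p(6)[of s] r(7)[of s] by auto
    show "s < c \<Longrightarrow> \<bar>r' s - p' s\<bar> \<le> 9 / a \<and> \<bar>r'' s - p'' s\<bar> \<le> 72 / a\<^sup>2" for s
      using p(8,9)[of s] r(10,11)[of s] by auto
    show "s \<ge> c \<Longrightarrow> \<bar>r' s - p' s\<bar> \<le> 9 / c \<and> \<bar>r'' s - p'' s\<bar> \<le> 72 / c\<^sup>2" for s
      using p(10,11)[of s] r(8,9)[of s] assms by auto
    show "s \<le> a \<or> 2 * a \<le> s \<and> s \<le> c \<or> s \<ge> 2 * c \<Longrightarrow> r' s - p' s = 0 \<and> r'' s - p'' s = 0" for s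
      using p(10,11)[of s] r(10,11)[of s] assms by auto
  qed
qed

text \<open>The quantity estimated is the Laplacian of q(|x|^2) for a cutoff at squared radius c;
  576 is 4 times 72 times 2.\<close>

lemma abs_laplacian_radial_le:
  fixes x :: "'a::euclidean_space"
  assumes "\<bar>q'\<bar> \<le> 9 / c" "\<bar>q''\<bar> \<le> 72 / c\<^sup>2" "x \<bullet> x \<le> 2 * c" "c > 0"
  shows "\<bar>real DIM('a) * (2 * q') + 4 * q'' * (x \<bullet> x)\<bar> \<le> (18 * real DIM('a) + 576) / c"
proof -
  have "\<bar>real DIM('a) * (2 * q')\<bar> \<le> real DIM('a) * (2 * (9 / c))"
    unfolding abs_mult using assms by (intro mult_mono) auto
  moreover have "\<bar>4 * q'' * (x \<bullet> x)\<bar> \<le> 4 * (72 / c\<^sup>2) * (2 * c)"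
    unfolding abs_mult using assms by (intro mult_mono) auto
  moreover have "4 * (72 / c\<^sup>2) * (2 * c) = 576 / c" using assms by (simp add: power2_eq_square)
  moreover have "(18 * real DIM('a) + 576) / c = real DIM('a) * (2 * (9 / c)) + 576 / c"
    by (simp add: add_divide_distrib)
  ultimately show ?thesis by linarith
qed

lemma sets_sq_ball [measurable]: "{x::'a::euclidean_space. x \<bullet> x \<le> \<rho>} \<in> sets borel"
  by (intro borel_closed closed_Collect_le continuous_intros)

lemma integrable_indicator_sq_ball:
  fixes f :: "'a::euclidean_space \<Rightarrow> real"
  assumes "continuous_on UNIV f"
  shows "integrable lborel (\<lambda>x. indicator {x. x \<bullet> x \<le> \<rho>} x * f x)"
proof -
  have eq: "{x::'a. x \<bullet> x \<le> \<rho>} = cball 0 (sqrt \<rho>)" by (auto simp: norm_eq_sqrt_inner)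
  have "integrable lborel (\<lambda>x. indicator (cball 0 (sqrt \<rho>)) x *\<^sub>R f x)"
    by (rule borel_integrable_compact) (use assms in \<open>auto intro: continuous_on_subset\<close>)
  then show ?thesis unfolding eq by simp
qed

text \<open>Half the Laplacian of the cutoff accounts for 9 d + 288. The remaining 1 comes from
  splitting |F| |T|, with T the Laplacian of F, into rho T^2 + F^2 / rho, the weights dictated by
  scaling since rho is a squared length.\<close>

lemma caccioppoli:
  fixes F :: "'a::euclidean_space \<Rightarrow> real"
  assumes F: "C2_fun F g H" and \<rho>: "\<rho> > 0"
  shows "(\<integral>x. indicator {x. x \<bullet> x \<le> \<rho>} x * (g x \<bullet> g x) \<partial>lborel)
    \<le> \<rho> * (\<integral>x. indicator {x. x \<bullet> x \<le> 2 * \<rho>} x * (trace_op (H x))\<^sup>2 \<partial>lborel)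
      + (9 * real DIM('a) + 289) / \<rho> * (\<integral>x. indicator {x. x \<bullet> x \<le> 2 * \<rho>} x * (F x)\<^sup>2 \<partial>lborel)"
proof -
  obtain q q' q'' :: "real \<Rightarrow> real" where q:
    "\<And>s. (q has_real_derivative q' s) (at s)" "\<And>s. (q' has_real_derivative q'' s) (at s)"
    "continuous_on UNIV q''" "\<And>s. 0 \<le> q s" "\<And>s. q s \<le> 1" "\<And>s. s \<ge> 2 * \<rho> \<Longrightarrow> q s = 0"
    "\<And>s. s \<le> \<rho> \<Longrightarrow> q s = 1" "\<And>s. \<bar>q' s\<bar> \<le> 9 / \<rho>" "\<And>s. \<bar>q'' s\<bar> \<le> 72 / \<rho>\<^sup>2"
    "\<And>s. s \<le> \<rho> \<or> s \<ge> 2 * \<rho> \<Longrightarrow> q' s = 0" "\<And>s. s \<le> \<rho> \<or> s \<ge> 2 * \<rho> \<Longrightarrow> q'' s = 0"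
    using outer_cutoff[OF \<rho>] by blast
  note Z = C2_fun_radial[OF q(1-3), where ?'a='a]
  have out: "q (x \<bullet> x) = 0" if "x \<bullet> x > 2 * \<rho>" for x :: 'a using q(6) that by simp
  note CI = caccioppoli_identity[OF F Z out, unfolded trace_op_radial]
  define C where "C = 9 * real DIM('a) + 289"
  have cL: "continuous_on UNIV (\<lambda>x. (trace_op (H x))\<^sup>2)"
    by (intro continuous_intros C2_fun_continuous_trace[OF F])
  have cF: "continuous_on UNIV (\<lambda>x. (F x)\<^sup>2)" by (intro continuous_intros C2_funD[OF F])
  note iL = integrable_indicator_sq_ball[OF cL, of "2 * \<rho>"] and iF = integrable_indicator_sq_ball[OF cF, of "2 * \<rho>"]
  have "(\<integral>x. indicator {x. x \<bullet> x \<le> \<rho>} x * (g x \<bullet> g x) \<partial>lborel) \<le> (\<integral>x. q (x \<bullet> x) * (g x \<bullet> g x) \<partial>lborel)"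
  proof (rule integral_mono)
    show "integrable lborel (\<lambda>x. indicator {x. x \<bullet> x \<le> \<rho>} x * (g x \<bullet> g x))"
      by (intro integrable_indicator_sq_ball continuous_intros C2_funD[OF F])
    show "indicator {x. x \<bullet> x \<le> \<rho>} x * (g x \<bullet> g x) \<le> q (x \<bullet> x) * (g x \<bullet> g x)" for x
      using q(4,7)[of "x \<bullet> x"] by (auto simp: indicator_def)
  qed (rule CI)
  also note CI(1)
  also have "(\<integral>x. (1/2) * (F x)\<^sup>2 * (real DIM('a) * (2 * q' (x \<bullet> x)) + 4 * q'' (x \<bullet> x) * (x \<bullet> x)) - q (x \<bullet> x) * F x * trace_op (H x) \<partial>lborel)
    \<le> (\<integral>x. \<rho> * (indicator {x. x \<bullet> x \<le> 2 * \<rho>} x * (trace_op (H x))\<^sup>2) + C / \<rho> * (indicator {x. x \<bullet> x \<le> 2 * \<rho>} x * (F x)\<^sup>2) \<partial>lborel)"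
  proof (rule integral_mono, rule CI(3))
    show "integrable lborel (\<lambda>x. \<rho> * (indicator {x. x \<bullet> x \<le> 2 * \<rho>} x * (trace_op (H x))\<^sup>2) + C / \<rho> * (indicator {x. x \<bullet> x \<le> 2 * \<rho>} x * (F x)\<^sup>2))"
      using iL iF by simp
    fix x
    define T where "T = trace_op (H x)"
    define l where "l = real DIM('a) * (2 * q' (x \<bullet> x)) + 4 * q'' (x \<bullet> x) * (x \<bullet> x)"
    show "(1/2) * (F x)\<^sup>2 * (real DIM('a) * (2 * q' (x \<bullet> x)) + 4 * q'' (x \<bullet> x) * (x \<bullet> x)) - q (x \<bullet> x) * F x * trace_op (H x)
      \<le> \<rho> * (indicator {x. x \<bullet> x \<le> 2 * \<rho>} x * (trace_op (H x))\<^sup>2) + C / \<rho> * (indicator {x. x \<bullet> x \<le> 2 * \<rho>} x * (F x)\<^sup>2)"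
    proof (cases "x \<bullet> x \<le> 2 * \<rho>")
      case False
      then show ?thesis using q(6,10,11)[of "x \<bullet> x"] by simp
    next
      case True
      have "\<bar>l\<bar> \<le> (18 * real DIM('a) + 576) / \<rho>"
        unfolding l_def using q(8,9) True \<rho> by (rule abs_laplacian_radial_le)
      then have "(F x)\<^sup>2 * l \<le> (F x)\<^sup>2 * ((18 * real DIM('a) + 576) / \<rho>)"
        by (intro mult_left_mono) auto
      then have 1: "(1/2) * (F x)\<^sup>2 * l \<le> (9 * real DIM('a) + 288) / \<rho> * (F x)\<^sup>2" by (simp add: field_simps)
      have "- q (x \<bullet> x) * F x * T \<le> \<bar>q (x \<bullet> x)\<bar> * (\<bar>F x\<bar> * \<bar>T\<bar>)"
        by (metis abs_ge_self abs_minus_cancel abs_mult mult.assoc mult_minus_left)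
      also have "\<dots> \<le> 1 * (\<bar>F x\<bar> * \<bar>T\<bar>)"
        using q(4,5)[of "x \<bullet> x"] by (intro mult_right_mono) auto
      also have "\<dots> \<le> \<rho> * T\<^sup>2 + 1 / \<rho> * (F x)\<^sup>2"
      proof -
        have "0 \<le> (\<rho> * \<bar>T\<bar> - \<bar>F x\<bar>)\<^sup>2" by simp
        then have "2 * \<rho> * (\<bar>F x\<bar> * \<bar>T\<bar>) \<le> \<rho>\<^sup>2 * T\<^sup>2 + (F x)\<^sup>2"
          by (simp add: power2_eq_square algebra_simps)
        moreover have "0 \<le> \<rho> * (\<bar>F x\<bar> * \<bar>T\<bar>)" using \<rho> by simp
        moreover have "\<rho> * (\<rho> * T\<^sup>2 + 1 / \<rho> * (F x)\<^sup>2) = \<rho>\<^sup>2 * T\<^sup>2 + (F x)\<^sup>2"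
          using \<rho> by (simp add: distrib_left power2_eq_square)
        ultimately have "\<rho> * (\<bar>F x\<bar> * \<bar>T\<bar>) \<le> \<rho> * (\<rho> * T\<^sup>2 + 1 / \<rho> * (F x)\<^sup>2)"
          by linarith
        then show ?thesis using \<rho> by simp
      qed
      finally have 2: "- q (x \<bullet> x) * F x * T \<le> \<rho> * T\<^sup>2 + 1 / \<rho> * (F x)\<^sup>2" .
      have "C / \<rho> * (F x)\<^sup>2 = (9 * real DIM('a) + 288) / \<rho> * (F x)\<^sup>2 + 1 / \<rho> * (F x)\<^sup>2"
      proof -
        have "C = (9 * real DIM('a) + 288) + 1" by (simp add: C_def)
        then show ?thesis by (simp only: add_divide_distrib distrib_right)
      qed
      then show ?thesis using True 1 2 by (simp add: l_def T_def)
    qed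
  qed
  also have "\<dots> = \<rho> * (\<integral>x. indicator {x. x \<bullet> x \<le> 2 * \<rho>} x * (trace_op (H x))\<^sup>2 \<partial>lborel)
      + C / \<rho> * (\<integral>x. indicator {x. x \<bullet> x \<le> 2 * \<rho>} x * (F x)\<^sup>2 \<partial>lborel)"
    using iL iF by simp
  finally show ?thesis by (simp add: C_def)
qed

section \<open>The local estimate for smooth functions\<close>

lemma carleman_weight_nonneg: "0 \<le> carleman_weight \<alpha> b s"
  by (simp add: carleman_weight_def)

text \<open>The logarithmic derivative -alpha / s + 2 alpha b is nonpositive while 2 b s <= 1. The
  inequality ln x <= x - 1 replaces the differentiation.\<close>

lemma carleman_weight_antimono:
  assumes "0 < s" "s \<le> s'" "2 * b * s' \<le> 1" "0 \<le> b" "0 \<le> \<alpha>"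
  shows "carleman_weight \<alpha> b s' \<le> carleman_weight \<alpha> b s"
proof -
  have s': "s' > 0" using assms by linarith
  have "ln (s / s') \<le> s / s' - 1" using assms s' by (intro ln_le_minus_one) auto
  then have "ln s - ln s' \<le> - ((s' - s) / s')" using assms s' by (simp add: ln_div diff_divide_distrib)
  moreover have "2 * b * (s' - s) \<le> (s' - s) / s'"
    using assms s' mult_right_mono[of "2 * b * s'" 1 "s' - s"] by (simp add: field_simps)
  ultimately have "- ln s' + 2 * b * s' \<le> - ln s + 2 * b * s" by (simp add: algebra_simps)
  then have "\<alpha> * (- ln s' + 2 * b * s') \<le> \<alpha> * (- ln s + 2 * b * s)" using assms by (intro mult_left_mono)
  then show ?thesis using assms s'
    by (simp add: carleman_weight_def powr_def exp_add[symmetric] algebra_simps)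
qed

text \<open>What is squared is the commutator of the cutoff with the Laplacian, f Lap(q) + 2 grad q
  . grad f. The factor |x|^2 supplied by the Carleman estimate is at most 2 c and cancels one power
  of 1 / c, which leaves f^2 / c and |g|^2.\<close>

lemma cutoff_laplacian_error:
  fixes x :: "'a::euclidean_space" and g :: 'a
  assumes "\<bar>q'\<bar> \<le> 9 / c" "\<bar>q''\<bar> \<le> 72 / c\<^sup>2" "x \<bullet> x \<le> 2 * c" "c > 0"
  shows "(x \<bullet> x) * (f * (real DIM('a) * (2 * q') + 4 * q'' * (x \<bullet> x)) + 4 * q' * (x \<bullet> g))\<^sup>2
     \<le> 4 * (18 * real DIM('a) + 576)\<^sup>2 * (f\<^sup>2 / c + g \<bullet> g)"
proof -
  define l where "l = real DIM('a) * (2 * q') + 4 * q'' * (x \<bullet> x)"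
  define K where "K = 18 * real DIM('a) + 576"
  have "\<bar>l\<bar> \<le> K / c" unfolding l_def K_def by (rule abs_laplacian_radial_le[OF assms])
  then have l2: "l\<^sup>2 \<le> (K / c)\<^sup>2" using assms(4) by (simp add: abs_le_square_iff[symmetric] K_def)
  have q2: "q'\<^sup>2 \<le> (9 / c)\<^sup>2" using assms by (simp add: abs_le_square_iff[symmetric])
  have xg: "(x \<bullet> g)\<^sup>2 \<le> (x \<bullet> x) * (g \<bullet> g)" by (rule Cauchy_Schwarz_ineq)
  have "(4 * q' * (x \<bullet> g))\<^sup>2 = 16 * (q'\<^sup>2 * (x \<bullet> g)\<^sup>2)" by (simp add: power_mult_distrib)
  also have "\<dots> \<le> 16 * ((9 / c)\<^sup>2 * (2 * c * (g \<bullet> g)))"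
    by (intro mult_left_mono mult_mono q2 order_trans[OF xg] mult_right_mono assms) auto
  also have "\<dots> = 2592 / c * (g \<bullet> g)" using assms by (simp add: power2_eq_square)
  finally have B: "(4 * q' * (x \<bullet> g))\<^sup>2 \<le> 2592 / c * (g \<bullet> g)" .
  have A: "(f * l)\<^sup>2 \<le> f\<^sup>2 * (K / c)\<^sup>2" unfolding power_mult_distrib by (intro mult_left_mono l2) auto
  have "(f * l + 4 * q' * (x \<bullet> g))\<^sup>2 \<le> 2 * (f * l)\<^sup>2 + 2 * (4 * q' * (x \<bullet> g))\<^sup>2"
    using sum_squares_bound[of "f * l" "4 * q' * (x \<bullet> g)"] by (simp add: power2_sum)
  also have "\<dots> \<le> 2 * (f\<^sup>2 * (K / c)\<^sup>2) + 2 * (2592 / c * (g \<bullet> g))" using A B by linarith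
  finally have "(x \<bullet> x) * (f * l + 4 * q' * (x \<bullet> g))\<^sup>2 \<le> (2 * c) * (2 * (f\<^sup>2 * (K / c)\<^sup>2) + 2 * (2592 / c * (g \<bullet> g)))"
    using assms by (intro mult_mono) auto
  also have "\<dots> = 4 * K\<^sup>2 * (f\<^sup>2 / c) + 10368 * (g \<bullet> g)"
    using assms by (simp add: power2_eq_square algebra_simps)
  also have "\<dots> \<le> 4 * K\<^sup>2 * (f\<^sup>2 / c) + 4 * K\<^sup>2 * (g \<bullet> g)"
  proof -
    have "576\<^sup>2 \<le> K\<^sup>2" unfolding K_def by (intro power_mono) auto
    then show ?thesis by (intro add_left_mono mult_right_mono) auto
  qed
  finally show ?thesis by (simp add: l_def K_def distrib_left)
qed

text \<open>The Carleman estimate is applied to q(|x|^2) F; b = 1 / (8 c) gives 4 b L = 1 for the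
  outer squared radius L = 2 c. The commutator with the cutoff lives where |x|^2 is in [a, 2 a] or
  [c, 2 c], and there the decreasing weight is at most E(a) or E(c). Caccioppoli's inequality at the
  squared radii 2 a and 2 c then removes grad F and doubles them to 4 a and 4 c. The cutoff is
  passed as a parameter so that a single q can serve all mollifications.\<close>

lemma local_estimate_smooth:
  fixes F :: "'a::euclidean_space \<Rightarrow> real" and \<alpha> a b c :: real
  defines "(E :: real \<Rightarrow> real) \<equiv> carleman_weight \<alpha> b"
  defines "K0 \<equiv> 8 * (18 * real DIM('a) + 576)\<^sup>2 * (9 * real DIM('a) + 291)"
  assumes a: "0 < a" "2 * a \<le> c" and b: "b = 1 / (8 * c)" and \<alpha>: "\<alpha> \<ge> 2 * real DIM('a)"
    and F: "C2_fun F g H"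
    and q: "\<And>s. (q has_real_derivative q' s) (at s)" "\<And>s. (q' has_real_derivative q'' s) (at s)"
    "continuous_on UNIV q''" "\<And>s. 0 \<le> q s" "\<And>s. q s \<le> 1" "\<And>s. s \<le> a \<or> s \<ge> 2 * c \<Longrightarrow> q s = 0"
    "\<And>s. s < c \<Longrightarrow> \<bar>q' s\<bar> \<le> 9 / a \<and> \<bar>q'' s\<bar> \<le> 72 / a\<^sup>2"
    "\<And>s. s \<ge> c \<Longrightarrow> \<bar>q' s\<bar> \<le> 9 / c \<and> \<bar>q'' s\<bar> \<le> 72 / c\<^sup>2"
    "\<And>s. s \<le> a \<or> 2 * a \<le> s \<and> s \<le> c \<or> s \<ge> 2 * c \<Longrightarrow> q' s = 0 \<and> q'' s = 0"
  shows "2 * \<alpha> ^ 3 * b * (\<integral>x. E (x \<bullet> x) * (q (x \<bullet> x))\<^sup>2 * (F x)\<^sup>2 \<partial>lborel)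
    \<le> 2 * (\<integral>x. (x \<bullet> x) * E (x \<bullet> x) * (q (x \<bullet> x))\<^sup>2 * (trace_op (H x))\<^sup>2 \<partial>lborel)
      + K0 * E a * (a * (\<integral>x. indicator {x. x \<bullet> x \<le> 4 * a} x * (trace_op (H x))\<^sup>2 \<partial>lborel)
                   + 1 / a * (\<integral>x. indicator {x. x \<bullet> x \<le> 4 * a} x * (F x)\<^sup>2 \<partial>lborel))
      + K0 * E c * (c * (\<integral>x. indicator {x. x \<bullet> x \<le> 4 * c} x * (trace_op (H x))\<^sup>2 \<partial>lborel)
                   + 1 / c * (\<integral>x. indicator {x. x \<bullet> x \<le> 4 * c} x * (F x)\<^sup>2 \<partial>lborel))"
proof -
  define A where "A = 4 * (18 * real DIM('a) + 576)\<^sup>2"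
  define C where "C = 9 * real DIM('a) + 289"
  have A0: "A \<ge> 0" by (simp add: A_def)
  have C0: "C \<ge> 0" by (simp add: C_def)
  have c: "c > 0" using a by linarith
  have b0: "b > 0" using b c by simp
  have \<alpha>0: "\<alpha> \<ge> 0" using \<alpha> by (meson of_nat_0_le_iff order_trans zero_le_mult_iff zero_le_numeral)
  have bs: "2 * b * s \<le> 1" if "s \<le> 2 * c" for s
  proof -
    have "2 * b * s \<le> 2 * b * (2 * c)" using that b0 by (intro mult_left_mono) auto
    then show ?thesis using b c by simp
  qed
  note R = C2_fun_radial[OF q(1-3), where ?'a='a]
  note U = C2_fun_mult[OF R F]
  define u where "u x = q (x \<bullet> x) * F x" for x :: 'a
  define T where "T x = trace_op (H x)" for x
  define r where "r x = F x * (real DIM('a) * (2 * q' (x \<bullet> x)) + 4 * q'' (x \<bullet> x) * (x \<bullet> x)) + 4 * q' (x \<bullet> x) * (x \<bullet> g x)" for x :: 'a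
  define lu where "lu x = q (x \<bullet> x) * T x + r x" for x
  have in0: "q (x \<bullet> x) * F x = 0" if "x \<bullet> x < a" for x using q(6)[of "x \<bullet> x"] that by simp
  have out0: "q (x \<bullet> x) * F x = 0" if "x \<bullet> x > 2 * c" for x using q(6)[of "x \<bullet> x"] that by simp
  have bL: "4 * b * (2 * c) \<le> 1" using b c by simp
  note CE = carleman_estimate[OF U a(1) less_imp_le[OF b0] \<alpha> in0 out0 bL, unfolded trace_op_mult trace_op_radial, folded E_def]
  have lu: "q (x \<bullet> x) * trace_op (H x) + F x * (real DIM('a) * (2 * q' (x \<bullet> x)) + 4 * q'' (x \<bullet> x) * (x \<bullet> x))
      + 2 * ((2 * q' (x \<bullet> x)) *\<^sub>R x \<bullet> g x) = lu x" for x
    by (simp add: lu_def r_def T_def)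
  note CE = CE[unfolded lu]
  let ?I = "\<lambda>\<rho> x. indicator {x::'a. x \<bullet> x \<le> \<rho>} x :: real"
  note iI = integrable_indicator_sq_ball
  have cF2: "continuous_on UNIV (\<lambda>x. (F x)\<^sup>2)" and cG: "continuous_on UNIV (\<lambda>x. g x \<bullet> g x)"
    and cT: "continuous_on UNIV (\<lambda>x. (T x)\<^sup>2)"
    unfolding T_def by (intro continuous_intros C2_funD[OF F] C2_fun_continuous_trace[OF F])+
  \<comment> \<open>The weight blows up at the origin, but q vanishes for |x|^2 <= a, so E(a)
    dominates it on the support of q.\<close>
  have i1: "integrable lborel (\<lambda>x. (x \<bullet> x) * E (x \<bullet> x) * (q (x \<bullet> x))\<^sup>2 * (T x)\<^sup>2)"
  proof (rule Bochner_Integration.integrable_bound[where f="\<lambda>x. ?I (2 * c) x * ((x \<bullet> x) * E a * (T x)\<^sup>2)"])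
    show "integrable lborel (\<lambda>x. ?I (2 * c) x * ((x \<bullet> x) * E a * (T x)\<^sup>2))"
      by (intro iI continuous_intros cT)
    have [measurable]: "q \<in> borel_measurable borel"
      using q(1) by (intro borel_measurable_continuous_onI) (meson DERIV_isCont continuous_at_imp_continuous_on)
    have [measurable]: "T \<in> borel_measurable borel"
      unfolding T_def[abs_def] by (intro borel_measurable_continuous_onI C2_fun_continuous_trace[OF F])
    show "(\<lambda>x. (x \<bullet> x) * E (x \<bullet> x) * (q (x \<bullet> x))\<^sup>2 * (T x)\<^sup>2) \<in> borel_measurable lborel"
      unfolding E_def carleman_weight_def by measurable
    have "norm ((x \<bullet> x) * E (x \<bullet> x) * (q (x \<bullet> x))\<^sup>2 * (T x)\<^sup>2) \<le> norm (?I (2 * c) x * ((x \<bullet> x) * E a * (T x)\<^sup>2))" for x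
    proof (cases "x \<bullet> x \<le> a \<or> x \<bullet> x \<ge> 2 * c")
      case True
      then show ?thesis using q(6)[of "x \<bullet> x"] by simp
    next
      case False
      have "E (x \<bullet> x) \<le> E a" unfolding E_def
        by (rule carleman_weight_antimono) (use False a c \<alpha>0 b0 bs in auto)
      moreover have "(q (x \<bullet> x))\<^sup>2 \<le> 1" using q(4,5) by (simp add: power_le_one)
      ultimately have "E (x \<bullet> x) * (q (x \<bullet> x))\<^sup>2 \<le> E a * 1"
        by (intro mult_mono) (auto simp: E_def carleman_weight_nonneg)
      then have "(x \<bullet> x) * (T x)\<^sup>2 * (E (x \<bullet> x) * (q (x \<bullet> x))\<^sup>2) \<le> (x \<bullet> x) * (T x)\<^sup>2 * (E a * 1)"
        by (intro mult_left_mono) auto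
      then show ?thesis using False
        by (simp add: abs_mult E_def carleman_weight_nonneg mult_ac)
    qed
    then show "AE x in lborel. norm ((x \<bullet> x) * E (x \<bullet> x) * (q (x \<bullet> x))\<^sup>2 * (T x)\<^sup>2) \<le> norm (?I (2 * c) x * ((x \<bullet> x) * E a * (T x)\<^sup>2))"
      by simp
  qed
  define B where "B e x = 2 * A * E e * (?I (2 * e) x * (F x)\<^sup>2 / e + ?I (2 * e) x * (g x \<bullet> g x))" for e x
  have iB: "integrable lborel (B e)" for e
    unfolding B_def using iI[OF cF2, of "2 * e"] iI[OF cG, of "2 * e"] by simp
  have pw: "(x \<bullet> x) * E (x \<bullet> x) * (lu x)\<^sup>2 \<le> 2 * ((x \<bullet> x) * E (x \<bullet> x) * (q (x \<bullet> x))\<^sup>2 * (T x)\<^sup>2) + (B a x + B c x)" for x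
  proof -
    have Bnn: "B e x \<ge> 0" if "e > 0" for e
      using that A0 by (simp add: B_def E_def carleman_weight_nonneg)
    have err: "(x \<bullet> x) * E (x \<bullet> x) * (r x)\<^sup>2 \<le> B e x / 2"
      if e: "\<bar>q' (x \<bullet> x)\<bar> \<le> 9 / e" "\<bar>q'' (x \<bullet> x)\<bar> \<le> 72 / e\<^sup>2" "x \<bullet> x \<le> 2 * e" "e > 0" "E (x \<bullet> x) \<le> E e" for e
    proof -
      have "(x \<bullet> x) * (r x)\<^sup>2 \<le> A * ((F x)\<^sup>2 / e + g x \<bullet> g x)"
        unfolding r_def A_def by (rule cutoff_laplacian_error[OF e(1-4)])
      then have "((x \<bullet> x) * (r x)\<^sup>2) * E (x \<bullet> x) \<le> (A * ((F x)\<^sup>2 / e + g x \<bullet> g x)) * E e"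
        by (rule mult_mono) (use e A0 in \<open>auto simp: E_def carleman_weight_nonneg\<close>)
      moreover have "B e x / 2 = (A * ((F x)\<^sup>2 / e + g x \<bullet> g x)) * E e" using e by (simp add: B_def)
      moreover have "(x \<bullet> x) * E (x \<bullet> x) * (r x)\<^sup>2 = ((x \<bullet> x) * (r x)\<^sup>2) * E (x \<bullet> x)" by simp
      ultimately show ?thesis by linarith
    qed
    have "(x \<bullet> x) * E (x \<bullet> x) * (r x)\<^sup>2 \<le> B a x / 2 + B c x / 2"
    proof (cases "x \<bullet> x \<le> a \<or> 2 * a \<le> x \<bullet> x \<and> x \<bullet> x \<le> c \<or> x \<bullet> x \<ge> 2 * c")
      case True
      then show ?thesis using q(9)[OF True] Bnn[OF a(1)] Bnn[OF c] by (simp add: r_def)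
    next
      case False
      show ?thesis
      proof (cases "x \<bullet> x < c")
        case True
        have "E (x \<bullet> x) \<le> E a" unfolding E_def
          by (rule carleman_weight_antimono) (use False True a c \<alpha>0 b0 bs in auto)
        from err[OF conjunct1[OF q(7)[OF True]] conjunct2[OF q(7)[OF True]] _ a(1) this]
        show ?thesis using False True Bnn[OF c] by linarith
      next
        case ge: False
        then have ge': "x \<bullet> x \<ge> c" by simp
        have "E (x \<bullet> x) \<le> E c" unfolding E_def
          by (rule carleman_weight_antimono) (use False ge a c \<alpha>0 b0 bs in auto)
        from err[OF conjunct1[OF q(8)[OF ge']] conjunct2[OF q(8)[OF ge']] _ c this]
        show ?thesis using False ge Bnn[OF a(1)] by linarith
      qed
    qed
    moreover have "(lu x)\<^sup>2 \<le> 2 * ((q (x \<bullet> x))\<^sup>2 * (T x)\<^sup>2) + 2 * (r x)\<^sup>2"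
      unfolding lu_def using sum_squares_bound[of "q (x \<bullet> x) * T x" "r x"]
        power2_sum[of "q (x \<bullet> x) * T x" "r x"] power_mult_distrib[of "q (x \<bullet> x)" "T x" 2] by linarith
    then have "(x \<bullet> x) * E (x \<bullet> x) * (lu x)\<^sup>2 \<le> (x \<bullet> x) * E (x \<bullet> x) * (2 * ((q (x \<bullet> x))\<^sup>2 * (T x)\<^sup>2) + 2 * (r x)\<^sup>2)"
      by (intro mult_left_mono) (auto simp: E_def carleman_weight_nonneg)
    ultimately show ?thesis by (simp add: algebra_simps)
  qed
  have "2 * \<alpha> ^ 3 * b * (\<integral>x. E (x \<bullet> x) * (q (x \<bullet> x))\<^sup>2 * (F x)\<^sup>2 \<partial>lborel)
     = 2 * \<alpha> ^ 3 * b * (\<integral>x. E (x \<bullet> x) * (q (x \<bullet> x) * F x)\<^sup>2 \<partial>lborel)"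
    by (simp add: power_mult_distrib mult.assoc)
  also have "\<dots> \<le> (\<integral>x. (x \<bullet> x) * E (x \<bullet> x) * (lu x)\<^sup>2 \<partial>lborel)" by (rule CE(3))
  also have "\<dots> \<le> (\<integral>x. 2 * ((x \<bullet> x) * E (x \<bullet> x) * (q (x \<bullet> x))\<^sup>2 * (T x)\<^sup>2) + (B a x + B c x) \<partial>lborel)"
    using CE(2) i1 iB pw by (intro integral_mono) auto
  also have "\<dots> = 2 * (\<integral>x. (x \<bullet> x) * E (x \<bullet> x) * (q (x \<bullet> x))\<^sup>2 * (T x)\<^sup>2 \<partial>lborel) + ((\<integral>x. B a x \<partial>lborel) + (\<integral>x. B c x \<partial>lborel))"
    using i1 iB by simp
  also have "\<dots> \<le> 2 * (\<integral>x. (x \<bullet> x) * E (x \<bullet> x) * (q (x \<bullet> x))\<^sup>2 * (T x)\<^sup>2 \<partial>lborel)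
     + (K0 * E a * (a * (\<integral>x. ?I (4 * a) x * (T x)\<^sup>2 \<partial>lborel) + 1 / a * (\<integral>x. ?I (4 * a) x * (F x)\<^sup>2 \<partial>lborel))
      + K0 * E c * (c * (\<integral>x. ?I (4 * c) x * (T x)\<^sup>2 \<partial>lborel) + 1 / c * (\<integral>x. ?I (4 * c) x * (F x)\<^sup>2 \<partial>lborel)))"
  proof -
    have "(\<integral>x. B e x \<partial>lborel) \<le> K0 * E e * (e * (\<integral>x. ?I (4 * e) x * (T x)\<^sup>2 \<partial>lborel) + 1 / e * (\<integral>x. ?I (4 * e) x * (F x)\<^sup>2 \<partial>lborel))"
      if e: "e > 0" for e
    proof -
      define X where "X = (\<integral>x. ?I (4 * e) x * (T x)\<^sup>2 \<partial>lborel)"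
      define Y where "Y = (\<integral>x. ?I (4 * e) x * (F x)\<^sup>2 \<partial>lborel)"
      have XY: "X \<ge> 0" "Y \<ge> 0" unfolding X_def Y_def by (intro Bochner_Integration.integral_nonneg) auto
      have "(\<integral>x. ?I (2 * e) x * (F x)\<^sup>2 \<partial>lborel) \<le> Y" unfolding Y_def
        by (rule integral_mono[OF iI[OF cF2] iI[OF cF2]]) (use e in \<open>auto simp: indicator_def\<close>)
      then have "(\<integral>x. ?I (2 * e) x * (F x)\<^sup>2 \<partial>lborel) / e \<le> Y / e" using e by (simp add: divide_right_mono)
      \<comment> \<open>Caccioppoli's inequality is used at the squared radius 2 e. Together with Y
        / e the result is at most (C + 2) (e X + Y / e), and K0 is 2 A (C + 2).\<close>
      moreover have "(\<integral>x. ?I (2 * e) x * (g x \<bullet> g x) \<partial>lborel) \<le> 2 * e * X + C / (2 * e) * Y"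
        using caccioppoli[OF F, of "2 * e"] e by (simp add: X_def Y_def T_def C_def)
      ultimately have "(\<integral>x. ?I (2 * e) x * (F x)\<^sup>2 \<partial>lborel) / e + (\<integral>x. ?I (2 * e) x * (g x \<bullet> g x) \<partial>lborel)
          \<le> Y / e + (2 * e * X + C / (2 * e) * Y)" by linarith
      also have "\<dots> \<le> (C + 2) * (e * X + 1 / e * Y)"
      proof -
        have "C / (2 * e) * Y = C / 2 * (Y / e)" by simp
        moreover have "0 \<le> C * (Y / e)" "0 \<le> Y / e" "0 \<le> C * (e * X)" "0 \<le> e * X" using C0 XY e by auto
        ultimately show ?thesis by (simp add: algebra_simps)
      qed
      finally have *: "(\<integral>x. ?I (2 * e) x * (F x)\<^sup>2 \<partial>lborel) / e + (\<integral>x. ?I (2 * e) x * (g x \<bullet> g x) \<partial>lborel)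
        \<le> (C + 2) * (e * X + 1 / e * Y)" .
      have "(\<integral>x. B e x \<partial>lborel) = 2 * A * E e * ((\<integral>x. ?I (2 * e) x * (F x)\<^sup>2 \<partial>lborel) / e + (\<integral>x. ?I (2 * e) x * (g x \<bullet> g x) \<partial>lborel))"
        unfolding B_def using iI[OF cF2, of "2 * e"] iI[OF cG, of "2 * e"] by simp
      also have "\<dots> \<le> 2 * A * E e * ((C + 2) * (e * X + 1 / e * Y))"
        using A0 by (intro mult_left_mono *) (auto simp: E_def carleman_weight_nonneg)
      also have "\<dots> = K0 * E e * (e * X + 1 / e * Y)"
        by (simp add: K0_def A_def C_def)
      finally show ?thesis by (simp add: X_def Y_def)
    qed
    from this[OF a(1)] this[OF c] show ?thesis by linarith
  qed
  finally show ?thesis by (simp add: T_def)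
qed

section \<open>Test functions and mollifiers\<close>

text \<open>For k = 0 this is the classical smooth function flat at 0. The powers of 1 / t are there
  because differentiation then stays within linear combinations of the family.\<close>

definition expk :: "nat \<Rightarrow> real \<Rightarrow> real" where
  "expk k t = (if t > 0 then exp (- 1 / t) / t ^ k else 0)"

lemma expk_tendsto_0: "(expk k \<longlongrightarrow> 0) (at 0)"
proof (rule filterlim_split_at)
  show "(expk k \<longlongrightarrow> 0) (at_left 0)"
    by (rule Lim_transform_eventually[OF tendsto_const]) (auto simp: expk_def eventually_at_filter intro!: always_eventually)
  have lim: "((\<lambda>t. inverse t ^ k / exp (inverse t)) \<longlongrightarrow> (0::real)) (at_right 0)"
    by (rule filterlim_compose[OF tendsto_power_div_exp_0 filterlim_inverse_at_top_right])
  have "inverse t ^ k / exp (inverse t) = expk k t" if "t > 0" for t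
  proof -
    have "exp (- 1 / t) = inverse (exp (inverse t))" using exp_minus[of "inverse t"] by (simp add: inverse_eq_divide)
    then show ?thesis using that by (simp add: expk_def divide_inverse power_inverse mult.commute)
  qed
  then have "eventually (\<lambda>t. inverse t ^ k / exp (inverse t) = expk k t) (at_right 0)"
    by (auto simp: eventually_at_filter intro!: always_eventually)
  then show "(expk k \<longlongrightarrow> 0) (at_right 0)"
    by (rule Lim_transform_eventually[OF lim])
qed

lemma expk_deriv: "(expk k has_real_derivative expk (k + 2) t - real k * expk (k + 1) t) (at t)"
proof (cases t "0 :: real" rule: linorder_cases)
  case less
  have "(expk k has_real_derivative 0) (at t)"
    by (rule has_field_derivative_transform_within_open[OF DERIV_const, where S="{..<0}"]) (use less in \<open>auto simp: expk_def\<close>)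
  then show ?thesis using less by (simp add: expk_def)
next
  case greater
  have "((\<lambda>t. exp (- 1 / t) / t ^ k) has_real_derivative
      exp (- 1 / t) / t ^ (k + 2) - real k * (exp (- 1 / t) / t ^ (k + 1))) (at t)"
  proof (cases k)
    case (Suc n)
    have "t * (t * (real n * t ^ (n - Suc 0))) = t * (real n * t ^ n)" by (cases n) auto
    then show ?thesis using greater Suc
      by (auto intro!: derivative_eq_intros simp: field_simps)
  qed (use greater in \<open>auto intro!: derivative_eq_intros simp: field_simps power2_eq_square\<close>)
  then have "(expk k has_real_derivative exp (- 1 / t) / t ^ (k + 2) - real k * (exp (- 1 / t) / t ^ (k + 1))) (at t)"
    by (rule has_field_derivative_transform_within_open[of _ _ _ "{0<..}"]) (use greater in \<open>auto simp: expk_def\<close>)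
  then show ?thesis using greater by (simp add: expk_def)
next
  case equal
  \<comment> \<open>The difference quotient of \<open>expk k\<close> at 0 is
    \<open>expk (Suc k)\<close>, which tends to 0.\<close>
  have "((\<lambda>h. (expk k (0 + h) - expk k 0) / h) \<longlongrightarrow> 0) (at 0)"
    by (rule Lim_transform_eventually[OF expk_tendsto_0[of "Suc k"]])
      (auto simp: expk_def eventually_at_filter intro!: always_eventually)
  then have "(expk k has_real_derivative 0) (at 0)" by (simp add: has_field_derivative_iff)
  then show ?thesis using equal by (simp add: expk_def)
qed

lemma expk_continuous: "continuous_on A (expk k)"
  by (meson expk_deriv DERIV_isCont continuous_at_imp_continuous_on)

lemma expk_nonneg: "0 \<le> expk k t"
  by (simp add: expk_def)

text \<open>\<open>test_fun\<close> demands differentiability of all iterated directional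
  derivatives. This class consists of differentiable functions and is closed under directional
  derivatives, so an induction over the list of directions settles smoothness for all its
  members.\<close>

inductive smooth_algebra :: "('a::euclidean_space \<Rightarrow> real) \<Rightarrow> bool" where
  const: "smooth_algebra (\<lambda>x. c)"
| inner: "smooth_algebra (\<lambda>x. x \<bullet> b)"
| add: "smooth_algebra f \<Longrightarrow> smooth_algebra g \<Longrightarrow> smooth_algebra (\<lambda>x. f x + g x)"
| mult: "smooth_algebra f \<Longrightarrow> smooth_algebra g \<Longrightarrow> smooth_algebra (\<lambda>x. f x * g x)"
| expk: "smooth_algebra f \<Longrightarrow> smooth_algebra (\<lambda>x. expk k (f x))"

lemma smooth_algebra_deriv:
  assumes "smooth_algebra f"
  shows "\<exists>D. (\<forall>x. (f has_derivative D x) (at x)) \<and> (\<forall>b. smooth_algebra (\<lambda>x. D x b))"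
  using assms
proof induction
  case (const c)
  show ?case by (rule exI[of _ "\<lambda>_ _. 0"]) (auto intro: smooth_algebra.const)
next
  case (inner b)
  show ?case by (rule exI[of _ "\<lambda>_ h. h \<bullet> b"]) (auto intro!: derivative_eq_intros intro: smooth_algebra.const)
next
  case (add f g)
  then obtain D E where "\<forall>x. (f has_derivative D x) (at x)" "\<forall>b. smooth_algebra (\<lambda>x. D x b)"
    "\<forall>x. (g has_derivative E x) (at x)" "\<forall>b. smooth_algebra (\<lambda>x. E x b)" by blast
  then show ?case
    by (intro exI[of _ "\<lambda>x h. D x h + E x h"]) (auto intro!: derivative_eq_intros smooth_algebra.intros)
next
  case (mult f g)
  then obtain D E where "\<forall>x. (f has_derivative D x) (at x)" "\<forall>b. smooth_algebra (\<lambda>x. D x b)"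
    "\<forall>x. (g has_derivative E x) (at x)" "\<forall>b. smooth_algebra (\<lambda>x. E x b)" by blast
  then show ?case using mult.hyps
    by (intro exI[of _ "\<lambda>x h. f x * E x h + D x h * g x"]) (auto intro!: derivative_eq_intros smooth_algebra.intros)
next
  case (expk f k)
  then obtain D where D: "\<And>x. (f has_derivative D x) (at x)" "\<And>b. smooth_algebra (\<lambda>x. D x b)" by blast
  let ?e = "\<lambda>x. expk (k + 2) (f x) + (- real k) * expk (k + 1) (f x)"
  show ?case
  proof (intro exI[of _ "\<lambda>x h. ?e x * D x h"] conjI allI)
    fix x
    have "((\<lambda>x. expk k (f x)) has_derivative (\<lambda>h. (expk (k + 2) (f x) - real k * expk (k + 1) (f x)) * D x h)) (at x)"
      by (rule has_derivative_compose[OF D(1) expk_deriv[unfolded has_field_derivative_def]])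
    then show "((\<lambda>x. expk k (f x)) has_derivative (\<lambda>h. ?e x * D x h)) (at x)" by simp
  next
    fix b
    show "smooth_algebra (\<lambda>x. ?e x * D x b)" using expk.hyps D(2)
      by (intro smooth_algebra.intros)
  qed
qed

lemma smooth_algebra_smooth:
  assumes "smooth_algebra f"
  shows "smooth_fun f"
proof -
  have *: "smooth_algebra (deriv_iter bs f)" for bs
  proof (induction bs)
    case (Cons b bs)
    from smooth_algebra_deriv[OF this] obtain D where
      D: "\<forall>x. (deriv_iter bs f has_derivative D x) (at x)" "\<forall>b. smooth_algebra (\<lambda>x. D x b)" by blast
    have "frechet_derivative (deriv_iter bs f) (at x) = D x" for x
      using D(1) frechet_derivative_at[of "deriv_iter bs f" "D x" x] by simp
    then show ?case using D(2) by simp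
  qed (use assms in simp)
  show ?thesis unfolding smooth_fun_def differentiable_def using smooth_algebra_deriv[OF *] by blast
qed

lemma smooth_algebra_sum: "finite A \<Longrightarrow> (\<And>i. i \<in> A \<Longrightarrow> smooth_algebra (f i)) \<Longrightarrow> smooth_algebra (\<lambda>x. \<Sum>i\<in>A. f i x)"
  by (induction A rule: finite_induct) (auto intro: smooth_algebra.intros)

lemma smooth_algebra_prod: "finite A \<Longrightarrow> (\<And>i. i \<in> A \<Longrightarrow> smooth_algebra (f i)) \<Longrightarrow> smooth_algebra (\<lambda>x. \<Prod>i\<in>A. f i x)"
  by (induction A rule: finite_induct) (auto intro: smooth_algebra.intros)

lemma smooth_algebra_sq_dist: "smooth_algebra (\<lambda>x::'a::euclidean_space. (x - y) \<bullet> (x - y))"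
proof -
  have "smooth_algebra (\<lambda>x::'a. \<Sum>i\<in>Basis. (x \<bullet> i + - (y \<bullet> i)) * (x \<bullet> i + - (y \<bullet> i)))"
    by (intro smooth_algebra_sum smooth_algebra.intros) auto
  moreover have "(x - y) \<bullet> (x - y) = (\<Sum>i\<in>Basis. (x \<bullet> i + - (y \<bullet> i)) * (x \<bullet> i + - (y \<bullet> i)))" for x
    by (subst euclidean_inner) (simp add: inner_diff_left)
  ultimately show ?thesis by simp
qed

text \<open>The kernel has two roles: as a \<open>C2_fun\<close> it is differentiated under the
  convolution integral, and its reflected translates are the test functions inserted into the weak
  derivatives. It is radial, hence even.\<close>

lemma mollifier_exists:
  assumes "r > 0"
  obtains \<rho> :: "'a::euclidean_space \<Rightarrow> real" and g H where
    "C2_fun \<rho> g H" "\<And>x. 0 \<le> \<rho> x" "\<And>x. norm x \<ge> r \<Longrightarrow> \<rho> x = 0"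
    "integrable lborel \<rho>" "(\<integral>x. \<rho> x \<partial>lborel) = 1" "\<And>x. \<rho> (- x) = \<rho> x" "\<And>y. test_fun (\<lambda>x. \<rho> (y - x))"
proof -
  define b where "b x = expk 0 (r\<^sup>2 - x \<bullet> x)" for x :: 'a
  have cb: "continuous_on UNIV b" unfolding b_def
    by (intro continuous_on_compose2[OF expk_continuous[of UNIV]] continuous_intros) auto
  have b0: "b x = 0" if "norm x \<ge> r" for x
  proof -
    have "r\<^sup>2 \<le> (norm x)\<^sup>2" using that assms by (intro power_mono) auto
    then show ?thesis by (simp add: b_def expk_def power2_norm_eq_inner)
  qed
  have ib: "integrable lborel b"
    by (rule integrable_continuous_compact_support[OF cb, of r]) (use b0 in auto)
  have bnn: "0 \<le> b x" for x by (simp add: b_def expk_nonneg)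
  define N where "N = (\<integral>x. b x \<partial>lborel)"
  have N: "N > 0"
  proof -
    have "N \<ge> 0" unfolding N_def by (intro Bochner_Integration.integral_nonneg) (auto simp: b_def expk_nonneg)
    moreover have "N \<noteq> 0"
    proof
      assume "N = 0"
      then have "AE x in lborel. b x = 0"
        using integral_nonneg_eq_0_iff_AE[OF ib] bnn by (simp add: N_def)
      then have "AE x in lborel. x \<notin> ball (0::'a) r"
      proof eventually_elim
        case (elim x)
        then show ?case using assms
          by (auto simp: b_def expk_def power2_norm_eq_inner[symmetric] dist_norm not_less abs_le_square_iff[symmetric] split: if_splits)
      qed
      then have "emeasure lborel (ball (0::'a) r) = 0"
        by (subst (asm) AE_iff_measurable[of "ball 0 r"]) auto
      then show False using assms content_ball_pos[of r "0::'a"] by (simp add: measure_def)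
    qed
    ultimately show ?thesis by simp
  qed
  define q where "q s = expk 0 (r\<^sup>2 - s) / N" for s
  have e: "((\<lambda>s. expk k (r\<^sup>2 - s)) has_real_derivative
      - (expk (k + 2) (r\<^sup>2 - s) - real k * expk (k + 1) (r\<^sup>2 - s))) (at s)" for k s
  proof -
    have "((\<lambda>s. r\<^sup>2 - s) has_real_derivative - 1) (at s)" by (auto intro!: derivative_eq_intros)
    from DERIV_chain2[OF expk_deriv this] show ?thesis by simp
  qed
  have q: "(q has_real_derivative - expk 2 (r\<^sup>2 - s) / N) (at s)" for s
    using DERIV_cdivide[OF e[of 0 s], of N] by (simp add: q_def[abs_def] numeral_2_eq_2)
  have q': "((\<lambda>s. - expk 2 (r\<^sup>2 - s) / N) has_real_derivative (expk 4 (r\<^sup>2 - s) - 2 * expk 3 (r\<^sup>2 - s)) / N) (at s)" for s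
    using DERIV_cdivide[OF DERIV_minus[OF e[of 2 s]], of N] by simp
  have cq'': "continuous_on UNIV (\<lambda>s. (expk 4 (r\<^sup>2 - s) - 2 * expk 3 (r\<^sup>2 - s)) / N)"
    using N by (intro continuous_intros continuous_on_compose2[OF expk_continuous[of UNIV]]) auto
  have qb: "q (x \<bullet> x) = b x / N" for x by (simp add: q_def b_def)
  have tf: "test_fun (\<lambda>x. q ((y - x) \<bullet> (y - x)))" for y :: 'a
  proof -
    have "smooth_algebra (\<lambda>x. (1 / N) * expk 0 (r\<^sup>2 + (-1) * ((x - y) \<bullet> (x - y))))"
      by (intro smooth_algebra.intros smooth_algebra_sq_dist)
    moreover have "(\<lambda>x. (1 / N) * expk 0 (r\<^sup>2 + (-1) * ((x - y) \<bullet> (x - y)))) = (\<lambda>x. q ((y - x) \<bullet> (y - x)))"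
      by (auto simp: q_def fun_eq_iff power2_norm_eq_inner[symmetric] norm_minus_commute)
    ultimately have "smooth_fun (\<lambda>x. q ((y - x) \<bullet> (y - x)))" using smooth_algebra_smooth by metis
    moreover have "bounded {x. q ((y - x) \<bullet> (y - x)) \<noteq> 0}"
    proof (rule bounded_subset[OF bounded_cball[of y r]], rule subsetI)
      fix x assume "x \<in> {x. q ((y - x) \<bullet> (y - x)) \<noteq> 0}"
      then have "\<not> norm (y - x) \<ge> r" using b0[of "y - x"] qb[of "y - x"] by auto
      then show "x \<in> cball y r" by (simp add: dist_norm)
    qed
    ultimately show ?thesis unfolding test_fun_def by (simp add: compact_closure)
  qed
  show thesis
  proof (rule that[OF C2_fun_radial[OF q q' cq'']])
    show "0 \<le> q (x \<bullet> x)" for x :: 'a using N by (simp add: q_def expk_nonneg)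
    show "norm x \<ge> r \<Longrightarrow> q (x \<bullet> x) = 0" for x :: 'a using b0[of x] qb[of x] by simp
    show "integrable lborel (\<lambda>x::'a. q (x \<bullet> x))" unfolding qb using ib by simp
    show "(\<integral>x. q (x \<bullet> x) \<partial>(lborel :: 'a measure)) = 1" unfolding qb using N N_def by simp
    show "q ((- x) \<bullet> (- x)) = q (x \<bullet> x)" for x :: 'a by simp
    show "test_fun (\<lambda>x. q ((y - x) \<bullet> (y - x)))" for y :: 'a by (rule tf)
  qed
qed

section \<open>Convolution with compactly supported kernels\<close>

definition locally_integrable :: "('a::euclidean_space \<Rightarrow> real) \<Rightarrow> bool" where
  "locally_integrable f \<longleftrightarrow> f \<in> borel_measurable borel \<and>
     (\<forall>c R. integrable lborel (\<lambda>x. indicator (cball c R) x * f x))"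

lemma convolution_integrable:
  fixes K :: "'a::euclidean_space \<Rightarrow> 'b::euclidean_space"
  assumes f: "locally_integrable f" and K: "continuous_on UNIV K" "\<And>z. norm z > r \<Longrightarrow> K z = 0"
  shows "integrable lborel (\<lambda>x. f x *\<^sub>R K (y - x))"
proof -
  have "bounded (K ` cball 0 r)"
    by (intro compact_imp_bounded compact_continuous_image continuous_on_subset[OF K(1)]) auto
  then obtain B where "\<forall>z\<in>cball 0 r. norm (K z) \<le> B" by (auto simp: bounded_iff)
  then have B: "norm (K z) \<le> B" if "norm z \<le> r" for z using that by simp
  have [measurable]: "K \<in> borel_measurable borel" "f \<in> borel_measurable borel"
    using borel_measurable_continuous_onI[OF K(1)] f by (auto simp: locally_integrable_def)
  show ?thesis
  proof (rule Bochner_Integration.integrable_bound)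
    show "integrable lborel (\<lambda>x. B * (indicator (cball y r) x * f x))"
      using f by (auto simp: locally_integrable_def)
    have "norm (f x *\<^sub>R K (y - x)) \<le> norm (B * (indicator (cball y r) x * f x))" for x
    proof (cases "norm (y - x) \<le> r")
      case True
      then have "norm (K (y - x)) \<le> \<bar>B\<bar>" using B by fastforce
      then show ?thesis using True by (simp add: dist_norm abs_mult mult.commute[of "\<bar>f x\<bar>"] mult_right_mono)
    qed (use K in auto)
    then show "AE x in lborel. norm (f x *\<^sub>R K (y - x)) \<le> norm (B * (indicator (cball y r) x * f x))" by simp
  qed measurable
qed

text \<open>The bound holds on the whole space: for z far from the support both values vanish, and d
  <= 1 keeps all other pairs inside a ball of radius r + 2.\<close>

lemma uniform_continuity_compact_support:
  fixes K :: "'a::euclidean_space \<Rightarrow> 'b::euclidean_space"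
  assumes K: "continuous_on UNIV K" "\<And>z. norm z > r \<Longrightarrow> K z = 0" and e: "e > 0"
  obtains d where "d > 0" "d \<le> 1" "\<And>z z'. norm (z' - z) < d \<Longrightarrow> norm (K z' - K z) \<le> e"
proof -
  have "uniformly_continuous_on (cball 0 (r + 2)) K"
    by (intro compact_uniformly_continuous continuous_on_subset[OF K(1)]) auto
  then obtain d where d: "d > 0" "\<And>z z'. norm z \<le> r + 2 \<Longrightarrow> norm z' \<le> r + 2 \<Longrightarrow> norm (z' - z) < d \<Longrightarrow> norm (K z' - K z) < e"
    unfolding uniformly_continuous_on_def using e by (force simp: dist_norm)
  show thesis
  proof (rule that[of "min d 1"])
    fix z z' :: 'a assume z: "norm (z' - z) < min d 1"
    show "norm (K z' - K z) \<le> e"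
    proof (cases "norm z \<le> r + 1")
      case True
      then have "norm z' \<le> r + 2" using z norm_triangle_ineq2[of z' z] by simp
      then show ?thesis using d(2)[of z z'] True z by simp
    next
      case False
      then have "norm z' > r" using z norm_triangle_ineq3[of z' z] by linarith
      then show ?thesis using False K(2)[of z] K(2)[of z'] e by simp
    qed
  qed (use d in auto)
qed

lemma convolution_bound:
  fixes k :: "'a::euclidean_space \<Rightarrow> 'b::euclidean_space"
  assumes f: "locally_integrable f" and i: "integrable lborel (\<lambda>x. f x *\<^sub>R k x)"
    and k: "\<And>x. norm (k x) \<le> e" "\<And>x. norm (y - x) > r \<Longrightarrow> k x = 0"
  shows "norm (\<integral>x. f x *\<^sub>R k x \<partial>lborel) \<le> e * (\<integral>x. \<bar>indicator (cball y r) x * f x\<bar> \<partial>lborel)"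
proof -
  have "norm (\<integral>x. f x *\<^sub>R k x \<partial>lborel) \<le> (\<integral>x. norm (f x *\<^sub>R k x) \<partial>lborel)" by (rule integral_norm_bound)
  also have "\<dots> \<le> (\<integral>x. e * \<bar>indicator (cball y r) x * f x\<bar> \<partial>lborel)"
  proof (rule integral_mono)
    show "integrable lborel (\<lambda>x. norm (f x *\<^sub>R k x))" using i by (rule integrable_norm)
    show "integrable lborel (\<lambda>x. e * \<bar>indicator (cball y r) x * f x\<bar>)"
      using f by (auto simp: locally_integrable_def)
    fix x
    show "norm (f x *\<^sub>R k x) \<le> e * \<bar>indicator (cball y r) x * f x\<bar>"
    proof (cases "norm (y - x) \<le> r")
      case True
      then show ?thesis using k(1)[of x] by (simp add: dist_norm mult.commute[of "\<bar>f x\<bar>"] mult_right_mono)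
    next
      case False
      then show ?thesis using k(2)[of x] order_trans[OF norm_ge_zero k(1)[of x]] by simp
    qed
  qed
  finally show ?thesis by simp
qed

lemma convolution_continuous:
  fixes K :: "'a::euclidean_space \<Rightarrow> 'b::euclidean_space"
  assumes f: "locally_integrable f" and K: "continuous_on UNIV K" "\<And>z. norm z > r \<Longrightarrow> K z = 0"
  shows "continuous_on UNIV (\<lambda>y. \<integral>x. f x *\<^sub>R K (y - x) \<partial>lborel)"
proof -
  have "isCont (\<lambda>y. \<integral>x. f x *\<^sub>R K (y - x) \<partial>lborel) y" for y
    unfolding continuous_at_eps_delta dist_norm
  proof (intro allI impI)
    fix e :: real assume e: "e > 0"
    define I where "I = (\<integral>x. \<bar>indicator (cball y (r + 1)) x * f x\<bar> \<partial>lborel)"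
    have I: "I \<ge> 0" unfolding I_def by (rule Bochner_Integration.integral_nonneg) auto
    have "e / (I + 1) > 0" using e I by simp
    from uniform_continuity_compact_support[OF K this]
    obtain d where d: "d > 0" "d \<le> 1" "\<And>z z'. norm (z' - z) < d \<Longrightarrow> norm (K z' - K z) \<le> e / (I + 1)"
      by blast
    show "\<exists>d>0. \<forall>x'. norm (x' - y) < d \<longrightarrow>
       norm ((\<integral>x. f x *\<^sub>R K (x' - x) \<partial>lborel) - (\<integral>x. f x *\<^sub>R K (y - x) \<partial>lborel)) < e"
    proof (intro exI[of _ d] conjI allI impI d(1))
      fix y' assume y': "norm (y' - y) < d"
      note i = convolution_integrable[OF f K]
      have eq: "f x *\<^sub>R (K (y' - x) - K (y - x)) = f x *\<^sub>R K (y' - x) - f x *\<^sub>R K (y - x)" for x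
        by (simp add: scaleR_diff_right)
      have "norm (\<integral>x. f x *\<^sub>R (K (y' - x) - K (y - x)) \<partial>lborel) \<le> e / (I + 1) * I"
        unfolding I_def
      proof (rule convolution_bound[OF f])
        show "integrable lborel (\<lambda>x. f x *\<^sub>R (K (y' - x) - K (y - x)))" unfolding eq using i by simp
        show "norm (K (y' - x) - K (y - x)) \<le> e / ((\<integral>x. \<bar>indicator (cball y (r + 1)) x * f x\<bar> \<partial>lborel) + 1)" for x
          using d(3)[of "y' - x" "y - x"] y' by (simp add: I_def)
        show "K (y' - x) - K (y - x) = 0" if "norm (y - x) > r + 1" for x
        proof -
          have "norm (y - x) \<le> norm (y' - x) + norm (y' - y)"
            using norm_triangle_ineq4[of "y' - x" "y' - y"] by simp
          then have "norm (y' - x) > r" using that y' d by simp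
          then show ?thesis using that K(2) by simp
        qed
      qed
      also have "\<dots> < e" using e I by (simp add: field_simps)
      finally show "norm ((\<integral>x. f x *\<^sub>R K (y' - x) \<partial>lborel) - (\<integral>x. f x *\<^sub>R K (y - x) \<partial>lborel)) < e"
        unfolding eq using i by simp
    qed
  qed
  then show ?thesis by (simp add: continuous_at_imp_continuous_on)
qed

text \<open>The linearisation error of K is at most e |h| uniformly in z, by uniform continuity of
  the derivative, so it can be integrated against f. The kernel is vector valued because the lemma
  is used twice, for the mollifier and for its gradient.\<close>

lemma convolution_has_derivative:
  fixes K :: "'a::euclidean_space \<Rightarrow> 'b::euclidean_space"
  assumes f: "locally_integrable f" and K: "\<And>z. (K has_derivative K' z) (at z)"
    and K': "\<And>h. continuous_on UNIV (\<lambda>z. K' z h)"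
    and K0: "\<And>z. norm z > r \<Longrightarrow> K z = 0" and K'0: "\<And>z h. norm z > r \<Longrightarrow> K' z h = 0"
  shows "((\<lambda>y. \<integral>x. f x *\<^sub>R K (y - x) \<partial>lborel) has_derivative (\<lambda>h. \<integral>x. f x *\<^sub>R K' (y - x) h \<partial>lborel)) (at y)"
proof -
  have cK: "continuous_on UNIV K"
    using K by (meson has_derivative_continuous continuous_at_imp_continuous_on)
  have lin: "linear (K' z)" for z using K has_derivative_linear by blast
  note iK = convolution_integrable[OF f cK K0] and iK' = convolution_integrable[OF f K' K'0]
  have "linear (\<lambda>h. \<integral>x. f x *\<^sub>R K' (y - x) h \<partial>lborel)"
  proof (rule linearI)
    show "(\<integral>x. f x *\<^sub>R K' (y - x) (a + b) \<partial>lborel) = (\<integral>x. f x *\<^sub>R K' (y - x) a \<partial>lborel) + (\<integral>x. f x *\<^sub>R K' (y - x) b \<partial>lborel)" for a b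
      using lin iK' by (simp add: linear_add scaleR_add_right)
    show "(\<integral>x. f x *\<^sub>R K' (y - x) (c *\<^sub>R b) \<partial>lborel) = c *\<^sub>R (\<integral>x. f x *\<^sub>R K' (y - x) b \<partial>lborel)" for c b
    proof -
      have "f x *\<^sub>R K' (y - x) (c *\<^sub>R b) = c *\<^sub>R (f x *\<^sub>R K' (y - x) b)" for x
        using lin by (simp add: linear_cmul)
      then show ?thesis by (simp only: integral_scaleR_right)
    qed
  qed
  then have bl: "bounded_linear (\<lambda>h. \<integral>x. f x *\<^sub>R K' (y - x) h \<partial>lborel)" by (simp add: linear_conv_bounded_linear)
  \<comment> \<open>An increment shorter than d <= 1 moves the support of K by less than 1, so one
    integral of |f| over the ball of radius r + 1 serves all increments. The 1 added to I below
    avoids a division by zero.\<close>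
  define I where "I = (\<integral>x. \<bar>indicator (cball y (r + 1)) x * f x\<bar> \<partial>lborel)"
  have I: "I \<ge> 0" unfolding I_def by (rule Bochner_Integration.integral_nonneg) auto
  have unif: "\<exists>d>0. d \<le> 1 \<and> (\<forall>z h. norm h < d \<longrightarrow> norm (K (z + h) - K z - K' z h) \<le> e * norm h)" if e: "e > 0" for e
  proof -
    \<comment> \<open>Closeness of K' in each of the DIM('a) coordinate directions up to this share
      gives closeness e in operator norm.\<close>
    define e' where "e' = e / DIM('a)"
    have e': "e' > 0" using e by (simp add: e'_def)
    have "\<forall>i\<in>Basis. \<exists>d. d > 0 \<and> d \<le> 1 \<and> (\<forall>z z'. norm (z' - z) < d \<longrightarrow> norm (K' z' i - K' z i) \<le> e')"
      using uniform_continuity_compact_support[OF K' K'0 e'] by metis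
    then obtain D where D: "\<And>i. i \<in> Basis \<Longrightarrow> D i > 0 \<and> D i \<le> 1 \<and> (\<forall>z z'. norm (z' - z) < D i \<longrightarrow> norm (K' z' i - K' z i) \<le> e')"
      by metis
    define d where "d = Min (D ` (Basis::'a set))"
    have d: "d > 0" "d \<le> 1" "\<And>i. i \<in> Basis \<Longrightarrow> d \<le> D i"
    proof -
      show "d > 0" unfolding d_def using D by (subst Min_gr_iff) auto
      show le: "\<And>i. i \<in> Basis \<Longrightarrow> d \<le> D i" unfolding d_def by (intro Min_le) auto
      show "d \<le> 1" using le[OF SOME_Basis] D[OF SOME_Basis] by linarith
    qed
    have on: "onorm (K' z' - K' z) \<le> e" if "norm (z' - z) < d" for z z'
    proof (rule onorm_bound)
      fix h
      have rep: "K' w h = (\<Sum>i\<in>Basis. (h \<bullet> i) *\<^sub>R K' w i)" for w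
        using lin[of w] by (subst (1) euclidean_representation[of h, symmetric]) (simp only: linear_sum linear_cmul)
      have "(K' z' - K' z) h = (\<Sum>i\<in>Basis. (h \<bullet> i) *\<^sub>R (K' z' i - K' z i))"
        by (simp add: rep[of z] rep[of z'] sum_subtractf scaleR_diff_right)
      also have "norm \<dots> \<le> (\<Sum>i\<in>(Basis::'a set). norm h * e')"
      proof (rule sum_norm_le)
        fix i :: 'a assume i: "i \<in> Basis"
        have "norm (K' z' i - K' z i) \<le> e'" using D[OF i] d(3)[OF i] that by force
        then show "norm ((h \<bullet> i) *\<^sub>R (K' z' i - K' z i)) \<le> norm h * e'"
          using Basis_le_norm[OF i, of h] by (simp add: mult_mono)
      qed
      also have "\<dots> = e * norm h" by (simp add: e'_def)
      finally show "norm ((K' z' - K' z) h) \<le> e * norm h" .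
    qed (use e in simp)
    have "norm (K (z + h) - K z - K' z h) \<le> e * norm h" if h: "norm h < d" for z h
    proof -
      have "norm (K (z + h) - K z - K' z ((z + h) - z)) \<le> norm ((z + h) - z) * e"
      proof (rule differentiable_bound_linearization[where S="ball z d"])
        show "z + t *\<^sub>R (z + h - z) \<in> ball z d" if "t \<in> {0..1}" for t
        proof -
          have "norm (t *\<^sub>R h) \<le> 1 * norm h" unfolding norm_scaleR using that by (intro mult_right_mono) auto
          then show ?thesis using h by (simp add: dist_norm)
        qed
        show "(K has_derivative K' x) (at x within ball z d)" for x by (rule has_derivative_at_withinI[OF K])
        show "onorm (K' x - K' z) \<le> e" if "x \<in> ball z d" for x using on that by (auto simp: dist_norm norm_minus_commute)
        show "z \<in> ball z d" using d by simp
      qed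
      then show ?thesis by (simp add: mult.commute)
    qed
    then show ?thesis using d by blast
  qed
  show ?thesis unfolding has_derivative_at_alt
  proof (intro conjI allI impI bl)
    fix e :: real assume e: "e > 0"
    have "e / (I + 1) > 0" using e I by simp
    from unif[OF this] obtain d where d: "d > 0" "d \<le> 1"
      "\<And>z h. norm h < d \<Longrightarrow> norm (K (z + h) - K z - K' z h) \<le> e / (I + 1) * norm h" by blast
    show "\<exists>d>0. \<forall>y'. norm (y' - y) < d \<longrightarrow>
       norm ((\<integral>x. f x *\<^sub>R K (y' - x) \<partial>lborel) - (\<integral>x. f x *\<^sub>R K (y - x) \<partial>lborel) - (\<integral>x. f x *\<^sub>R K' (y - x) (y' - y) \<partial>lborel)) \<le> e * norm (y' - y)"
    proof (intro exI[of _ d] conjI allI impI d(1))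
      fix y' assume y': "norm (y' - y) < d"
      have eq: "f x *\<^sub>R (K (y' - x) - K (y - x) - K' (y - x) (y' - y)) = f x *\<^sub>R K (y' - x) - f x *\<^sub>R K (y - x) - f x *\<^sub>R K' (y - x) (y' - y)" for x
        by (simp add: scaleR_diff_right)
      have "norm (\<integral>x. f x *\<^sub>R (K (y' - x) - K (y - x) - K' (y - x) (y' - y)) \<partial>lborel) \<le> (e / (I + 1) * norm (y' - y)) * I"
        unfolding I_def
      proof (rule convolution_bound[OF f])
        show "integrable lborel (\<lambda>x. f x *\<^sub>R (K (y' - x) - K (y - x) - K' (y - x) (y' - y)))"
          unfolding eq using iK iK' by simp
        show "norm (K (y' - x) - K (y - x) - K' (y - x) (y' - y))
            \<le> e / ((\<integral>x. \<bar>indicator (cball y (r + 1)) x * f x\<bar> \<partial>lborel) + 1) * norm (y' - y)" for x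
          using d(3)[of "y' - y" "y - x"] y' by (simp add: I_def)
        show "K (y' - x) - K (y - x) - K' (y - x) (y' - y) = 0" if "norm (y - x) > r + 1" for x
        proof -
          have "norm (y - x) \<le> norm (y' - x) + norm (y' - y)"
            using norm_triangle_ineq4[of "y' - x" "y' - y"] by simp
          then have "norm (y' - x) > r" using that y' d by simp
          then show ?thesis using that K0 K'0 by simp
        qed
      qed
      also have "\<dots> \<le> e * norm (y' - y)" using e I by (simp add: field_simps mult_left_mono)
      finally show "norm ((\<integral>x. f x *\<^sub>R K (y' - x) \<partial>lborel) - (\<integral>x. f x *\<^sub>R K (y - x) \<partial>lborel) - (\<integral>x. f x *\<^sub>R K' (y - x) (y' - y) \<partial>lborel)) \<le> e * norm (y' - y)"
        unfolding eq using iK iK' by simp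
    qed
  qed
qed

section \<open>Square integrable functions\<close>

lemma mollified_C2_fun:
  assumes f: "locally_integrable f" and \<rho>: "C2_fun \<rho> g H" and \<rho>0: "\<And>x. norm x \<ge> r \<Longrightarrow> \<rho> x = 0"
  shows "C2_fun (\<lambda>y. \<integral>x. f x * \<rho> (y - x) \<partial>lborel) (\<lambda>y. \<integral>x. f x *\<^sub>R g (y - x) \<partial>lborel)
      (\<lambda>y h. \<integral>x. f x *\<^sub>R H (y - x) h \<partial>lborel)"
    and "trace_op (\<lambda>h. \<integral>x. f x *\<^sub>R H (y - x) h \<partial>lborel) = (\<Sum>i\<in>Basis. \<integral>x. f x * (H (y - x) i \<bullet> i) \<partial>lborel)"
proof -
  have op: "open {x::'a. norm x > r}" by (intro open_Collect_less continuous_intros)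
  note z = C2_fun_zero_on_open[OF \<rho> op]
  have g0: "g x = 0" and H0: "H x h = 0" and \<rho>0': "\<rho> x = 0" if "norm x > r" for x h
    using z(1,2)[of x] that \<rho>0 by auto
  note c = C2_funD[OF \<rho>]
  note ig = convolution_integrable[OF f c(6) g0] and iH = convolution_integrable[OF f c(4) H0]
  have d1: "((\<lambda>y. \<integral>x. f x *\<^sub>R \<rho> (y - x) \<partial>lborel) has_derivative (\<lambda>h. \<integral>x. f x *\<^sub>R (g (y - x) \<bullet> h) \<partial>lborel)) (at y)" for y
    by (rule convolution_has_derivative[OF f c(1), where r=r]) (auto intro!: continuous_intros c simp: \<rho>0 g0)
  have eq1: "(\<integral>x. f x *\<^sub>R (g (y - x) \<bullet> h) \<partial>lborel) = (\<integral>x. f x *\<^sub>R g (y - x) \<partial>lborel) \<bullet> h" for y h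
  proof -
    have "(\<integral>x. f x *\<^sub>R (g (y - x) \<bullet> h) \<partial>lborel) = (\<integral>x. (f x *\<^sub>R g (y - x)) \<bullet> h \<partial>lborel)" by simp
    also have "\<dots> = (\<integral>x. f x *\<^sub>R g (y - x) \<partial>lborel) \<bullet> h" using ig by (intro integral_inner_left) auto
    finally show ?thesis .
  qed
  have d1': "((\<lambda>y. \<integral>x. f x * \<rho> (y - x) \<partial>lborel) has_derivative (\<lambda>h. (\<integral>x. f x *\<^sub>R g (y - x) \<partial>lborel) \<bullet> h)) (at y)" for y
    using d1[of y, unfolded eq1] by simp
  have d2: "((\<lambda>y. \<integral>x. f x *\<^sub>R g (y - x) \<partial>lborel) has_derivative (\<lambda>h. \<integral>x. f x *\<^sub>R H (y - x) h \<partial>lborel)) (at y)" for y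
    by (rule convolution_has_derivative[OF f c(2) c(4), where r=r]) (auto simp: g0 H0)
  have inner: "(\<integral>x. f x *\<^sub>R H (y - x) h \<partial>lborel) \<bullet> k = (\<integral>x. f x * (H (y - x) h \<bullet> k) \<partial>lborel)" for y h k
  proof -
    have "(\<integral>x. f x *\<^sub>R H (y - x) h \<partial>lborel) \<bullet> k = (\<integral>x. (f x *\<^sub>R H (y - x) h) \<bullet> k \<partial>lborel)"
      using iH by (intro integral_inner_left[symmetric]) auto
    then show ?thesis by simp
  qed
  have sym: "(\<integral>x. f x *\<^sub>R H (y - x) h \<partial>lborel) \<bullet> k = h \<bullet> (\<integral>x. f x *\<^sub>R H (y - x) k \<partial>lborel)" for y h k
    using inner[of y h k] inner[of y k h] c(3) by (simp add: inner_commute)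
  show "C2_fun (\<lambda>y. \<integral>x. f x * \<rho> (y - x) \<partial>lborel) (\<lambda>y. \<integral>x. f x *\<^sub>R g (y - x) \<partial>lborel)
      (\<lambda>y h. \<integral>x. f x *\<^sub>R H (y - x) h \<partial>lborel)"
    unfolding C2_fun_def using d1' d2 sym convolution_continuous[OF f c(4) H0] by blast
  show "trace_op (\<lambda>h. \<integral>x. f x *\<^sub>R H (y - x) h \<partial>lborel) = (\<Sum>i\<in>Basis. \<integral>x. f x * (H (y - x) i \<bullet> i) \<partial>lborel)"
    by (simp add: trace_op_def inner)
qed

text \<open>Each derivative of the reflected kernel costs a sign, and two of them cancel. Thus
  testing with the reflected kernel produces exactly the second derivatives of the
  mollification.\<close>

lemma deriv_iter_twice_reflected:
  assumes "C2_fun \<rho> g H"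
  shows "deriv_iter [i, i] (\<lambda>x. \<rho> (y - x)) x = H (y - x) i \<bullet> i"
proof -
  note c = C2_funD[OF assms]
  have m: "((\<lambda>x. y - x) has_derivative (\<lambda>h. - h)) (at x)" for x by (auto intro!: derivative_eq_intros)
  have d1: "((\<lambda>x. \<rho> (y - x)) has_derivative (\<lambda>h. - (g (y - x) \<bullet> h))) (at x)" for x
    using has_derivative_compose[OF m c(1)] by simp
  have "frechet_derivative (\<lambda>x. \<rho> (y - x)) (at x) = (\<lambda>h. - (g (y - x) \<bullet> h))" for x
    using frechet_derivative_at[OF d1] by simp
  then have e1: "deriv_iter [i] (\<lambda>x. \<rho> (y - x)) = (\<lambda>x. - (g (y - x) \<bullet> i))" by (simp add: fun_eq_iff)
  have "((\<lambda>x. g (y - x)) has_derivative (\<lambda>h. H (y - x) (- h))) (at x)"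
    by (rule has_derivative_compose[OF m c(2)])
  then have "((\<lambda>x. - (g (y - x) \<bullet> i)) has_derivative (\<lambda>h. - (H (y - x) (- h) \<bullet> i))) (at x)"
    by (intro derivative_intros)
  then have "frechet_derivative (\<lambda>x. - (g (y - x) \<bullet> i)) (at x) = (\<lambda>h. - (H (y - x) (- h) \<bullet> i))"
    using frechet_derivative_at by metis
  then show ?thesis using e1 linear_neg[OF c(5)] by simp
qed

text \<open>The Borel counterpart of \<open>L2\<close>: translations and Fubini arguments take place
  on \<open>lborel\<close>, and a function in \<open>L2\<close> is replaced by a Borel
  representative at the end.\<close>

definition square_integrable :: "('a::euclidean_space \<Rightarrow> real) \<Rightarrow> bool" where
  "square_integrable f \<longleftrightarrow> f \<in> borel_measurable borel \<and> integrable lborel (\<lambda>x. (f x)\<^sup>2)"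

lemma square_sum_le: "(a + b :: real)\<^sup>2 \<le> 2 * a\<^sup>2 + 2 * b\<^sup>2"
  using sum_squares_bound[of a b] by (simp add: power2_sum)

lemma square_integrableD:
  assumes "square_integrable f"
  shows "f \<in> borel_measurable borel" "integrable lborel (\<lambda>x. (f x)\<^sup>2)"
  using assms by (auto simp: square_integrable_def)

lemma square_integrable_add:
  assumes f: "square_integrable f" and g: "square_integrable g"
  shows "square_integrable (\<lambda>x. f x + g x)"
proof -
  note [measurable] = square_integrableD(1)[OF f] square_integrableD(1)[OF g]
  have "integrable lborel (\<lambda>x. (f x + g x)\<^sup>2)"
  proof (rule Bochner_Integration.integrable_bound)
    show "integrable lborel (\<lambda>x. 2 * (f x)\<^sup>2 + 2 * (g x)\<^sup>2)"
      using square_integrableD[OF f] square_integrableD[OF g] by simp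
    show "AE x in lborel. norm ((f x + g x)\<^sup>2) \<le> norm (2 * (f x)\<^sup>2 + 2 * (g x)\<^sup>2)"
      by (simp add: square_sum_le)
  qed measurable
  then show ?thesis by (simp add: square_integrable_def)
qed

lemma square_integrable_cmult:
  "square_integrable f \<Longrightarrow> square_integrable (\<lambda>x. c * f x)"
  by (auto simp: square_integrable_def power_mult_distrib)

lemma square_integrable_diff:
  "square_integrable f \<Longrightarrow> square_integrable g \<Longrightarrow> square_integrable (\<lambda>x. f x - g x)"
  using square_integrable_add[of f "\<lambda>x. (-1) * g x"] square_integrable_cmult[of g "-1"] by simp

lemma square_integrable_translate:
  assumes "square_integrable f"
  shows "square_integrable (\<lambda>x. f (x + z))" "(\<integral>x. (f (x + z))\<^sup>2 \<partial>lborel) = (\<integral>x. (f x)\<^sup>2 \<partial>lborel)"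
  using assms lborel_integrable_translate[of "\<lambda>x. (f x)\<^sup>2"] lborel_integral_translate[of "\<lambda>x. (f x)\<^sup>2"]
  by (auto simp: square_integrable_def)

lemma square_integrable_sum:
  "finite A \<Longrightarrow> (\<And>i. i \<in> A \<Longrightarrow> square_integrable (f i)) \<Longrightarrow> square_integrable (\<lambda>x. \<Sum>i\<in>A. f i x)"
  by (induction A rule: finite_induct) (auto intro!: square_integrable_add simp: square_integrable_def[of "\<lambda>x. 0"])

lemma square_integrable_imp_locally_integrable:
  assumes "square_integrable f"
  shows "locally_integrable f"
proof -
  note [measurable] = square_integrableD(1)[OF assms]
  have "integrable lborel (\<lambda>x. indicator (cball c R) x * f x)" for c R
  proof (rule Bochner_Integration.integrable_bound)
    show "integrable lborel (\<lambda>x. indicator (cball c R) x + (f x)\<^sup>2)"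
      using square_integrableD[OF assms]
      by (intro Bochner_Integration.integrable_add integrable_real_indicator emeasure_lborel_cball_finite) auto
    have "\<bar>t\<bar> \<le> 1 + t\<^sup>2" for t :: real
      using zero_le_power2[of "\<bar>t\<bar> - 1"] by (simp add: power2_diff power2_abs) 
    then show "AE x in lborel. norm (indicator (cball c R) x * f x) \<le> norm (indicator (cball c R) x + (f x)\<^sup>2)"
      by (intro AE_I2) (auto simp: indicator_def)
    show "(\<lambda>x. indicator (cball c R) x * f x) \<in> borel_measurable lborel"
      using square_integrableD(1)[OF assms] by (auto intro!: borel_measurable_times borel_measurable_indicator)
  qed
  then show ?thesis using assms by (simp add: locally_integrable_def square_integrable_def)
qed

lemma square_integrable_continuous:
  assumes "continuous_on UNIV g" "\<And>x. norm x > R \<Longrightarrow> g x = 0"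
  shows "square_integrable g"
  unfolding square_integrable_def
  using assms by (auto intro!: borel_measurable_continuous_onI integrable_continuous_compact_support[of _ R] continuous_intros)

definition clamp1 :: "real \<Rightarrow> real \<Rightarrow> real" where "clamp1 k t = max (- k) (min k t)"

text \<open>Truncating f in space and in value gives a first approximation F k. Measurability
  provides continuous functions converging to f almost everywhere; the same truncation applied to
  them supplies the dominating function that turns this into L2 convergence to F k.\<close>

lemma continuous_approximation_L2:
  fixes f :: "'a::euclidean_space \<Rightarrow> real"
  assumes f: "square_integrable f" and e: "e > 0"
  obtains g R where "continuous_on UNIV g" "\<And>x. norm x > R \<Longrightarrow> g x = 0" "(\<integral>x. (f x - g x)\<^sup>2 \<partial>lborel) \<le> e"
proof -
  note [measurable] = square_integrableD(1)[OF f]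
  define \<theta> where "\<theta> k x = max 0 (min 1 (real k + 1 - norm x))" for k and x :: 'a
  have \<theta>: "0 \<le> \<theta> k x" "\<theta> k x \<le> 1" for k x by (auto simp: \<theta>_def)
  have \<theta>0: "\<theta> k x = 0" if "norm x > real k + 1" for k x using that by (auto simp: \<theta>_def)
  have c\<theta>: "continuous_on UNIV (\<theta> k)" for k unfolding \<theta>_def by (intro continuous_intros)
  have [measurable]: "\<theta> k \<in> borel_measurable borel" for k by (rule borel_measurable_continuous_onI[OF c\<theta>])
  define F where "F k x = \<theta> k x * clamp1 (real k) (f x)" for k x
  have mF [measurable]: "F k \<in> borel_measurable borel" for k unfolding F_def clamp1_def by measurable
  have "(\<lambda>k. \<integral>x. (f x - F k x)\<^sup>2 \<partial>lborel) \<longlonglongrightarrow> (\<integral>x. 0 \<partial>(lborel :: 'a measure))"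
  proof (rule integral_dominated_convergence[where w="\<lambda>x. (f x)\<^sup>2"])
    show "integrable lborel (\<lambda>x. (f x)\<^sup>2)" by (rule square_integrableD[OF f])
    have "(\<lambda>k. (f x - F k x)\<^sup>2) \<longlonglongrightarrow> 0" for x
    proof (rule tendsto_eventually)
      obtain N where N: "real N \<ge> \<bar>f x\<bar> + norm x" using real_arch_simple by blast
      show "eventually (\<lambda>k. (f x - F k x)\<^sup>2 = 0) sequentially"
        using eventually_ge_at_top[of N]
      proof eventually_elim
        case (elim k)
          have "norm x \<le> real k" "\<bar>f x\<bar> \<le> real k"
            using N elim norm_ge_zero[of x] by linarith+
          then have "\<theta> k x = 1" "clamp1 (real k) (f x) = f x" by (auto simp: \<theta>_def clamp1_def)
        then show ?case by (simp add: F_def)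
      qed
    qed
    then show "AE x in lborel. (\<lambda>k. (f x - F k x)\<^sup>2) \<longlonglongrightarrow> 0" by simp
    have "(f x - F k x)\<^sup>2 \<le> (f x)\<^sup>2" for k x
    proof -
      \<comment> \<open>Clamping only multiplies f x by a factor in [0, 1], so the squared error
        never exceeds (f x)^2.\<close>
      have "\<exists>s. 0 \<le> s \<and> s \<le> 1 \<and> clamp1 (real k) (f x) = s * f x"
      proof (cases "\<bar>f x\<bar> \<le> real k")
        case True then show ?thesis by (intro exI[of _ 1]) (auto simp: clamp1_def)
      next
        case False
        then consider "f x > real k" | "f x < - real k" by linarith
        then show ?thesis
          by cases (intro exI[of _ "real k / \<bar>f x\<bar>"]; simp add: clamp1_def field_simps)+
      qed
      then obtain s where s: "0 \<le> s" "s \<le> 1" "clamp1 (real k) (f x) = s * f x" by blast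
      have "f x - F k x = (1 - \<theta> k x * s) * f x" by (simp add: F_def s algebra_simps)
      moreover have "0 \<le> \<theta> k x * s" "\<theta> k x * s \<le> 1" using s \<theta>[of k x] by (auto intro: mult_le_one)
      then have "(1 - \<theta> k x * s)\<^sup>2 \<le> 1" by (simp add: power_le_one)
      ultimately show ?thesis by (simp add: power_mult_distrib mult_left_le_one_le)
    qed
    then show "AE x in lborel. norm ((f x - F k x)\<^sup>2) \<le> (f x)\<^sup>2" for k by simp
  qed measurable
  then have "(\<lambda>k. \<integral>x. (f x - F k x)\<^sup>2 \<partial>lborel) \<longlonglongrightarrow> 0" by simp
  then have "eventually (\<lambda>k. (\<integral>x. (f x - F k x)\<^sup>2 \<partial>lborel) < e / 4) sequentially"
    using e by (intro order_tendstoD) auto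
  then obtain k where k: "(\<integral>x. (f x - F k x)\<^sup>2 \<partial>lborel) < e / 4"
    using eventually_happens sequentially_bot by blast
  have "f \<in> borel_measurable lebesgue" by (rule measurable_completion) simp
  then have "f measurable_on UNIV" using lebesgue_measurable_imp_measurable_on[of f UNIV] by simp
  then obtain N g where N: "negligible N" and cg: "\<And>n. continuous_on UNIV (g n)"
    and lim: "\<And>x. x \<notin> N \<Longrightarrow> (\<lambda>n. g n x) \<longlonglongrightarrow> f x"
    unfolding measurable_on_def by auto
  define G where "G n x = \<theta> k x * clamp1 (real k) (g n x)" for n x
  have cG: "continuous_on UNIV (G n)" for n
    unfolding G_def clamp1_def by (intro continuous_intros c\<theta> cg)
  have [measurable]: "G n \<in> borel_measurable borel" for n by (rule borel_measurable_continuous_onI[OF cG])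
  have "(\<lambda>n. \<integral>x. (F k x - G n x)\<^sup>2 \<partial>lebesgue) \<longlonglongrightarrow> (\<integral>x. 0 \<partial>(lebesgue :: 'a measure))"
  proof (rule integral_dominated_convergence[where w="\<lambda>x. (2 * real k)\<^sup>2 * indicator (cball 0 (real k + 1)) x"])
    have "integrable lborel (\<lambda>x::'a. (2 * real k)\<^sup>2 * indicator (cball 0 (real k + 1)) x :: real)"
      by (intro integrable_mult_right integrable_real_indicator emeasure_lborel_cball_finite) auto
    then show "integrable lebesgue (\<lambda>x::'a. (2 * real k)\<^sup>2 * indicator (cball 0 (real k + 1)) x :: real)"
      by (subst integrable_completion) auto
    show "(\<lambda>x. (F k x - G n x)\<^sup>2) \<in> borel_measurable lebesgue" for n by (rule measurable_completion) measurable
    have "AE x in lebesgue. x \<notin> N" using N by (simp add: negligible_iff_null_sets AE_not_in)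
    then show "AE x in lebesgue. (\<lambda>n. (F k x - G n x)\<^sup>2) \<longlonglongrightarrow> 0"
    proof eventually_elim
      case (elim x)
      have "(\<lambda>n. (F k x - G n x)\<^sup>2) \<longlonglongrightarrow> (F k x - \<theta> k x * clamp1 (real k) (f x))\<^sup>2"
        unfolding G_def clamp1_def by (intro tendsto_intros lim elim)
      then show ?case by (simp add: F_def)
    qed
    have "norm ((F k x - G n x)\<^sup>2) \<le> (2 * real k)\<^sup>2 * indicator (cball 0 (real k + 1)) x" for n x
    proof (cases "norm x > real k + 1")
      case True then show ?thesis using \<theta>0[of k x] by (simp add: F_def G_def)
    next
      case False
      have cl: "\<bar>clamp1 (real k) t\<bar> \<le> real k" for t by (auto simp: clamp1_def)
      have "\<theta> k x * \<bar>clamp1 (real k) t\<bar> \<le> 1 * real k" for t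
        using \<theta>[of k x] cl by (intro mult_mono) auto
      then have "\<bar>F k x\<bar> \<le> real k" "\<bar>G n x\<bar> \<le> real k"
        unfolding F_def G_def abs_mult using \<theta>[of k x] by auto
      then have "\<bar>F k x - G n x\<bar> \<le> \<bar>2 * real k\<bar>" by linarith
      then have "(F k x - G n x)\<^sup>2 \<le> (2 * real k)\<^sup>2" by (simp only: abs_le_square_iff)
      then show ?thesis using False by (simp del: power_mult_distrib power_mult_numeral)
    qed
    then show "AE x in lebesgue. norm ((F k x - G n x)\<^sup>2) \<le> (2 * real k)\<^sup>2 * indicator (cball 0 (real k + 1)) x" for n
      by simp
  qed auto
  moreover have "(\<integral>x. (F k x - G n x)\<^sup>2 \<partial>lebesgue) = (\<integral>x. (F k x - G n x)\<^sup>2 \<partial>lborel)" for n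
    by (rule integral_completion) measurable
  ultimately have "(\<lambda>n. \<integral>x. (F k x - G n x)\<^sup>2 \<partial>lborel) \<longlonglongrightarrow> 0" by simp
  then have "eventually (\<lambda>n. (\<integral>x. (F k x - G n x)\<^sup>2 \<partial>lborel) < e / 4) sequentially"
    using e by (intro order_tendstoD) auto
  then obtain n where n: "(\<integral>x. (F k x - G n x)\<^sup>2 \<partial>lborel) < e / 4"
    using eventually_happens sequentially_bot by blast
  have G0: "G n x = 0" if "norm x > real k + 1" for x using \<theta>0[OF that] by (simp add: G_def)
  have G: "square_integrable (G n)" by (rule square_integrable_continuous[OF cG G0])
  have F: "square_integrable (F k)"
  proof -
    have "integrable lborel (\<lambda>x. (F k x)\<^sup>2)"
    proof (rule Bochner_Integration.integrable_bound[OF square_integrableD(2)[OF f]])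
      have "\<bar>F k x\<bar> \<le> 1 * \<bar>f x\<bar>" for x
        unfolding F_def abs_mult using \<theta>[of k x] by (intro mult_mono) (auto simp: clamp1_def)
      then show "AE x in lborel. norm ((F k x)\<^sup>2) \<le> norm ((f x)\<^sup>2)"
        by (simp add: abs_le_square_iff[symmetric])
    qed measurable
    then show ?thesis by (simp add: square_integrable_def)
  qed
  note d1 = square_integrableD(2)[OF square_integrable_diff[OF f F]]
    and d2 = square_integrableD(2)[OF square_integrable_diff[OF F G]]
    and d3 = square_integrableD(2)[OF square_integrable_diff[OF f G]]
  show thesis
  proof (rule that[OF cG G0])
    have "(\<integral>x. (f x - G n x)\<^sup>2 \<partial>lborel) \<le> (\<integral>x. 2 * (f x - F k x)\<^sup>2 + 2 * (F k x - G n x)\<^sup>2 \<partial>lborel)"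
    proof (rule integral_mono[OF d3])
      show "integrable lborel (\<lambda>x. 2 * (f x - F k x)\<^sup>2 + 2 * (F k x - G n x)\<^sup>2)" using d1 d2 by simp
      show "(f x - G n x)\<^sup>2 \<le> 2 * (f x - F k x)\<^sup>2 + 2 * (F k x - G n x)\<^sup>2" for x
        using square_sum_le[of "f x - F k x" "F k x - G n x"] by simp
    qed
    also have "\<dots> = 2 * (\<integral>x. (f x - F k x)\<^sup>2 \<partial>lborel) + 2 * (\<integral>x. (F k x - G n x)\<^sup>2 \<partial>lborel)" using d1 d2 by simp
    also have "\<dots> \<le> e" using k n by simp
    finally show "(\<integral>x. (f x - G n x)\<^sup>2 \<partial>lborel) \<le> e" .
  qed
qed

text \<open>For continuous g of compact support this is uniform continuity. The other two terms of
  the splitting involve f - g and its translate, which have equal norm. The shares add up as 3 (e /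
  12) + 3 (e / 6) + 3 (e / 12) = e.\<close>

lemma translation_continuous_L2:
  fixes f :: "'a::euclidean_space \<Rightarrow> real"
  assumes f: "square_integrable f" and e: "e > 0"
  obtains d where "d > 0" "\<And>z. norm z < d \<Longrightarrow> (\<integral>x. (f (x + z) - f x)\<^sup>2 \<partial>lborel) \<le> e"
proof -
  obtain g R where cg: "continuous_on UNIV g" and g0: "\<And>x. norm x > R \<Longrightarrow> g x = 0"
    and fg: "(\<integral>x. (f x - g x)\<^sup>2 \<partial>lborel) \<le> e / 12"
    using continuous_approximation_L2[OF f, of "e / 12"] e by auto
  have g: "square_integrable g" by (rule square_integrable_continuous[OF cg g0])
  define m where "m = measure lborel (cball (0::'a) (R + 1))"
  have m: "m \<ge> 0" by (simp add: m_def)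
  define e' where "e' = sqrt (e / (6 * (m + 1)))"
  have e': "e' > 0" "e'\<^sup>2 = e / (6 * (m + 1))" using e m by (auto simp: e'_def)
  from uniform_continuity_compact_support[OF cg g0 e'(1)]
  obtain d where d: "d > 0" "d \<le> 1" "\<And>z z'. norm (z' - z) < d \<Longrightarrow> norm (g z' - g z) \<le> e'" by blast
  show thesis
  proof (rule that[OF d(1)])
    fix z :: 'a assume z: "norm z < d"
    note t = square_integrable_translate[OF square_integrable_diff[OF f g], of z]
    note gg = square_integrable_diff[OF square_integrable_translate(1)[OF g, of z] g]
    have ff: "square_integrable (\<lambda>x. f (x + z) - f x)"
      by (intro square_integrable_diff square_integrable_translate f)
    note fg2 = square_integrable_diff[OF f g]
    have ci: "integrable lborel (\<lambda>x. e'\<^sup>2 * indicator (cball (0::'a) (R + 1)) x :: real)"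
      by (intro integrable_mult_right integrable_real_indicator emeasure_lborel_cball_finite) auto
    have "(\<integral>x. (g (x + z) - g x)\<^sup>2 \<partial>lborel) \<le> (\<integral>x. e'\<^sup>2 * indicator (cball (0::'a) (R + 1)) x \<partial>lborel)"
    proof (rule integral_mono)
      show "integrable lborel (\<lambda>x. (g (x + z) - g x)\<^sup>2)" by (rule square_integrableD(2)[OF gg])
      show "integrable lborel (\<lambda>x::'a. e'\<^sup>2 * indicator (cball 0 (R + 1)) x)" by (rule ci)
      fix x
      show "(g (x + z) - g x)\<^sup>2 \<le> e'\<^sup>2 * indicator (cball 0 (R + 1)) x"
      proof (cases "norm x \<le> R + 1")
        case True
        have "\<bar>g (x + z) - g x\<bar> \<le> \<bar>e'\<bar>" using d(3)[of "x + z" x] z e' by simp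
        then show ?thesis using True by (simp add: abs_le_square_iff)
      next
        case False
        have "norm x \<le> norm (x + z) + norm z" using norm_triangle_ineq4[of "x + z" z] by simp
        then have "norm (x + z) > R" using False z d by simp
        then show ?thesis using False g0 by simp
      qed
    qed
    also have "\<dots> = e'\<^sup>2 * m" by (simp add: m_def)
    also have "\<dots> \<le> e / 6" using e m by (simp add: e' field_simps)
    finally have mid: "(\<integral>x. (g (x + z) - g x)\<^sup>2 \<partial>lborel) \<le> e / 6" .
    have "(\<integral>x. (f (x + z) - f x)\<^sup>2 \<partial>lborel)
      \<le> (\<integral>x. 3 * (f (x + z) - g (x + z))\<^sup>2 + 3 * (g (x + z) - g x)\<^sup>2 + 3 * (f x - g x)\<^sup>2 \<partial>lborel)"
    proof (rule integral_mono[OF square_integrableD(2)[OF ff]])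
      show "integrable lborel (\<lambda>x. 3 * (f (x + z) - g (x + z))\<^sup>2 + 3 * (g (x + z) - g x)\<^sup>2 + 3 * (f x - g x)\<^sup>2)"
        using t(1) gg fg2 by (auto simp: square_integrable_def)
      have *: "(a + b - c)\<^sup>2 \<le> 3 * a\<^sup>2 + 3 * b\<^sup>2 + 3 * c\<^sup>2" for a b c :: real
      proof -
        have "3 * a\<^sup>2 + 3 * b\<^sup>2 + 3 * c\<^sup>2 - (a + b - c)\<^sup>2 = (a - b)\<^sup>2 + (a + c)\<^sup>2 + (b + c)\<^sup>2"
          by (simp add: power2_eq_square algebra_simps)
        moreover have "0 \<le> (a - b)\<^sup>2 + (a + c)\<^sup>2 + (b + c)\<^sup>2" by simp
        ultimately show ?thesis by linarith
      qed
      show "(f (x + z) - f x)\<^sup>2 \<le> 3 * (f (x + z) - g (x + z))\<^sup>2 + 3 * (g (x + z) - g x)\<^sup>2 + 3 * (f x - g x)\<^sup>2" for x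
        using *[of "f (x + z) - g (x + z)" "g (x + z) - g x" "f x - g x"] by simp
    qed
    also have "\<dots> = 3 * (\<integral>x. (f x - g x)\<^sup>2 \<partial>lborel) + 3 * (\<integral>x. (g (x + z) - g x)\<^sup>2 \<partial>lborel) + 3 * (\<integral>x. (f x - g x)\<^sup>2 \<partial>lborel)"
      using t(1) gg fg2 t(2) by (simp add: square_integrable_def)
    also have "\<dots> \<le> e" using fg mid by simp
    finally show "(\<integral>x. (f (x + z) - f x)\<^sup>2 \<partial>lborel) \<le> e" .
  qed
qed

lemma nn_integral_lborel_translate:
  fixes f :: "'a::euclidean_space \<Rightarrow> ennreal"
  assumes [measurable]: "f \<in> borel_measurable borel"
  shows "(\<integral>\<^sup>+x. f (c + x) \<partial>lborel) = (\<integral>\<^sup>+x. f x \<partial>lborel)"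
proof -
  have "(\<integral>\<^sup>+x. f x \<partial>lborel) = (\<integral>\<^sup>+x. f x \<partial>distr lborel borel ((+) c))"
    by (simp add: lborel_distr_plus)
  also have "\<dots> = (\<integral>\<^sup>+x. f (c + x) \<partial>lborel)"
    by (subst nn_integral_distr) auto
  finally show ?thesis ..
qed

text \<open>Jensen's inequality for the probability density rho, from Cauchy-Schwarz applied to |u|
  sqrt(rho) and sqrt(rho). The right-hand side may be infinite.\<close>

lemma square_integral_le_weighted:
  fixes u \<rho> :: "'a::euclidean_space \<Rightarrow> real"
  assumes [measurable]: "u \<in> borel_measurable borel" "\<rho> \<in> borel_measurable borel"
    and \<rho>: "\<And>x. 0 \<le> \<rho> x" "(\<integral>\<^sup>+x. ennreal (\<rho> x) \<partial>lborel) = 1"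
    and i: "integrable lborel (\<lambda>x. u x * \<rho> x)"
  shows "ennreal ((\<integral>x. u x * \<rho> x \<partial>lborel)\<^sup>2) \<le> (\<integral>\<^sup>+x. ennreal ((u x)\<^sup>2 * \<rho> x) \<partial>lborel)"
proof -
  have "ennreal ((\<integral>x. u x * \<rho> x \<partial>lborel)\<^sup>2) = (ennreal (norm (\<integral>x. u x * \<rho> x \<partial>lborel)))\<^sup>2"
    by (simp add: ennreal_power)
  also have "\<dots> \<le> (\<integral>\<^sup>+x. ennreal (norm (u x * \<rho> x)) \<partial>lborel)\<^sup>2"
    by (intro power_mono integral_norm_bound_ennreal i) auto
  also have "(\<integral>\<^sup>+x. ennreal (norm (u x * \<rho> x)) \<partial>lborel)
      = (\<integral>\<^sup>+x. ennreal (\<bar>u x\<bar> * sqrt (\<rho> x)) * ennreal (sqrt (\<rho> x)) \<partial>lborel)"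
    using \<rho>(1) by (intro nn_integral_cong) (simp add: abs_mult ennreal_mult[symmetric] mult.assoc)
  also have "\<dots>\<^sup>2 \<le> (\<integral>\<^sup>+x. (ennreal (\<bar>u x\<bar> * sqrt (\<rho> x)))\<^sup>2 \<partial>lborel) * (\<integral>\<^sup>+x. (ennreal (sqrt (\<rho> x)))\<^sup>2 \<partial>lborel)"
    by (rule Cauchy_Schwarz_nn_integral) measurable
  also have "(\<integral>\<^sup>+x. (ennreal (sqrt (\<rho> x)))\<^sup>2 \<partial>lborel) = 1"
    using \<rho> by (simp add: ennreal_power)
  also have "(\<integral>\<^sup>+x. (ennreal (\<bar>u x\<bar> * sqrt (\<rho> x)))\<^sup>2 \<partial>lborel) = (\<integral>\<^sup>+x. ennreal ((u x)\<^sup>2 * \<rho> x) \<partial>lborel)"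
    using \<rho>(1) by (intro nn_integral_cong) (simp add: ennreal_power power_mult_distrib)
  finally show ?thesis by simp
qed

text \<open>The error is a weighted mean of differences between translates of f and f. Jensen and
  Tonelli bound its squared norm by the mean of the squared translation errors over |z| < d. Square
  integrability of the mollification follows from that of the error.\<close>

lemma mollification_L2_error:
  fixes f :: "'a::euclidean_space \<Rightarrow> real"
  assumes f: "square_integrable f"
    and \<rho>: "continuous_on UNIV \<rho>" "\<And>x. 0 \<le> \<rho> x" "\<And>x. norm x \<ge> d \<Longrightarrow> \<rho> x = 0"
      "integrable lborel \<rho>" "(\<integral>x. \<rho> x \<partial>lborel) = 1" "\<And>x. \<rho> (- x) = \<rho> x"
    and tr: "\<And>z. norm z < d \<Longrightarrow> (\<integral>x. (f (x + z) - f x)\<^sup>2 \<partial>lborel) \<le> e" and e: "e \<ge> 0"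
  shows "square_integrable (\<lambda>y. \<integral>x. f x * \<rho> (y - x) \<partial>lborel)"
    and "(\<integral>y. ((\<integral>x. f x * \<rho> (y - x) \<partial>lborel) - f y)\<^sup>2 \<partial>lborel) \<le> e"
proof -
  note [measurable] = square_integrableD(1)[OF f] borel_measurable_continuous_onI[OF \<rho>(1)]
  have lf: "locally_integrable f" by (rule square_integrable_imp_locally_integrable[OF f])
  define F where "F y = (\<integral>x. f x * \<rho> (y - x) \<partial>lborel)" for y
  have "continuous_on UNIV F"
    using convolution_continuous[OF lf \<rho>(1), of d] \<rho>(3) by (simp add: F_def[abs_def])
  then have [measurable]: "F \<in> borel_measurable borel" by (rule borel_measurable_continuous_onI)
  have \<rho>nn: "(\<integral>\<^sup>+x. ennreal (\<rho> x) \<partial>lborel) = 1"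
    using nn_integral_eq_integral[OF \<rho>(4)] \<rho>(2,5) by simp
  have ref: "\<rho> (y - x) = \<rho> (- y + x)" for x y using \<rho>(6)[of "y - x"] by simp
  have nn1: "(\<integral>\<^sup>+x. ennreal (\<rho> (y - x)) \<partial>lborel) = 1" for y
    unfolding ref using nn_integral_lborel_translate[of "\<lambda>x. ennreal (\<rho> x)" "- y"] \<rho>nn by simp
  have i1: "integrable lborel (\<lambda>x. \<rho> (y - x))" for y
    using lborel_integrable_translate[OF \<rho>(4), of "- y"] unfolding ref by (simp add: add.commute)
  have int1: "(\<integral>x. \<rho> (y - x) \<partial>lborel) = 1" for y
    using lborel_integral_translate[of \<rho> "- y"] \<rho>(5) unfolding ref by (simp add: add.commute)
  have if\<rho>: "integrable lborel (\<lambda>x. f x * \<rho> (y - x))" for y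
    using convolution_integrable[OF lf \<rho>(1), of d y] \<rho>(3) by simp
  have pw: "ennreal ((F y - f y)\<^sup>2) \<le> (\<integral>\<^sup>+x. ennreal ((f x - f y)\<^sup>2 * \<rho> (y - x)) \<partial>lborel)" for y
  proof -
    have eq: "(f x - f y) * \<rho> (y - x) = f x * \<rho> (y - x) - f y * \<rho> (y - x)" for x by (simp add: algebra_simps)
    have i: "integrable lborel (\<lambda>x. (f x - f y) * \<rho> (y - x))" unfolding eq using if\<rho> i1 by simp
    have "F y - f y = (\<integral>x. (f x - f y) * \<rho> (y - x) \<partial>lborel)"
      unfolding eq F_def using if\<rho> i1 int1 by simp
    then show ?thesis
      using square_integral_le_weighted[of "\<lambda>x. f x - f y" "\<lambda>x. \<rho> (y - x)"] i nn1 \<rho>(2) by simp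
  qed
  have "(\<integral>\<^sup>+y. ennreal ((F y - f y)\<^sup>2) \<partial>lborel)
     \<le> (\<integral>\<^sup>+y. \<integral>\<^sup>+x. ennreal ((f x - f y)\<^sup>2 * \<rho> (y - x)) \<partial>lborel \<partial>lborel)"
    by (intro nn_integral_mono pw)
  also have "\<dots> = (\<integral>\<^sup>+x. \<integral>\<^sup>+y. ennreal ((f x - f y)\<^sup>2 * \<rho> (y - x)) \<partial>lborel \<partial>lborel)"
    by (rule lborel_pair.Fubini') measurable
  also have "\<dots> = (\<integral>\<^sup>+x. \<integral>\<^sup>+z. ennreal ((f x - f (x + z))\<^sup>2 * \<rho> z) \<partial>lborel \<partial>lborel)"
  proof (rule nn_integral_cong)
    fix x
    show "(\<integral>\<^sup>+y. ennreal ((f x - f y)\<^sup>2 * \<rho> (y - x)) \<partial>lborel) = (\<integral>\<^sup>+z. ennreal ((f x - f (x + z))\<^sup>2 * \<rho> z) \<partial>lborel)"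
      using nn_integral_lborel_translate[of "\<lambda>y. ennreal ((f x - f y)\<^sup>2 * \<rho> (y - x))" x] by simp
  qed
  also have "\<dots> = (\<integral>\<^sup>+z. \<integral>\<^sup>+x. ennreal ((f x - f (x + z))\<^sup>2 * \<rho> z) \<partial>lborel \<partial>lborel)"
    by (rule lborel_pair.Fubini'[symmetric]) measurable
  also have "\<dots> \<le> (\<integral>\<^sup>+z. ennreal (e * \<rho> z) \<partial>lborel)"
  proof (rule nn_integral_mono)
    fix z
    show "(\<integral>\<^sup>+x. ennreal ((f x - f (x + z))\<^sup>2 * \<rho> z) \<partial>lborel) \<le> ennreal (e * \<rho> z)"
    proof (cases "norm z < d")
      case True
      have sq: "square_integrable (\<lambda>x. f (x + z) - f x)"
        by (intro square_integrable_diff square_integrable_translate f)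
      have "(\<integral>\<^sup>+x. ennreal ((f x - f (x + z))\<^sup>2 * \<rho> z) \<partial>lborel) = (\<integral>\<^sup>+x. ennreal ((f (x + z) - f x)\<^sup>2 * \<rho> z) \<partial>lborel)"
        by (simp add: power2_commute)
      also have "\<dots> = ennreal (\<integral>x. (f (x + z) - f x)\<^sup>2 * \<rho> z \<partial>lborel)"
        using square_integrableD(2)[OF sq] \<rho>(2) by (intro nn_integral_eq_integral) auto
      also have "\<dots> \<le> ennreal (e * \<rho> z)"
        using tr[OF True] \<rho>(2)[of z] by (intro ennreal_leI) (simp add: mult_right_mono)
      finally show ?thesis .
    qed (use \<rho>(3)[of z] in auto)
  qed
  also have "\<dots> = ennreal e"
    using e \<rho>(2) \<rho>nn by (simp add: ennreal_mult' nn_integral_cmult)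
  finally have fin: "(\<integral>\<^sup>+y. ennreal ((F y - f y)\<^sup>2) \<partial>lborel) \<le> ennreal e" .
  have iFf: "integrable lborel (\<lambda>y. (F y - f y)\<^sup>2)"
    by (rule integrableI_bounded) (use fin in \<open>auto intro: le_less_trans\<close>)
  then have "square_integrable (\<lambda>y. F y - f y)" by (simp add: square_integrable_def)
  from square_integrable_add[OF this f] have "square_integrable F" by simp
  then show "square_integrable (\<lambda>y. \<integral>x. f x * \<rho> (y - x) \<partial>lborel)" by (simp add: F_def[abs_def])
  have "ennreal (\<integral>y. (F y - f y)\<^sup>2 \<partial>lborel) \<le> ennreal e"
    using nn_integral_eq_integral[OF iFf] fin by simp
  then show "(\<integral>y. ((\<integral>x. f x * \<rho> (y - x) \<partial>lborel) - f y)\<^sup>2 \<partial>lborel) \<le> e"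
    using e by (simp add: F_def)
qed

lemma integrable_weighted_square:
  fixes f P :: "'a::euclidean_space \<Rightarrow> real"
  assumes f: "square_integrable f" and [measurable]: "P \<in> borel_measurable borel" and B: "\<And>x. \<bar>P x\<bar> \<le> B"
  shows "integrable lborel (\<lambda>x. P x * (f x)\<^sup>2)"
proof (rule Bochner_Integration.integrable_bound)
  note [measurable] = square_integrableD(1)[OF f]
  have B0: "B \<ge> 0" using B[of undefined] by simp
  show "integrable lborel (\<lambda>x. B * (f x)\<^sup>2)" using square_integrableD(2)[OF f] by simp
  show "AE x in lborel. norm (P x * (f x)\<^sup>2) \<le> norm (B * (f x)\<^sup>2)"
    using B B0 by (auto simp: abs_mult intro!: mult_right_mono)
  show "(\<lambda>x. P x * (f x)\<^sup>2) \<in> borel_measurable lborel" by measurable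
qed

text \<open>From |F^2 - phi^2| <= (1 + 1 / t) (F - phi)^2 + t phi^2 with t = 1 / (n + 1); the
  assumed rate t^2 is chosen so that both terms are of order t after integration.\<close>

lemma weighted_square_limit:
  fixes \<phi> P :: "'a::euclidean_space \<Rightarrow> real"
  assumes \<phi>: "square_integrable \<phi>" and F: "\<And>n. square_integrable (F n)"
    and d: "\<And>n. (\<integral>x. (F n x - \<phi> x)\<^sup>2 \<partial>lborel) \<le> (1 / (real n + 1))\<^sup>2"
    and [measurable]: "P \<in> borel_measurable borel" and B: "\<And>x. \<bar>P x\<bar> \<le> B"
  shows "(\<lambda>n. \<integral>x. P x * (F n x)\<^sup>2 \<partial>lborel) \<longlonglongrightarrow> (\<integral>x. P x * (\<phi> x)\<^sup>2 \<partial>lborel)"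
proof -
  have B0: "B \<ge> 0" using B[of undefined] by simp
  have iP: "integrable lborel (\<lambda>x. P x * (f x)\<^sup>2)" if "square_integrable f" for f
    by (rule integrable_weighted_square[OF that assms(4) B])
  define N where "N = (\<integral>x. (\<phi> x)\<^sup>2 \<partial>lborel)"
  have bound: "\<bar>(\<integral>x. P x * (F n x)\<^sup>2 \<partial>lborel) - (\<integral>x. P x * (\<phi> x)\<^sup>2 \<partial>lborel)\<bar> \<le> B * ((2 + N) * (1 / (real n + 1)))" for n
  proof -
    define t where "t = 1 / (real n + 1)"
    have t: "t > 0" "t \<le> 1" by (auto simp: t_def)
    note D = square_integrableD(2)[OF square_integrable_diff[OF F[of n] \<phi>]] and \<phi>2 = square_integrableD(2)[OF \<phi>]
    have "\<bar>(\<integral>x. P x * (F n x)\<^sup>2 \<partial>lborel) - (\<integral>x. P x * (\<phi> x)\<^sup>2 \<partial>lborel)\<bar>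
       = \<bar>\<integral>x. P x * (F n x)\<^sup>2 - P x * (\<phi> x)\<^sup>2 \<partial>lborel\<bar>"
      using iP[OF F[of n]] iP[OF \<phi>] by simp
    also have "\<dots> \<le> (\<integral>x. \<bar>P x * (F n x)\<^sup>2 - P x * (\<phi> x)\<^sup>2\<bar> \<partial>lborel)" by (rule integral_abs_bound)
    also have "\<dots> \<le> (\<integral>x. B * ((1 + 1 / t) * (F n x - \<phi> x)\<^sup>2 + t * (\<phi> x)\<^sup>2) \<partial>lborel)"
    proof (rule integral_mono)
      show "integrable lborel (\<lambda>x. \<bar>P x * (F n x)\<^sup>2 - P x * (\<phi> x)\<^sup>2\<bar>)"
        using iP[OF F[of n]] iP[OF \<phi>] by simp
      show "integrable lborel (\<lambda>x. B * ((1 + 1 / t) * (F n x - \<phi> x)\<^sup>2 + t * (\<phi> x)\<^sup>2))" using D \<phi>2 by simp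
      fix x
      define a where "a = F n x - \<phi> x"
      have young: "\<bar>2 * \<phi> x * a\<bar> \<le> 1 / t * a\<^sup>2 + t * (\<phi> x)\<^sup>2"
      proof -
        have "0 \<le> (\<bar>a\<bar> - t * \<bar>\<phi> x\<bar>)\<^sup>2 / t" using t by simp
        also have "\<dots> = 1 / t * a\<^sup>2 + t * (\<phi> x)\<^sup>2 - \<bar>2 * \<phi> x * a\<bar>"
          using t by (simp add: power2_diff power_mult_distrib abs_mult field_simps power2_eq_square[of t])
        finally show ?thesis by simp
      qed
      have "(F n x)\<^sup>2 - (\<phi> x)\<^sup>2 = a\<^sup>2 + 2 * \<phi> x * a" by (simp add: a_def power2_eq_square algebra_simps)
      then have "\<bar>(F n x)\<^sup>2 - (\<phi> x)\<^sup>2\<bar> \<le> \<bar>a\<^sup>2\<bar> + \<bar>2 * \<phi> x * a\<bar>"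
        by (simp only: abs_triangle_ineq)
      also have "\<dots> \<le> a\<^sup>2 + (1 / t * a\<^sup>2 + t * (\<phi> x)\<^sup>2)"
        by (rule add_mono[OF _ young]) simp
      also have "\<dots> = (1 + 1 / t) * a\<^sup>2 + t * (\<phi> x)\<^sup>2"
        by (simp only: distrib_right mult_1 add.assoc)
      finally have "\<bar>(F n x)\<^sup>2 - (\<phi> x)\<^sup>2\<bar> \<le> (1 + 1 / t) * a\<^sup>2 + t * (\<phi> x)\<^sup>2" .
      then have "\<bar>P x\<bar> * \<bar>(F n x)\<^sup>2 - (\<phi> x)\<^sup>2\<bar> \<le> B * ((1 + 1 / t) * a\<^sup>2 + t * (\<phi> x)\<^sup>2)"
        by (rule mult_mono[OF B _ B0 abs_ge_zero])
      then show "\<bar>P x * (F n x)\<^sup>2 - P x * (\<phi> x)\<^sup>2\<bar> \<le> B * ((1 + 1 / t) * (F n x - \<phi> x)\<^sup>2 + t * (\<phi> x)\<^sup>2)"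
        by (simp only: a_def abs_mult[symmetric] right_diff_distrib)
    qed
    also have "\<dots> = B * ((1 + 1 / t) * (\<integral>x. (F n x - \<phi> x)\<^sup>2 \<partial>lborel) + t * N)" using D \<phi>2 by (simp add: N_def)
    also have "\<dots> \<le> B * ((1 + 1 / t) * t\<^sup>2 + t * N)"
    proof (intro mult_left_mono add_right_mono)
      show "(\<integral>x. (F n x - \<phi> x)\<^sup>2 \<partial>lborel) \<le> t\<^sup>2" using d[of n] by (simp only: t_def)
    qed (use t B0 in auto)
    also have "\<dots> \<le> B * ((2 + N) * t)"
    proof (rule mult_left_mono[OF _ B0])
      have "(1 + 1 / t) * t\<^sup>2 = t * t + t" using t by (simp add: field_simps power2_eq_square)
      moreover have "t * t \<le> t * 1" using t by (intro mult_left_mono) auto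
      ultimately show "(1 + 1 / t) * t\<^sup>2 + t * N \<le> (2 + N) * t" by (simp add: algebra_simps)
    qed
    finally show ?thesis by (simp add: t_def)
  qed
  have "(\<lambda>n. B * ((2 + N) * (1 / (real n + 1)))) \<longlonglongrightarrow> B * ((2 + N) * 0)"
    using LIMSEQ_Suc[OF lim_1_over_n] by (intro tendsto_mult_left) (simp add: add.commute)
  then have "(\<lambda>n. B * ((2 + N) * (1 / (real n + 1)))) \<longlonglongrightarrow> 0" by (simp only: mult_zero_right)
  then have "(\<lambda>n. (\<integral>x. P x * (F n x)\<^sup>2 \<partial>lborel) - (\<integral>x. P x * (\<phi> x)\<^sup>2 \<partial>lborel)) \<longlonglongrightarrow> 0"
    by (rule Lim_null_comparison[rotated]) (rule always_eventually, rule allI, simp only: real_norm_def, rule bound)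
  then show ?thesis by (rule LIM_zero_cancel)
qed

text \<open>Mollification commutes with the weak Laplacian: the trace of the Hessian of the
  mollified phi is the mollification of the sum of the \<open>h i\<close>. Hence one kernel, of
  radius below both translation moduli, approximates the function and its Laplacian
  simultaneously.\<close>

lemma smooth_approximation:
  fixes \<phi> :: "'a::euclidean_space \<Rightarrow> real"
  assumes \<phi>: "square_integrable \<phi>" and h: "\<And>i. i \<in> Basis \<Longrightarrow> square_integrable (h i)"
    and weak: "\<And>i \<psi>. i \<in> Basis \<Longrightarrow> test_fun \<psi> \<Longrightarrow>
      (\<integral>x. \<phi> x * deriv_iter [i, i] \<psi> x \<partial>lborel) = (\<integral>x. h i x * \<psi> x \<partial>lborel)"
    and e: "e > 0"
  obtains F g H where "C2_fun F g H" "square_integrable F" "square_integrable (\<lambda>x. trace_op (H x))"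
    "(\<integral>x. (F x - \<phi> x)\<^sup>2 \<partial>lborel) \<le> e" "(\<integral>x. (trace_op (H x) - (\<Sum>i\<in>Basis. h i x))\<^sup>2 \<partial>lborel) \<le> e"
proof -
  define L where "L x = (\<Sum>i\<in>Basis. h i x)" for x
  have L: "square_integrable L" unfolding L_def by (intro square_integrable_sum h) auto
  obtain d1 where d1: "d1 > 0" "\<And>z. norm z < d1 \<Longrightarrow> (\<integral>x. (\<phi> (x + z) - \<phi> x)\<^sup>2 \<partial>lborel) \<le> e"
    using translation_continuous_L2[OF \<phi> e] by blast
  obtain d2 where d2: "d2 > 0" "\<And>z. norm z < d2 \<Longrightarrow> (\<integral>x. (L (x + z) - L x)\<^sup>2 \<partial>lborel) \<le> e"
    using translation_continuous_L2[OF L e] by blast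
  define d where "d = min d1 d2"
  have d: "d > 0" using d1 d2 by (auto simp: d_def)
  obtain \<rho> :: "'a \<Rightarrow> real" and g H where \<rho>: "C2_fun \<rho> g H" "\<And>x. 0 \<le> \<rho> x" "\<And>x. norm x \<ge> d \<Longrightarrow> \<rho> x = 0"
    "integrable lborel \<rho>" "(\<integral>x. \<rho> x \<partial>lborel) = 1" "\<And>x. \<rho> (- x) = \<rho> x" "\<And>y. test_fun (\<lambda>x. \<rho> (y - x))"
    using mollifier_exists[OF d] by blast
  note c\<rho> = C2_funD(7)[OF \<rho>(1)]
  note l\<phi> = square_integrable_imp_locally_integrable[OF \<phi>]
  have C: "C2_fun (\<lambda>y. \<integral>x. \<phi> x * \<rho> (y - x) \<partial>lborel) (\<lambda>y. \<integral>x. \<phi> x *\<^sub>R g (y - x) \<partial>lborel)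
      (\<lambda>y k. \<integral>x. \<phi> x *\<^sub>R H (y - x) k \<partial>lborel)"
    "trace_op (\<lambda>k. \<integral>x. \<phi> x *\<^sub>R H (y - x) k \<partial>lborel) = (\<Sum>i\<in>Basis. \<integral>x. \<phi> x * (H (y - x) i \<bullet> i) \<partial>lborel)" for y
    by (rule mollified_C2_fun(1)[OF l\<phi> \<rho>(1), of d], rule \<rho>(3), assumption)
      (rule mollified_C2_fun(2)[OF l\<phi> \<rho>(1), of d], rule \<rho>(3), assumption)
  have tr: "trace_op (\<lambda>k. \<integral>x. \<phi> x *\<^sub>R H (y - x) k \<partial>lborel) = (\<integral>x. L x * \<rho> (y - x) \<partial>lborel)" for y
  proof -
    have ih: "integrable lborel (\<lambda>x. h i x * \<rho> (y - x))" if "i \<in> Basis" for i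
      using convolution_integrable[OF square_integrable_imp_locally_integrable[OF h[OF that]] c\<rho>, of d y] \<rho>(3) by simp
    have "(\<integral>x. \<phi> x * (H (y - x) i \<bullet> i) \<partial>lborel) = (\<integral>x. h i x * \<rho> (y - x) \<partial>lborel)" if "i \<in> Basis" for i
      using weak[OF that \<rho>(7)[of y]] unfolding deriv_iter_twice_reflected[OF \<rho>(1)] .
    then have "trace_op (\<lambda>k. \<integral>x. \<phi> x *\<^sub>R H (y - x) k \<partial>lborel) = (\<Sum>i\<in>Basis. \<integral>x. h i x * \<rho> (y - x) \<partial>lborel)"
      unfolding C(2) by simp
    also have "\<dots> = (\<integral>x. L x * \<rho> (y - x) \<partial>lborel)"
      unfolding L_def sum_distrib_right using ih by (intro Bochner_Integration.integral_sum[symmetric]) auto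
    finally show ?thesis .
  qed
  have e0: "e \<ge> 0" using e by simp
  note moll\<phi> = mollification_L2_error[OF \<phi> c\<rho> \<rho>(2-6) d1(2) e0]
  note mollL = mollification_L2_error[OF L c\<rho> \<rho>(2-6) d2(2) e0]
  show thesis
  proof (rule that[OF C(1)])
    show "square_integrable (\<lambda>y. \<integral>x. \<phi> x * \<rho> (y - x) \<partial>lborel)" by (rule moll\<phi>(1)) (auto simp: d_def)
    show "(\<integral>y. ((\<integral>x. \<phi> x * \<rho> (y - x) \<partial>lborel) - \<phi> y)\<^sup>2 \<partial>lborel) \<le> e" by (rule moll\<phi>(2)) (auto simp: d_def)
    show "square_integrable (\<lambda>y. trace_op (\<lambda>k. \<integral>x. \<phi> x *\<^sub>R H (y - x) k \<partial>lborel))" unfolding tr by (rule mollL(1)) (auto simp: d_def)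
    show "(\<integral>y. (trace_op (\<lambda>k. \<integral>x. \<phi> x *\<^sub>R H (y - x) k \<partial>lborel) - (\<Sum>i\<in>Basis. h i y))\<^sup>2 \<partial>lborel) \<le> e"
      unfolding tr L_def[symmetric] by (rule mollL(2)) (auto simp: d_def)
  qed
qed

section \<open>The local estimate in the Sobolev space\<close>

definition sq_mass :: "('a::euclidean_space \<Rightarrow> real) \<Rightarrow> real \<Rightarrow> real" where
  "sq_mass \<psi> t = (\<integral>x. indicator {x. x \<bullet> x \<le> t} x * (\<psi> x)\<^sup>2 \<partial>lborel)"

lemma carleman_weight_pos: "s > 0 \<Longrightarrow> 0 < carleman_weight \<alpha> b s"
  by (simp add: carleman_weight_def)

text \<open>Compares the weight with its value at rho: at the inner scale the power gives (rho /
  a)^alpha, since the exponential increases; at 4 rho the power gains 4^(-alpha) and the exponential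
  loses little because b is of order 1 / rho.\<close>

lemma carleman_weight_ratio:
  assumes "a > 0" "a \<le> \<rho>" "\<alpha> \<ge> 0" "b = 1 / (32 * \<rho>)"
  shows "carleman_weight \<alpha> b a \<le> (\<rho> / a) powr \<alpha> * carleman_weight \<alpha> b \<rho>"
    and "carleman_weight \<alpha> b (4 * \<rho>) \<le> 3 powr (-\<alpha>) * carleman_weight \<alpha> b \<rho>"
proof -
  have \<rho>: "\<rho> > 0" using assms by linarith
  have b: "b > 0" "b * \<rho> = 1 / 32" using assms \<rho> by auto
  have "carleman_weight \<alpha> b a \<le> a powr (-\<alpha>) * exp (2 * \<alpha> * b * \<rho>)"
  proof -
    have "2 * \<alpha> * b * a \<le> 2 * \<alpha> * b * \<rho>" using assms b(1) by (intro mult_left_mono) auto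
    then show ?thesis unfolding carleman_weight_def by (intro mult_left_mono) auto
  qed
  also have "a powr (-\<alpha>) = (\<rho> / a) powr \<alpha> * \<rho> powr (-\<alpha>)"
    using assms \<rho> by (simp add: powr_divide powr_minus field_simps)
  finally show "carleman_weight \<alpha> b a \<le> (\<rho> / a) powr \<alpha> * carleman_weight \<alpha> b \<rho>"
    by (simp add: carleman_weight_def mult.assoc)
  \<comment> \<open>Here 3 / 16 = 2 b (4 rho - rho). Since 4 / (4 / 3) = 3, this bound is what turns
    4^(-alpha) into 3^(-alpha).\<close>
  have "exp (3 / 16 :: real) \<le> 4 / 3"
  proof -
    have "1 + (- (3 / 16)) \<le> exp (- (3 / 16) :: real)" by (rule exp_ge_add_one_self)
    then have "exp (3 / 16 :: real) * (13 / 16) \<le> exp (3 / 16) * exp (- (3 / 16))" by (intro mult_left_mono) auto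
    then show ?thesis by (simp add: exp_minus)
  qed
  then have le: "exp (3 / 16) powr \<alpha> \<le> (4 / 3) powr \<alpha>" using assms by (intro powr_mono2) auto
  have e: "exp (2 * \<alpha> * b * (4 * \<rho>)) = exp (3 / 16) powr \<alpha> * exp (2 * \<alpha> * b * \<rho>)"
  proof -
    have "2 * \<alpha> * b * (4 * \<rho>) = 8 * \<alpha> * (b * \<rho>)" by simp
    also have "\<dots> = 3 / 16 * \<alpha> + 2 * \<alpha> * (b * \<rho>)" unfolding b(2) by simp
    also have "2 * \<alpha> * (b * \<rho>) = 2 * \<alpha> * b * \<rho>" by (simp only: mult.assoc)
    finally have eq: "2 * \<alpha> * b * (4 * \<rho>) = 3 / 16 * \<alpha> + 2 * \<alpha> * b * \<rho>" .
    show ?thesis unfolding eq exp_add by (simp add: powr_def mult.commute)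
  qed
  have "(4 * \<rho>) powr (-\<alpha>) = 4 powr (-\<alpha>) * \<rho> powr (-\<alpha>)" using \<rho> by (simp add: powr_mult)
  then have "carleman_weight \<alpha> b (4 * \<rho>) = (4 powr (-\<alpha>) * exp (3 / 16) powr \<alpha>) * carleman_weight \<alpha> b \<rho>"
    unfolding carleman_weight_def e by (simp only: mult_ac)
  also have "\<dots> \<le> (4 powr (-\<alpha>) * (4 / 3) powr \<alpha>) * carleman_weight \<alpha> b \<rho>"
    by (intro mult_right_mono mult_left_mono le) (auto simp: carleman_weight_nonneg)
  also have "4 powr (-\<alpha>) * (4 / 3) powr \<alpha> = 3 powr (-\<alpha>)"
    by (simp add: powr_divide powr_minus field_simps)
  finally show "carleman_weight \<alpha> b (4 * \<rho>) \<le> 3 powr (-\<alpha>) * carleman_weight \<alpha> b \<rho>" .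
qed

text \<open>The bound |L| <= N |psi| is not inherited by the smooth approximations. Therefore the
  cutoff is fixed first, the smooth estimate is taken to the limit with L in place of the Laplacian,
  and only then is the bound used. All weights occurring are bounded, since q vanishes for |x|^2 <=
  a.\<close>

lemma local_estimate_limit:
  fixes \<psi> L :: "'a::euclidean_space \<Rightarrow> real" and \<alpha> a b c N :: real
  defines "(E :: real \<Rightarrow> real) \<equiv> carleman_weight \<alpha> b"
  defines "K0 \<equiv> 8 * (18 * real DIM('a) + 576)\<^sup>2 * (9 * real DIM('a) + 291)"
  assumes a: "0 < a" "2 * a \<le> c" and b: "b = 1 / (8 * c)" and \<alpha>: "\<alpha> \<ge> 2 * real DIM('a)"
    and \<alpha>N: "\<alpha> ^ 3 \<ge> 32 * c\<^sup>2 * N\<^sup>2"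
    and \<psi>: "square_integrable \<psi>" and L: "square_integrable L" and LN: "AE x in lborel. \<bar>L x\<bar> \<le> N * \<bar>\<psi> x\<bar>"
    and F: "\<And>n. C2_fun (F n) (g n) (H n)" "\<And>n. square_integrable (F n)" "\<And>n. square_integrable (\<lambda>x. trace_op (H n x))"
      "\<And>n. (\<integral>x. (F n x - \<psi> x)\<^sup>2 \<partial>lborel) \<le> (1 / (real n + 1))\<^sup>2"
      "\<And>n. (\<integral>x. (trace_op (H n x) - L x)\<^sup>2 \<partial>lborel) \<le> (1 / (real n + 1))\<^sup>2"
  obtains q :: "real \<Rightarrow> real" where "\<And>s. 0 \<le> q s" "\<And>s. q s \<le> 1" "\<And>s. 2 * a \<le> s \<Longrightarrow> s \<le> c \<Longrightarrow> q s = 1"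
    "integrable lborel (\<lambda>x. E (x \<bullet> x) * (q (x \<bullet> x))\<^sup>2 * (\<psi> x)\<^sup>2)"
    "\<alpha> ^ 3 * b * (\<integral>x. E (x \<bullet> x) * (q (x \<bullet> x))\<^sup>2 * (\<psi> x)\<^sup>2 \<partial>lborel)
      \<le> K0 * E a * ((a * N\<^sup>2 + 1 / a) * sq_mass \<psi> (4 * a)) + K0 * E c * ((c * N\<^sup>2 + 1 / c) * sq_mass \<psi> (4 * c))"
proof -
  have c: "c > 0" using a by linarith
  have b0: "b > 0" using b c by simp
  have d1: "real DIM('a) \<ge> 1" by (simp add: Suc_leI)
  have \<alpha>0: "\<alpha> > 0" using \<alpha> d1 by linarith
  have bs: "2 * b * s \<le> 1" if "s \<le> 2 * c" for s
  proof -
    have "2 * b * s \<le> 2 * b * (2 * c)" using that b0 by (intro mult_left_mono) auto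
    then show ?thesis using b c by simp
  qed
  obtain q q' q'' :: "real \<Rightarrow> real" where q:
    "\<And>s. (q has_real_derivative q' s) (at s)" "\<And>s. (q' has_real_derivative q'' s) (at s)"
    "continuous_on UNIV q''" "\<And>s. 0 \<le> q s" "\<And>s. q s \<le> 1" "\<And>s. s \<le> a \<or> s \<ge> 2 * c \<Longrightarrow> q s = 0"
    "\<And>s. 2 * a \<le> s \<Longrightarrow> s \<le> c \<Longrightarrow> q s = 1"
    "\<And>s. s < c \<Longrightarrow> \<bar>q' s\<bar> \<le> 9 / a \<and> \<bar>q'' s\<bar> \<le> 72 / a\<^sup>2"
    "\<And>s. s \<ge> c \<Longrightarrow> \<bar>q' s\<bar> \<le> 9 / c \<and> \<bar>q'' s\<bar> \<le> 72 / c\<^sup>2"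
    "\<And>s. s \<le> a \<or> 2 * a \<le> s \<and> s \<le> c \<or> s \<ge> 2 * c \<Longrightarrow> q' s = 0 \<and> q'' s = 0"
    using annular_cutoff[OF a] by blast
  define P1 where "P1 x = E (x \<bullet> x) * (q (x \<bullet> x))\<^sup>2" for x :: 'a
  define P2 where "P2 x = (x \<bullet> x) * P1 x" for x :: 'a
  define I where "I t x = (indicator {x. x \<bullet> x \<le> t} x :: real)" for t and x :: 'a
  have [measurable]: "q \<in> borel_measurable borel"
    using q(1) by (intro borel_measurable_continuous_onI) (meson DERIV_isCont continuous_at_imp_continuous_on)
  have mP [measurable]: "P1 \<in> borel_measurable borel" "P2 \<in> borel_measurable borel" "I t \<in> borel_measurable borel" for t
    unfolding P1_def P2_def I_def E_def carleman_weight_def by measurable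
  have P1b: "0 \<le> P1 x \<and> P1 x \<le> E a \<and> P2 x \<le> 2 * c * P1 x \<and> 0 \<le> P2 x" for x
  proof (cases "x \<bullet> x \<le> a \<or> x \<bullet> x \<ge> 2 * c")
    case True
    then show ?thesis using q(6)[of "x \<bullet> x"] by (simp add: P1_def P2_def E_def carleman_weight_nonneg)
  next
    case False
    have "E (x \<bullet> x) \<le> E a" unfolding E_def
      by (rule carleman_weight_antimono) (use False a c \<alpha>0 b0 bs in auto)
    moreover have "(q (x \<bullet> x))\<^sup>2 \<le> 1" using q(4,5) by (simp add: power_le_one)
    ultimately have "E (x \<bullet> x) * (q (x \<bullet> x))\<^sup>2 \<le> E a * 1"
      by (intro mult_mono) (auto simp: E_def carleman_weight_nonneg)
    moreover have "0 \<le> P1 x" by (simp add: P1_def E_def carleman_weight_nonneg)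
    moreover have "P2 x \<le> 2 * c * P1 x" unfolding P2_def using False \<open>0 \<le> P1 x\<close> by (intro mult_right_mono) auto
    ultimately show ?thesis by (simp add: P1_def P2_def)
  qed
  have bP1: "\<bar>P1 x\<bar> \<le> E a" for x using P1b[of x] by simp
  have bP2: "\<bar>P2 x\<bar> \<le> 2 * c * E a" for x
  proof -
    have "2 * c * P1 x \<le> 2 * c * E a" using P1b[of x] c by (intro mult_left_mono) auto
    then show ?thesis using P1b[of x] by linarith
  qed
  have bI: "\<bar>I t x\<bar> \<le> 1" for t x by (simp add: I_def indicator_def)
  define X where "X P f = (\<integral>x. P x * (f x)\<^sup>2 \<partial>lborel)" for P f :: "'a \<Rightarrow> real"
  define T where "T n x = trace_op (H n x)" for n x
  have smooth: "2 * \<alpha> ^ 3 * b * X P1 (F n) \<le> 2 * X P2 (T n)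
      + K0 * E a * (a * X (I (4 * a)) (T n) + 1 / a * X (I (4 * a)) (F n))
      + K0 * E c * (c * X (I (4 * c)) (T n) + 1 / c * X (I (4 * c)) (F n))" for n
    using local_estimate_smooth[OF a b \<alpha> F(1)[of n] q(1-6) q(8-10)]
    unfolding X_def P1_def P2_def I_def T_def E_def K0_def by (simp add: mult.assoc)
  have limF: "(\<lambda>n. X P (F n)) \<longlonglongrightarrow> X P \<psi>" and limT: "(\<lambda>n. X P (T n)) \<longlonglongrightarrow> X P L"
    if "P \<in> borel_measurable borel" "\<And>x. \<bar>P x\<bar> \<le> B" for P B
    unfolding X_def T_def
    by (rule weighted_square_limit[OF \<psi> F(2,4) that]) (rule weighted_square_limit[OF L F(3,5) that])
  note lims = limF[OF mP(1) bP1] limT[OF mP(2) bP2] limF[OF mP(3) bI] limT[OF mP(3) bI]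
  have main: "2 * \<alpha> ^ 3 * b * X P1 \<psi> \<le> 2 * X P2 L
      + K0 * E a * (a * X (I (4 * a)) L + 1 / a * X (I (4 * a)) \<psi>)
      + K0 * E c * (c * X (I (4 * c)) L + 1 / c * X (I (4 * c)) \<psi>)"
    by (rule LIMSEQ_le[of "\<lambda>n. 2 * \<alpha> ^ 3 * b * X P1 (F n)" _ "\<lambda>n. 2 * X P2 (T n)
      + K0 * E a * (a * X (I (4 * a)) (T n) + 1 / a * X (I (4 * a)) (F n))
      + K0 * E c * (c * X (I (4 * c)) (T n) + 1 / c * X (I (4 * c)) (F n))"])
      (use smooth a c in \<open>auto intro!: tendsto_intros lims\<close>)
  have XL: "X P L \<le> N\<^sup>2 * X Q \<psi>" if [measurable]: "P \<in> borel_measurable borel" "Q \<in> borel_measurable borel"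
    and PQ: "\<And>x. 0 \<le> P x" "\<And>x. P x \<le> Q x" and B: "\<And>x. Q x \<le> B" for P Q B
  proof -
    have "X P L \<le> (\<integral>x. N\<^sup>2 * (Q x * (\<psi> x)\<^sup>2) \<partial>lborel)"
      unfolding X_def
    proof (rule integral_mono_AE)
      have bb: "\<bar>P x\<bar> \<le> B" "\<bar>Q x\<bar> \<le> B" for x using PQ[of x] B[of x] by auto
      show "integrable lborel (\<lambda>x. P x * (L x)\<^sup>2)" "integrable lborel (\<lambda>x. N\<^sup>2 * (Q x * (\<psi> x)\<^sup>2))"
        using integrable_weighted_square[OF L _ bb(1)] integrable_weighted_square[OF \<psi> _ bb(2)] by simp_all
      show "AE x in lborel. P x * (L x)\<^sup>2 \<le> N\<^sup>2 * (Q x * (\<psi> x)\<^sup>2)"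
        using LN
      proof eventually_elim
        case (elim x)
        have "\<bar>L x\<bar> \<le> \<bar>N * \<psi> x\<bar>"
          unfolding abs_mult by (rule order_trans[OF elim mult_right_mono[OF abs_ge_self abs_ge_zero]])
        then have "(L x)\<^sup>2 \<le> (N * \<psi> x)\<^sup>2" by (simp only: abs_le_square_iff)
        then have "(L x)\<^sup>2 \<le> N\<^sup>2 * (\<psi> x)\<^sup>2" by (simp only: power_mult_distrib)
        then have "P x * (L x)\<^sup>2 \<le> Q x * (N\<^sup>2 * (\<psi> x)\<^sup>2)"
          using PQ[of x] by (intro mult_mono) auto
        then show ?case by (simp add: mult_ac)
      qed
    qed
    then show ?thesis by (simp add: X_def)
  qed
  have "X P2 L \<le> N\<^sup>2 * X (\<lambda>x. 2 * c * P1 x) \<psi>"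
    by (rule XL[where B="2 * c * E a"]) (use P1b c in \<open>auto intro!: mult_left_mono\<close>)
  then have 1: "X P2 L \<le> N\<^sup>2 * (2 * c) * X P1 \<psi>" by (simp add: X_def mult.assoc)
  have 2: "X (I t) L \<le> N\<^sup>2 * X (I t) \<psi>" for t
    by (rule XL[where B=1]) (auto simp: I_def indicator_def)
  have XP1: "X P1 \<psi> \<ge> 0" unfolding X_def using P1b by (intro Bochner_Integration.integral_nonneg) auto
  \<comment> \<open>The potential contributes at most 2 N^2 (2 c) times the weighted mass. As b = 1
    / (8 c), the assumption on alpha^3 says exactly that half of the left-hand side absorbs
    it.\<close>
  have "N\<^sup>2 * (4 * c) \<le> \<alpha> ^ 3 * b"
  proof -
    have "N\<^sup>2 * (4 * c) * (8 * c) = 32 * c\<^sup>2 * N\<^sup>2" by (simp add: power2_eq_square)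
    then have "N\<^sup>2 * (4 * c) \<le> \<alpha> ^ 3 / (8 * c)" using \<alpha>N c by (simp only: pos_le_divide_eq)
    then show ?thesis by (simp add: b)
  qed
  then have 3: "N\<^sup>2 * (4 * c) * X P1 \<psi> \<le> \<alpha> ^ 3 * b * X P1 \<psi>" using XP1 by (rule mult_right_mono)
  have K0: "K0 \<ge> 0" by (simp add: K0_def)
  have 4: "K0 * E e * (e * X (I (4 * e)) L + 1 / e * X (I (4 * e)) \<psi>) \<le> K0 * E e * ((e * N\<^sup>2 + 1 / e) * X (I (4 * e)) \<psi>)"
    if e: "e > 0" for e
  proof (rule mult_left_mono)
    have "e * X (I (4 * e)) L \<le> e * (N\<^sup>2 * X (I (4 * e)) \<psi>)" using e by (intro mult_left_mono 2) auto
    then show "e * X (I (4 * e)) L + 1 / e * X (I (4 * e)) \<psi> \<le> (e * N\<^sup>2 + 1 / e) * X (I (4 * e)) \<psi>"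
      by (simp only: distrib_right mult.assoc add_right_mono)
  qed (use K0 in \<open>simp add: E_def carleman_weight_nonneg\<close>)
  have "\<alpha> ^ 3 * b * X P1 \<psi> \<le> K0 * E a * ((a * N\<^sup>2 + 1 / a) * X (I (4 * a)) \<psi>) + K0 * E c * ((c * N\<^sup>2 + 1 / c) * X (I (4 * c)) \<psi>)"
    using main 1 3 4[OF a(1)] 4[OF c] by linarith
  note fin = this
  have XI: "X (I t) \<psi> = sq_mass \<psi> t" for t by (simp add: X_def I_def sq_mass_def)
  have int: "integrable lborel (\<lambda>x. P1 x * (\<psi> x)\<^sup>2)" by (rule integrable_weighted_square[OF \<psi> mP(1) bP1])
  show thesis
    by (rule that[of q, OF q(4,5) _ int[unfolded P1_def] fin[unfolded XI, unfolded X_def P1_def]]) (rule q(7))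
qed

text \<open>The cutoff is placed at c = 4 rho, beyond the ball whose mass is to be bounded, so the
  outer error carries 3^(-alpha) after division by the weight at rho. The inner error carries (rho /
  a)^alpha and a further factor c / a = 4 rho / a.\<close>

lemma local_estimate_L2:
  fixes \<psi> L :: "'a::euclidean_space \<Rightarrow> real" and \<alpha> a \<rho> N :: real
  defines "K0 \<equiv> 8 * (18 * real DIM('a) + 576)\<^sup>2 * (9 * real DIM('a) + 291)"
  assumes a: "0 < a" "2 * a \<le> \<rho>" and \<alpha>: "\<alpha> \<ge> 2 * real DIM('a)"
    and \<alpha>N: "\<alpha> ^ 3 \<ge> 512 * \<rho>\<^sup>2 * N\<^sup>2"
    and \<psi>: "square_integrable \<psi>" and L: "square_integrable L" and LN: "AE x in lborel. \<bar>L x\<bar> \<le> N * \<bar>\<psi> x\<bar>"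
    and F: "\<And>n. C2_fun (F n) (g n) (H n)" "\<And>n. square_integrable (F n)" "\<And>n. square_integrable (\<lambda>x. trace_op (H n x))"
      "\<And>n. (\<integral>x. (F n x - \<psi> x)\<^sup>2 \<partial>lborel) \<le> (1 / (real n + 1))\<^sup>2"
      "\<And>n. (\<integral>x. (trace_op (H n x) - L x)\<^sup>2 \<partial>lborel) \<le> (1 / (real n + 1))\<^sup>2"
  shows "sq_mass \<psi> \<rho> \<le> (1 + 8 * K0) * (\<rho> / a) powr (\<alpha> + 1) * sq_mass \<psi> (4 * a)
      + 2 * K0 * 3 powr (-\<alpha>) * sq_mass \<psi> (16 * \<rho>)"
proof -
  define c where "c = 4 * \<rho>"
  define b where "b = 1 / (8 * c)"
  define E where "E = carleman_weight \<alpha> b"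
  have \<rho>: "\<rho> > 0" using a by linarith
  have c: "c > 0" "2 * a \<le> c" using a \<rho> by (auto simp: c_def)
  have b0: "b > 0" using c by (simp add: b_def)
  have bc: "b = 1 / (32 * \<rho>)" by (simp add: b_def c_def)
  have b2: "2 * b * \<rho> \<le> 1" using \<rho> by (simp add: bc)
  have "real DIM('a) \<ge> 1" by (simp add: Suc_leI)
  then have \<alpha>2: "\<alpha> \<ge> 2" using \<alpha> by linarith
  have K0: "K0 \<ge> 0" by (simp add: K0_def)
  have "32 * c\<^sup>2 * N\<^sup>2 \<le> \<alpha> ^ 3" using \<alpha>N by (simp add: c_def power_mult_distrib)
  note \<alpha>N' = this
  obtain q :: "real \<Rightarrow> real" where q: "\<And>s. 0 \<le> q s" "\<And>s. q s \<le> 1" "\<And>s. 2 * a \<le> s \<Longrightarrow> s \<le> c \<Longrightarrow> q s = 1"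
    "integrable lborel (\<lambda>x. E (x \<bullet> x) * (q (x \<bullet> x))\<^sup>2 * (\<psi> x)\<^sup>2)"
    "\<alpha> ^ 3 * b * (\<integral>x. E (x \<bullet> x) * (q (x \<bullet> x))\<^sup>2 * (\<psi> x)\<^sup>2 \<partial>lborel)
      \<le> K0 * E a * ((a * N\<^sup>2 + 1 / a) * sq_mass \<psi> (4 * a)) + K0 * E c * ((c * N\<^sup>2 + 1 / c) * sq_mass \<psi> (4 * c))"
    by (rule local_estimate_limit[OF a(1) c(2) b_def \<alpha> \<alpha>N' \<psi> L LN F, folded E_def K0_def]) (rule that)
  have iI: "integrable lborel (\<lambda>x. indicator {x. x \<bullet> x \<le> t} x * (\<psi> x)\<^sup>2)" for t
    by (rule integrable_weighted_square[OF \<psi>, where B=1]) (auto simp: indicator_def)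
  have J0: "sq_mass \<psi> t \<ge> 0" for t unfolding sq_mass_def by (intro Bochner_Integration.integral_nonneg) auto
  define Y where "Y = (\<integral>x. E (x \<bullet> x) * (q (x \<bullet> x))\<^sup>2 * (\<psi> x)\<^sup>2 \<partial>lborel)"
  have E\<rho>: "E \<rho> > 0" unfolding E_def using \<rho> by (rule carleman_weight_pos)
  have En: "E s \<ge> 0" for s by (simp add: E_def carleman_weight_nonneg)
  \<comment> \<open>For |x|^2 between 4 a and rho the cutoff is 1 and the weight is at least E(rho);
    the points with |x|^2 <= 4 a are charged to the inner mass.\<close>
  have split: "E \<rho> * sq_mass \<psi> \<rho> \<le> E \<rho> * sq_mass \<psi> (4 * a) + Y"
  proof -
    have "(\<integral>x. E \<rho> * (indicator {x. x \<bullet> x \<le> \<rho>} x * (\<psi> x)\<^sup>2) \<partial>lborel)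
      \<le> (\<integral>x. E \<rho> * (indicator {x. x \<bullet> x \<le> 4 * a} x * (\<psi> x)\<^sup>2) + E (x \<bullet> x) * (q (x \<bullet> x))\<^sup>2 * (\<psi> x)\<^sup>2 \<partial>lborel)"
    proof (rule integral_mono)
      show "integrable lborel (\<lambda>x. E \<rho> * (indicator {x. x \<bullet> x \<le> \<rho>} x * (\<psi> x)\<^sup>2))" using iI by simp
      show "integrable lborel (\<lambda>x. E \<rho> * (indicator {x. x \<bullet> x \<le> 4 * a} x * (\<psi> x)\<^sup>2) + E (x \<bullet> x) * (q (x \<bullet> x))\<^sup>2 * (\<psi> x)\<^sup>2)"
        using iI q(4) by simp
      fix x :: 'a
      show "E \<rho> * (indicator {x. x \<bullet> x \<le> \<rho>} x * (\<psi> x)\<^sup>2)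
        \<le> E \<rho> * (indicator {x. x \<bullet> x \<le> 4 * a} x * (\<psi> x)\<^sup>2) + E (x \<bullet> x) * (q (x \<bullet> x))\<^sup>2 * (\<psi> x)\<^sup>2"
      proof (cases "4 * a < x \<bullet> x \<and> x \<bullet> x \<le> \<rho>")
        case True
        have "E \<rho> \<le> E (x \<bullet> x)" unfolding E_def
          by (rule carleman_weight_antimono) (use True a b0 \<alpha>2 b2 in auto)
        moreover have "q (x \<bullet> x) = 1" using True a \<rho> by (intro q(3)) (auto simp: c_def)
        ultimately show ?thesis using True by (simp add: mult_right_mono)
      next
        case False
        then have "indicator {x. x \<bullet> x \<le> \<rho>} x \<le> (indicator {x. x \<bullet> x \<le> 4 * a} x :: real)"
          by (auto simp: indicator_def)
        then have "E \<rho> * (indicator {x. x \<bullet> x \<le> \<rho>} x * (\<psi> x)\<^sup>2) \<le> E \<rho> * (indicator {x. x \<bullet> x \<le> 4 * a} x * (\<psi> x)\<^sup>2)"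
          using E\<rho> by (intro mult_left_mono mult_right_mono) auto
        moreover have "0 \<le> E (x \<bullet> x) * (q (x \<bullet> x))\<^sup>2 * (\<psi> x)\<^sup>2" by (simp add: En)
        ultimately show ?thesis by linarith
      qed
    qed
    also have "\<dots> = E \<rho> * sq_mass \<psi> (4 * a) + Y" using iI q(4) by (simp add: sq_mass_def Y_def)
    finally show ?thesis by (simp add: sq_mass_def)
  qed
  have \<alpha>3: "\<alpha> ^ 3 \<ge> 8" using power_mono[of 2 \<alpha> 3] \<alpha>2 by simp
  \<comment> \<open>Both e N^2 and 1 / e are at most alpha^3 b (c / e): the first by the assumption
    on alpha^3, the second because alpha >= 2 gives alpha^3 >= 8. So the factor alpha^3 b cancels
    against the left-hand side.\<close>
  have coef: "e * N\<^sup>2 + 1 / e \<le> \<alpha> ^ 3 * b * (2 * (c / e))" if e: "e > 0" "e \<le> c" for e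
  proof -
    have "8 * c * (e * N\<^sup>2) \<le> 8 * c * (c * N\<^sup>2)" using e c by (intro mult_left_mono mult_right_mono) auto
    also have "\<dots> = 8 * (c\<^sup>2 * N\<^sup>2)" by (simp add: power2_eq_square)
    also have "\<dots> \<le> 32 * (c\<^sup>2 * N\<^sup>2)" by (intro mult_right_mono) auto
    also have "\<dots> \<le> \<alpha> ^ 3" using \<alpha>N' by (simp only: mult.assoc)
    also have "\<dots> = \<alpha> ^ 3 * 1" by simp
    also have "\<dots> \<le> \<alpha> ^ 3 * (c / e)" using e \<alpha>2 by (intro mult_left_mono) auto
    finally have 1: "8 * c * (e * N\<^sup>2) \<le> \<alpha> ^ 3 * (c / e)" .
    have "8 * c * (1 / e) = 8 * (c / e)" by simp
    also have "\<dots> \<le> \<alpha> ^ 3 * (c / e)" using \<alpha>3 e c by (intro mult_right_mono) auto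
    finally have 2: "8 * c * (1 / e) \<le> \<alpha> ^ 3 * (c / e)" .
    have "(e * N\<^sup>2 + 1 / e) * (8 * c) = 8 * c * (e * N\<^sup>2) + 8 * c * (1 / e)"
      by (simp only: distrib_right mult.commute[of "8 * c"])
    also have "\<dots> \<le> 2 * (\<alpha> ^ 3 * (c / e))" using add_mono[OF 1 2] by (simp only: mult_2)
    finally have "e * N\<^sup>2 + 1 / e \<le> 2 * (\<alpha> ^ 3 * (c / e)) / (8 * c)"
      using c by (simp only: pos_le_divide_eq)
    also have "\<dots> = \<alpha> ^ 3 * b * (2 * (c / e))" by (simp add: b_def)
    finally show ?thesis .
  qed
  have pos: "\<alpha> ^ 3 * b > 0" using \<alpha>2 b0 by (intro mult_pos_pos) auto
  have scaled: "K0 * E e * ((e * N\<^sup>2 + 1 / e) * sq_mass \<psi> (4 * e)) \<le> \<alpha> ^ 3 * b * (2 * K0 * (c / e) * E e * sq_mass \<psi> (4 * e))"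
    if e: "e > 0" "e \<le> c" for e
  proof -
    have "K0 * E e * ((e * N\<^sup>2 + 1 / e) * sq_mass \<psi> (4 * e)) \<le> K0 * E e * ((\<alpha> ^ 3 * b * (2 * (c / e))) * sq_mass \<psi> (4 * e))"
      using K0 En J0 by (intro mult_left_mono mult_right_mono coef e) auto
    then show ?thesis by (simp add: mult_ac)
  qed
  have "\<alpha> ^ 3 * b * Y \<le> \<alpha> ^ 3 * b * (2 * K0 * (c / a) * E a * sq_mass \<psi> (4 * a) + 2 * K0 * (c / c) * E c * sq_mass \<psi> (4 * c))"
    unfolding distrib_left
    by (rule order_trans[OF q(5)[folded Y_def] add_mono[OF scaled scaled]]) (use a c in auto)
  then have "Y \<le> 2 * K0 * (c / a) * E a * sq_mass \<psi> (4 * a) + 2 * K0 * E c * sq_mass \<psi> (4 * c)"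
    using pos c(1) by (simp only: mult_le_cancel_left_pos divide_self[OF less_imp_neq[OF c(1), symmetric]] mult_1_right)
  also have "\<dots> \<le> 2 * K0 * (c / a) * ((\<rho> / a) powr \<alpha> * E \<rho>) * sq_mass \<psi> (4 * a) + 2 * K0 * (3 powr (-\<alpha>) * E \<rho>) * sq_mass \<psi> (4 * c)"
  proof -
    have r: "E a \<le> (\<rho> / a) powr \<alpha> * E \<rho>" "E c \<le> 3 powr (-\<alpha>) * E \<rho>"
      using carleman_weight_ratio[of a \<rho> \<alpha> b] a \<alpha>2 bc by (auto simp: E_def c_def)
    have "0 \<le> 2 * K0 * (c / a)" "0 \<le> 2 * K0" using K0 c a by auto
    then show ?thesis by (intro add_mono mult_right_mono[OF mult_left_mono[OF r(1)] J0] mult_right_mono[OF mult_left_mono[OF r(2)] J0])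
  qed
  finally have Y: "Y \<le> 2 * K0 * (c / a) * ((\<rho> / a) powr \<alpha> * E \<rho>) * sq_mass \<psi> (4 * a) + 2 * K0 * (3 powr (-\<alpha>) * E \<rho>) * sq_mass \<psi> (4 * c)" .
  have "E \<rho> * sq_mass \<psi> \<rho> \<le> E \<rho> * (sq_mass \<psi> (4 * a) + 2 * K0 * (c / a) * (\<rho> / a) powr \<alpha> * sq_mass \<psi> (4 * a)
      + 2 * K0 * 3 powr (-\<alpha>) * sq_mass \<psi> (4 * c))"
  proof -
    have "2 * K0 * (c / a) * ((\<rho> / a) powr \<alpha> * E \<rho>) * sq_mass \<psi> (4 * a) = E \<rho> * (2 * K0 * (c / a) * (\<rho> / a) powr \<alpha> * sq_mass \<psi> (4 * a))"
      "2 * K0 * (3 powr (-\<alpha>) * E \<rho>) * sq_mass \<psi> (4 * c) = E \<rho> * (2 * K0 * 3 powr (-\<alpha>) * sq_mass \<psi> (4 * c))"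
      by (simp_all only: mult_ac)
    then show ?thesis unfolding distrib_left using split Y by linarith
  qed
  then have "sq_mass \<psi> \<rho> \<le> sq_mass \<psi> (4 * a) + 2 * K0 * (c / a) * (\<rho> / a) powr \<alpha> * sq_mass \<psi> (4 * a)
      + 2 * K0 * 3 powr (-\<alpha>) * sq_mass \<psi> (4 * c)"
    using E\<rho> by (simp only: mult_le_cancel_left_pos)
  also have "\<dots> \<le> (1 + 8 * K0) * (\<rho> / a) powr (\<alpha> + 1) * sq_mass \<psi> (4 * a) + 2 * K0 * 3 powr (-\<alpha>) * sq_mass \<psi> (16 * \<rho>)"
  proof -
    have ra: "\<rho> / a \<ge> 1" using a by simp
    have p: "(\<rho> / a) powr (\<alpha> + 1) = (\<rho> / a) * (\<rho> / a) powr \<alpha>" using ra a(1) \<rho> by (simp add: powr_add)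
    have "1 \<le> (\<rho> / a) powr (\<alpha> + 1)" using ra \<alpha>2 by (intro ge_one_powr_ge_zero) auto
    then have "sq_mass \<psi> (4 * a) \<le> (\<rho> / a) powr (\<alpha> + 1) * sq_mass \<psi> (4 * a)"
      using mult_right_mono[OF _ J0[of "4 * a"], of 1] by simp
    moreover have "2 * K0 * (c / a) * (\<rho> / a) powr \<alpha> * sq_mass \<psi> (4 * a) = 8 * K0 * (\<rho> / a) powr (\<alpha> + 1) * sq_mass \<psi> (4 * a)"
      unfolding p c_def by simp
    ultimately have "sq_mass \<psi> (4 * a) + 2 * K0 * (c / a) * (\<rho> / a) powr \<alpha> * sq_mass \<psi> (4 * a)
      \<le> (1 + 8 * K0) * (\<rho> / a) powr (\<alpha> + 1) * sq_mass \<psi> (4 * a)"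
      by (simp only: distrib_right mult_1 add_mono order_refl)
    moreover have "4 * c = 16 * \<rho>" by (simp add: c_def)
    ultimately show ?thesis by simp
  qed
  finally show ?thesis .
qed

section \<open>Summation over the lattice\<close>

definition mass :: "('a::euclidean_space \<Rightarrow> real) \<Rightarrow> 'a set \<Rightarrow> real" where
  "mass \<phi> A = (\<integral>x. indicator A x * (\<phi> x)\<^sup>2 \<partial>lborel)"

lemma mass_integrable:
  assumes "square_integrable \<phi>" "A \<in> sets borel"
  shows "integrable lborel (\<lambda>x. indicator A x * (\<phi> x)\<^sup>2)"
  by (rule integrable_weighted_square[OF assms(1), where B=1]) (use assms(2) in \<open>auto simp: indicator_def\<close>)

lemma mass_mono:
  assumes \<phi>: "square_integrable \<phi>" and "A \<in> sets borel" "B \<in> sets borel" "A \<subseteq> B"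
  shows "mass \<phi> A \<le> mass \<phi> B"
  unfolding mass_def
  by (intro integral_mono mass_integrable assms) (use assms(4) in \<open>auto simp: indicator_def\<close>)

lemma mass_nonneg: "0 \<le> mass \<phi> A"
  unfolding mass_def by (intro Bochner_Integration.integral_nonneg) auto

lemma C2_fun_translate:
  assumes "C2_fun f g H"
  shows "C2_fun (\<lambda>x. f (x + z)) (\<lambda>x. g (x + z)) (\<lambda>x. H (x + z))"
proof -
  note c = C2_funD[OF assms]
  have t: "((\<lambda>x. x + z) has_derivative (\<lambda>h. h)) (at x)" for x by (auto intro!: derivative_eq_intros)
  have "((\<lambda>x. f (x + z)) has_derivative (\<lambda>h. g (x + z) \<bullet> h)) (at x)" for x
    by (rule has_derivative_compose[OF t c(1)])
  moreover have "((\<lambda>x. g (x + z)) has_derivative H (x + z)) (at x)" for x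
    by (rule has_derivative_compose[OF t c(2)])
  moreover have "continuous_on UNIV (\<lambda>x. H (x + z) h)" for h
    by (rule continuous_on_compose2[OF c(4)[of UNIV]]) (auto intro!: continuous_intros)
  ultimately show ?thesis unfolding C2_fun_def using c(3) by blast
qed

lemma sq_mass_translate:
  assumes \<phi>: "square_integrable \<phi>"
  shows "sq_mass (\<lambda>x. \<phi> (x + z)) t = mass \<phi> {x. (x - z) \<bullet> (x - z) \<le> t}"
proof -
  note [measurable] = square_integrableD(1)[OF \<phi>]
  have [measurable]: "{x. (x - z) \<bullet> (x - z) \<le> t} \<in> sets borel"
    by (intro borel_closed closed_Collect_le continuous_intros)
  have "mass \<phi> {x. (x - z) \<bullet> (x - z) \<le> t}
      = (\<integral>x. indicator {x. (x - z) \<bullet> (x - z) \<le> t} (x + z) * (\<phi> (x + z))\<^sup>2 \<partial>lborel)"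
    unfolding mass_def by (rule lborel_integral_translate[symmetric]) measurable
  also have "\<dots> = sq_mass (\<lambda>x. \<phi> (x + z)) t"
    by (simp add: sq_mass_def indicator_def)
  finally show ?thesis ..
qed

lemma AE_lborel_translate:
  fixes P :: "'a::euclidean_space \<Rightarrow> bool"
  assumes "AE x in lborel. P x" and P: "{x. P x} \<in> sets borel"
  shows "AE x in lborel. P (x + z)"
proof -
  have "AE x in distr lborel borel ((+) z). P x" using assms(1) unfolding lborel_distr_plus .
  then have "AE x in lborel. P (z + x)"
    by (subst (asm) AE_distr_iff) (use P in auto)
  then show ?thesis by (simp add: add.commute)
qed

text \<open>The approximations are built for phi itself and translated afterwards, since the weak
  formulation is available for phi and not for its translates.\<close>

lemma local_estimate_at:
  fixes \<phi> :: "'a::euclidean_space \<Rightarrow> real" and \<alpha> a \<rho> N :: real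
  defines "K0 \<equiv> 8 * (18 * real DIM('a) + 576)\<^sup>2 * (9 * real DIM('a) + 291)"
  assumes a: "0 < a" "2 * a \<le> \<rho>" and \<alpha>: "\<alpha> \<ge> 2 * real DIM('a)"
    and \<alpha>N: "\<alpha> ^ 3 \<ge> 512 * \<rho>\<^sup>2 * N\<^sup>2"
    and \<phi>: "square_integrable \<phi>" and h: "\<And>i. i \<in> Basis \<Longrightarrow> square_integrable (h i)"
    and weak: "\<And>i \<psi>. i \<in> Basis \<Longrightarrow> test_fun \<psi> \<Longrightarrow>
      (\<integral>x. \<phi> x * deriv_iter [i, i] \<psi> x \<partial>lborel) = (\<integral>x. h i x * \<psi> x \<partial>lborel)"
    and LN: "AE x in lborel. \<bar>\<Sum>i\<in>Basis. h i x\<bar> \<le> N * \<bar>\<phi> x\<bar>"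
  shows "mass \<phi> {x. (x - z) \<bullet> (x - z) \<le> \<rho>}
    \<le> (1 + 8 * K0) * (\<rho> / a) powr (\<alpha> + 1) * mass \<phi> {x. (x - z) \<bullet> (x - z) \<le> 4 * a}
      + 2 * K0 * 3 powr (-\<alpha>) * mass \<phi> {x. (x - z) \<bullet> (x - z) \<le> 16 * \<rho>}"
proof -
  define L where "L x = (\<Sum>i\<in>Basis. h i x)" for x
  have L: "square_integrable L" unfolding L_def by (intro square_integrable_sum h) auto
  note [measurable] = square_integrableD(1)[OF \<phi>] square_integrableD(1)[OF L]
  define P where "P n F g H \<longleftrightarrow> C2_fun F g H \<and> square_integrable F \<and> square_integrable (\<lambda>x. trace_op (H x)) \<and>
    (\<integral>x. (F x - \<phi> x)\<^sup>2 \<partial>lborel) \<le> (1 / (real n + 1))\<^sup>2 \<and>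
    (\<integral>x. (trace_op (H x) - L x)\<^sup>2 \<partial>lborel) \<le> (1 / (real n + 1))\<^sup>2" for n F g H
  have "\<exists>F g H. P n F g H" for n
  proof (rule smooth_approximation[OF \<phi>, of h "(1 / (real n + 1))\<^sup>2"])
    show "square_integrable (h i)" if "i \<in> Basis" for i by (rule h[OF that])
    show "(\<integral>x. \<phi> x * deriv_iter [i, i] \<psi> x \<partial>lborel) = (\<integral>x. h i x * \<psi> x \<partial>lborel)"
      if "i \<in> Basis" "test_fun \<psi>" for i \<psi> by (rule weak[OF that])
    show "0 < (1 / (real n + 1))\<^sup>2" by simp
    fix F g H
    assume "C2_fun F g H" "square_integrable F" "square_integrable (\<lambda>x. trace_op (H x))"
      "(\<integral>x. (F x - \<phi> x)\<^sup>2 \<partial>lborel) \<le> (1 / (real n + 1))\<^sup>2"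
      "(\<integral>x. (trace_op (H x) - (\<Sum>i\<in>Basis. h i x))\<^sup>2 \<partial>lborel) \<le> (1 / (real n + 1))\<^sup>2"
    then have "P n F g H" unfolding P_def L_def by (intro conjI)
    then show "\<exists>F g H. P n F g H" by (intro exI)
  qed
  then obtain F g H where PF: "\<And>n. P n (F n) (g n) (H n)" by metis
  have F: "C2_fun (F n) (g n) (H n)" "square_integrable (F n)" "square_integrable (\<lambda>x. trace_op (H n x))"
    "(\<integral>x. (F n x - \<phi> x)\<^sup>2 \<partial>lborel) \<le> (1 / (real n + 1))\<^sup>2"
    "(\<integral>x. (trace_op (H n x) - L x)\<^sup>2 \<partial>lborel) \<le> (1 / (real n + 1))\<^sup>2" for n
    using PF[of n] by (simp_all only: P_def)
  have t1: "(\<integral>x. (F n (x + z) - \<phi> (x + z))\<^sup>2 \<partial>lborel) \<le> (1 / (real n + 1))\<^sup>2" for n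
    using square_integrable_translate(2)[OF square_integrable_diff[OF F(2)[of n] \<phi>], of z] F(4)[of n] by simp
  have t2: "(\<integral>x. (trace_op (H n (x + z)) - L (x + z))\<^sup>2 \<partial>lborel) \<le> (1 / (real n + 1))\<^sup>2" for n
    using square_integrable_translate(2)[OF square_integrable_diff[OF F(3)[of n] L], of z] F(5)[of n] by simp
  have LN': "AE x in lborel. \<bar>L (x + z)\<bar> \<le> N * \<bar>\<phi> (x + z)\<bar>"
  proof (rule AE_lborel_translate)
    show "AE x in lborel. \<bar>L x\<bar> \<le> N * \<bar>\<phi> x\<bar>" using LN by (simp only: L_def)
    show "{x. \<bar>L x\<bar> \<le> N * \<bar>\<phi> x\<bar>} \<in> sets borel" by measurable
  qed
  show ?thesis
    using local_estimate_L2[OF a \<alpha> \<alpha>N square_integrable_translate(1)[OF \<phi>] square_integrable_translate(1)[OF L] LN'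
        C2_fun_translate[OF F(1)] square_integrable_translate(1)[OF F(2)] square_integrable_translate(1)[OF F(3)] t1 t2]
    unfolding sq_mass_translate[OF \<phi>] K0_def .
qed

text \<open>Dividing coordinates by M embeds the set into integer vectors. In each coordinate n runs
  from ceiling(x / M) - R to floor(x / M) + R, and floor <= ceiling leaves at most 2 R + 1
  values.\<close>

lemma lattice_box_finite:
  fixes x :: "'a::euclidean_space"
  assumes M: "M > 0"
  shows "finite {k \<in> lattice M. \<forall>i\<in>Basis. \<bar>x \<bullet> i - k \<bullet> i\<bar> \<le> real R * M}" (is "finite ?B")
    and "card {k \<in> lattice M. \<forall>i\<in>Basis. \<bar>x \<bullet> i - k \<bullet> i\<bar> \<le> real R * M} \<le> (2 * R + 1) ^ DIM('a)"
proof -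
  define f where "f k = restrict (\<lambda>i. \<lfloor>k \<bullet> i / M\<rfloor>) (Basis :: 'a set)" for k :: 'a
  define T where "T i = {\<lceil>x \<bullet> i / M\<rceil> - int R..\<lfloor>x \<bullet> i / M\<rfloor> + int R}" for i
  have coord: "k \<bullet> i = M * of_int \<lfloor>k \<bullet> i / M\<rfloor>" if k: "k \<in> lattice M" and i: "i \<in> Basis" for k i :: 'a
  proof -
    obtain n :: int where "k \<bullet> i = M * of_int n" using k i unfolding lattice_def by blast
    then show ?thesis using M by simp
  qed
  have inj: "inj_on f ?B"
  proof (rule inj_onI)
    fix k l assume kl: "k \<in> ?B" "l \<in> ?B" "f k = f l"
    show "k = l"
    proof (rule euclidean_eqI)
      fix i :: 'a assume i: "i \<in> Basis"
      have "\<lfloor>k \<bullet> i / M\<rfloor> = \<lfloor>l \<bullet> i / M\<rfloor>" using kl(3) i unfolding f_def by (metis restrict_apply')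
      then show "k \<bullet> i = l \<bullet> i" using coord[of k i] coord[of l i] kl i by simp
    qed
  qed
  have im: "f ` ?B \<subseteq> PiE Basis T"
  proof
    fix u assume "u \<in> f ` ?B"
    then obtain k where k: "k \<in> ?B" "u = f k" by blast
    have "\<lfloor>k \<bullet> i / M\<rfloor> \<in> T i" if i: "i \<in> Basis" for i
    proof -
      define n where "n = \<lfloor>k \<bullet> i / M\<rfloor>"
      have "\<bar>x \<bullet> i - M * of_int n\<bar> \<le> real R * M" using k i coord[of k i] by (auto simp: n_def)
      then have "\<bar>x \<bullet> i - M * of_int n\<bar> / M \<le> real R" using M by (simp add: pos_divide_le_eq)
      moreover have "\<bar>x \<bullet> i - M * of_int n\<bar> / M = \<bar>x \<bullet> i / M - of_int n\<bar>"
      proof -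
        have "x \<bullet> i / M - of_int n = (x \<bullet> i - M * of_int n) / M" using M by (simp add: diff_divide_distrib)
        then show ?thesis using M by (simp only: abs_divide abs_of_pos)
      qed
      ultimately have "\<bar>x \<bullet> i / M - of_int n\<bar> \<le> real R" by simp
      then have "of_int (n - int R) \<le> x \<bullet> i / M" "x \<bullet> i / M \<le> of_int (n + int R)" by (auto simp: abs_le_iff)
      then have "n - int R \<le> \<lfloor>x \<bullet> i / M\<rfloor>" "\<lceil>x \<bullet> i / M\<rceil> \<le> n + int R" by (simp_all add: le_floor_iff ceiling_le_iff)
      then show ?thesis by (simp add: T_def n_def)
    qed
    then show "u \<in> PiE Basis T" unfolding k(2) f_def by (simp add: restrict_PiE_iff)
  qed
  have finT: "finite (PiE Basis T)" by (intro finite_PiE) (auto simp: T_def)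
  show "finite ?B" using finite_imageD[OF finite_subset[OF im finT] inj] .
  have "card ?B = card (f ` ?B)" by (rule card_image[OF inj, symmetric])
  also have "\<dots> \<le> card (PiE Basis T)" by (rule card_mono[OF finT im])
  also have "\<dots> = (\<Prod>i\<in>Basis. card (T i))" by (simp add: card_PiE)
  also have "\<dots> \<le> (\<Prod>i\<in>(Basis::'a set). 2 * R + 1)"
  proof (rule prod_mono)
    fix i :: 'a
    have "\<lfloor>x \<bullet> i / M\<rfloor> \<le> \<lceil>x \<bullet> i / M\<rceil>" by (rule floor_le_ceiling)
    then have "nat (\<lfloor>x \<bullet> i / M\<rfloor> + int R - (\<lceil>x \<bullet> i / M\<rceil> - int R) + 1) \<le> 2 * R + 1"
      unfolding nat_le_iff by simp
    then show "0 \<le> card (T i) \<and> card (T i) \<le> 2 * R + 1"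
      by (simp only: T_def card_atLeastAtMost_int le0 simp_thms)
  qed
  finally show "card ?B \<le> (2 * R + 1) ^ DIM('a)" by simp
qed

lemma cube_iff: "x \<in> cube M k \<longleftrightarrow> (\<forall>i\<in>Basis. \<bar>x \<bullet> i - k \<bullet> i\<bar> < M / 2)"
  unfolding cube_def mem_box abs_diff_less_iff by (simp add: inner_diff_left inner_add_left)

lemma cube_disjoint:
  assumes M: "M > 0" and k: "k \<in> lattice M" "l \<in> lattice M" and x: "x \<in> cube M k" "x \<in> cube M l"
  shows "k = l"
proof (rule euclidean_eqI)
  fix i :: 'a assume i: "i \<in> Basis"
  obtain m n :: int where mn: "k \<bullet> i = M * of_int m" "l \<bullet> i = M * of_int n"
    using k i unfolding lattice_def by blast
  have "\<bar>x \<bullet> i - k \<bullet> i\<bar> < M / 2" "\<bar>x \<bullet> i - l \<bullet> i\<bar> < M / 2" using x i by (auto simp: cube_iff)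
  then have "\<bar>k \<bullet> i - l \<bullet> i\<bar> < M * 1" by linarith
  also have "k \<bullet> i - l \<bullet> i = M * of_int (m - n)" by (simp add: mn algebra_simps)
  finally have "M * \<bar>of_int (m - n)\<bar> < M * (1::real)" using M by (simp only: abs_mult abs_of_pos)
  then have "\<bar>of_int (m - n)\<bar> < (1::real)" using M by (simp only: mult_less_cancel_left_pos)
  then have "m = n" by linarith
  then show "k \<bullet> i = l \<bullet> i" by (simp add: mn)
qed

text \<open>The open cubes miss only countably many hyperplanes. Off these, rounding each coordinate
  to the nearest multiple of M gives the lattice point.\<close>

lemma AE_in_some_cube:
  fixes M :: real
  assumes M: "M > 0"
  shows "AE x in (lborel :: 'a::euclidean_space measure). \<exists>k\<in>lattice M. x \<in> cube M k"
proof -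
  define N where "N = (\<Union>i\<in>Basis. \<Union>n::int. {x::'a. x \<bullet> i = M * (of_int n + 1/2)})"
  have "{x::'a. x \<bullet> i = M * (of_int n + 1/2)} \<in> null_sets lborel" if "i \<in> Basis" for i and n :: int
  proof -
    have "negligible {x::'a. x \<bullet> i = M * (of_int n + 1/2)}" using negligible_standard_hyperplane[OF that] by simp
    then have "{x::'a. x \<bullet> i = M * (of_int n + 1/2)} \<in> null_sets lebesgue" by (simp add: negligible_iff_null_sets)
    moreover have "{x::'a. x \<bullet> i = M * (of_int n + 1/2)} \<in> sets borel"
      by (intro borel_closed closed_Collect_eq continuous_intros)
    ultimately show ?thesis by (auto simp: null_sets_def)
  qed
  then have "N \<in> null_sets lborel" unfolding N_def
    by (intro null_sets_UN'[OF countable_finite[OF finite_Basis]] null_sets_UN'[OF countableI_type])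
  then have "AE x in lborel. x \<notin> N" by (rule AE_not_in)
  then show ?thesis
  proof eventually_elim
    case (elim x)
    define k where "k = (\<Sum>i\<in>Basis. (M * of_int \<lfloor>x \<bullet> i / M + 1/2\<rfloor>) *\<^sub>R i)"
    have ki: "k \<bullet> i = M * of_int \<lfloor>x \<bullet> i / M + 1/2\<rfloor>" if "i \<in> Basis" for i
      using that by (simp add: k_def)
    have "k \<in> lattice M" unfolding lattice_def using ki by blast
    moreover have "\<bar>x \<bullet> i - k \<bullet> i\<bar> < M / 2" if i: "i \<in> Basis" for i
    proof -
      define t where "t = x \<bullet> i / M"
      define n where "n = \<lfloor>t + 1/2\<rfloor>"
      have n: "of_int n \<le> t + 1/2" "t + 1/2 < of_int n + 1" unfolding n_def using floor_correct[of "t + 1/2"] by auto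
      have xt: "x \<bullet> i = M * t" using M by (simp add: t_def)
      \<comment> \<open>Rounding by the floor still admits t = n - 1/2, the lower face of the cube;
        this is the hyperplane of index n - 1 in N.\<close>
      have "t \<noteq> of_int (n - 1) + 1/2"
      proof
        assume "t = of_int (n - 1) + 1/2"
        then have "x \<bullet> i = M * (of_int (n - 1) + 1/2)" by (simp only: xt)
        then have "x \<in> N" unfolding N_def using i by blast
        then show False using elim by simp
      qed
      then have "t \<noteq> of_int n - 1/2" by simp
      then have "of_int n - 1/2 < t" using n by linarith
      then have "\<bar>t - of_int n\<bar> < 1/2" using n by linarith
      then have "M * \<bar>t - of_int n\<bar> < M * (1/2)" using M by (intro mult_strict_left_mono) auto
      moreover have "\<bar>x \<bullet> i - k \<bullet> i\<bar> = M * \<bar>t - of_int n\<bar>"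
      proof -
        have "k \<bullet> i = M * of_int n" by (simp only: ki[OF i] n_def t_def)
        then have "x \<bullet> i - k \<bullet> i = M * (t - of_int n)" by (simp only: xt right_diff_distrib)
        then show ?thesis using M by (simp only: abs_mult abs_of_pos)
      qed
      ultimately show ?thesis by simp
    qed
    then have "x \<in> cube M k" by (simp add: cube_iff)
    ultimately show ?case by blast
  qed
qed

text \<open>The local bounds are summed over finite parts of the lattice, with constants independent
  of the part: the small balls lie in disjoint cubes, and a point is in at most (2 R + 1)^d large
  boxes. Dominated convergence then exhausts the space.\<close>

lemma global_from_local:
  fixes \<phi> :: "'a::euclidean_space \<Rightarrow> real"
  assumes M: "M > 0" and \<phi>: "square_integrable \<phi>" and Z: "equidistributed M \<delta> Z" and C: "C \<ge> 0" and e: "e \<ge> 0"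
    and loc: "\<And>k. k \<in> lattice M \<Longrightarrow> mass \<phi> (cube M k) \<le> C * mass \<phi> (ball (Z k) \<delta>)
        + e * mass \<phi> {x. \<forall>i\<in>Basis. \<bar>x \<bullet> i - k \<bullet> i\<bar> \<le> real R * M}"
  shows "(\<integral>x. (\<phi> x)\<^sup>2 \<partial>lborel) \<le> C * mass \<phi> (S_set M \<delta> Z) + e * real ((2 * R + 1) ^ DIM('a)) * (\<integral>x. (\<phi> x)\<^sup>2 \<partial>lborel)"
proof -
  define S where "S n = {k \<in> lattice M. \<forall>i\<in>Basis. \<bar>(0::'a) \<bullet> i - k \<bullet> i\<bar> \<le> real n * M}" for n
  have fS: "finite (S n)" for n unfolding S_def by (rule lattice_box_finite[OF M])
  define B where "B k = {x. \<forall>i\<in>Basis. \<bar>x \<bullet> i - k \<bullet> i\<bar> \<le> real R * M}" for k :: 'a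
  have mB: "B k \<in> sets borel" for k
  proof -
    have "B k = (\<Inter>i\<in>Basis. {x. \<bar>x \<bullet> i - k \<bullet> i\<bar> \<le> real R * M})" by (auto simp: B_def)
    also have "\<dots> \<in> sets borel"
      by (intro borel_closed closed_INT ballI closed_Collect_le continuous_intros)
    finally show ?thesis .
  qed
  have mC: "cube M k \<in> sets borel" for k :: 'a by (simp add: cube_def)
  have opS: "open (S_set M \<delta> Z)" unfolding S_set_def by auto
  have mS: "S_set M \<delta> Z \<in> sets borel" using opS by simp
  have sub: "S n \<subseteq> lattice M" for n by (auto simp: S_def)
  have ballcube: "ball (Z k) \<delta> \<subseteq> cube M k" if "k \<in> lattice M" for k
    using Z that by (simp add: equidistributed_def)
  have dC: "disjoint_family_on (cube M) (S n)" for n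
    unfolding disjoint_family_on_def using cube_disjoint[OF M] sub by blast
  have dB: "disjoint_family_on (\<lambda>k. ball (Z k) \<delta>) (S n)" for n
    unfolding disjoint_family_on_def using cube_disjoint[OF M] sub ballcube by blast
  define T where "T n x = (\<Sum>k\<in>S n. indicator (cube M k) x :: real)" for n and x :: 'a
  have T: "T n x = indicator (\<Union>k\<in>S n. cube M k) x" for n x
    unfolding T_def by (rule indicator_UN_disjoint[OF fS dC, symmetric])
  note i\<phi> = square_integrableD(2)[OF \<phi>]
  note [measurable] = square_integrableD(1)[OF \<phi>]
  define I where "I = (\<integral>x. (\<phi> x)\<^sup>2 \<partial>lborel)"
  have bound: "(\<integral>x. T n x * (\<phi> x)\<^sup>2 \<partial>lborel) \<le> C * mass \<phi> (S_set M \<delta> Z) + e * real ((2 * R + 1) ^ DIM('a)) * I" for n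
  proof -
    have "(\<integral>x. T n x * (\<phi> x)\<^sup>2 \<partial>lborel) = (\<Sum>k\<in>S n. mass \<phi> (cube M k))"
      unfolding T_def sum_distrib_right mass_def
      by (intro Bochner_Integration.integral_sum mass_integrable \<phi> mC)
    also have "\<dots> \<le> (\<Sum>k\<in>S n. C * mass \<phi> (ball (Z k) \<delta>) + e * mass \<phi> (B k))"
      using loc sub by (intro sum_mono) (auto simp: B_def)
    also have "\<dots> = C * (\<Sum>k\<in>S n. mass \<phi> (ball (Z k) \<delta>)) + e * (\<Sum>k\<in>S n. mass \<phi> (B k))"
      by (simp add: sum.distrib sum_distrib_left)
    also have "\<dots> \<le> C * mass \<phi> (S_set M \<delta> Z) + e * (real ((2 * R + 1) ^ DIM('a)) * I)"
    proof (intro add_mono mult_left_mono C e)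
      have "(\<Sum>k\<in>S n. mass \<phi> (ball (Z k) \<delta>)) = (\<integral>x. (\<Sum>k\<in>S n. indicator (ball (Z k) \<delta>) x) * (\<phi> x)\<^sup>2 \<partial>lborel)"
        unfolding sum_distrib_right mass_def
        by (intro Bochner_Integration.integral_sum[symmetric] mass_integrable \<phi>) auto
      also have "\<dots> = mass \<phi> (\<Union>k\<in>S n. ball (Z k) \<delta>)"
        unfolding mass_def by (simp only: indicator_UN_disjoint[OF fS dB])
      also have "\<dots> \<le> mass \<phi> (S_set M \<delta> Z)"
      proof (rule mass_mono[OF \<phi> _ mS])
        show "(\<Union>k\<in>S n. ball (Z k) \<delta>) \<in> sets borel" by (intro borel_open open_UN ballI open_ball)
        show "(\<Union>k\<in>S n. ball (Z k) \<delta>) \<subseteq> S_set M \<delta> Z" using sub by (auto simp: S_set_def)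
      qed
      finally show "(\<Sum>k\<in>S n. mass \<phi> (ball (Z k) \<delta>)) \<le> mass \<phi> (S_set M \<delta> Z)" .
      have cnt: "(\<Sum>k\<in>S n. indicator (B k) x :: real) \<le> real ((2 * R + 1) ^ DIM('a))" for x
      proof -
        have "(\<Sum>k\<in>S n. indicator (B k) x :: real) = real (card {k \<in> S n. x \<in> B k})"
          using fS by (simp add: indicator_def sum.If_cases Int_def)
        also have "card {k \<in> S n. x \<in> B k} \<le> card {k \<in> lattice M. \<forall>i\<in>Basis. \<bar>x \<bullet> i - k \<bullet> i\<bar> \<le> real R * M}"
          by (intro card_mono lattice_box_finite[OF M]) (use sub in \<open>auto simp: B_def\<close>)
        also have "\<dots> \<le> (2 * R + 1) ^ DIM('a)" by (rule lattice_box_finite[OF M])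
        finally show ?thesis by simp
      qed
      have "(\<Sum>k\<in>S n. mass \<phi> (B k)) = (\<integral>x. (\<Sum>k\<in>S n. indicator (B k) x) * (\<phi> x)\<^sup>2 \<partial>lborel)"
        unfolding sum_distrib_right mass_def
        by (intro Bochner_Integration.integral_sum[symmetric] mass_integrable \<phi> mB)
      also have "\<dots> \<le> (\<integral>x. real ((2 * R + 1) ^ DIM('a)) * (\<phi> x)\<^sup>2 \<partial>lborel)"
      proof (rule integral_mono)
        show "integrable lborel (\<lambda>x. (\<Sum>k\<in>S n. indicator (B k) x) * (\<phi> x)\<^sup>2)"
          unfolding sum_distrib_right by (intro Bochner_Integration.integrable_sum mass_integrable \<phi> mB)
        show "integrable lborel (\<lambda>x. real ((2 * R + 1) ^ DIM('a)) * (\<phi> x)\<^sup>2)" using i\<phi> by (rule integrable_mult_right)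
        show "(\<Sum>k\<in>S n. indicator (B k) x) * (\<phi> x)\<^sup>2 \<le> real ((2 * R + 1) ^ DIM('a)) * (\<phi> x)\<^sup>2" for x
          by (rule mult_right_mono[OF cnt]) simp
      qed
      also have "\<dots> = real ((2 * R + 1) ^ DIM('a)) * I" unfolding I_def by (rule integral_mult_right_zero)
      finally show "(\<Sum>k\<in>S n. mass \<phi> (B k)) \<le> real ((2 * R + 1) ^ DIM('a)) * I" .
    qed
    finally show ?thesis by (simp only: mult.assoc)
  qed
  have "(\<lambda>n. \<integral>x. T n x * (\<phi> x)\<^sup>2 \<partial>lborel) \<longlonglongrightarrow> (\<integral>x. (\<phi> x)\<^sup>2 \<partial>lborel)"
  proof (rule integral_dominated_convergence[where w="\<lambda>x. (\<phi> x)\<^sup>2"])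
    show "integrable lborel (\<lambda>x. (\<phi> x)\<^sup>2)" by (rule i\<phi>)
    show "(\<lambda>x. T n x * (\<phi> x)\<^sup>2) \<in> borel_measurable lborel" for n
      unfolding T_def using mC by measurable
    show "AE x in lborel. norm (T n x * (\<phi> x)\<^sup>2) \<le> (\<phi> x)\<^sup>2" for n
      unfolding T by (auto simp: indicator_def)
    show "AE x in lborel. (\<lambda>n. T n x * (\<phi> x)\<^sup>2) \<longlonglongrightarrow> (\<phi> x)\<^sup>2"
      using AE_in_some_cube[OF M]
    proof eventually_elim
      case (elim x)
      then obtain k where k: "k \<in> lattice M" "x \<in> cube M k" by blast
      obtain n0 :: nat where n0: "norm k / M \<le> real n0" using real_arch_simple by blast
      have "eventually (\<lambda>n. T n x * (\<phi> x)\<^sup>2 = (\<phi> x)\<^sup>2) sequentially"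
        using eventually_ge_at_top[of n0]
      proof eventually_elim
        case (elim n)
        have nk: "norm k \<le> real n * M"
        proof -
          have "norm k / M \<le> real n" using n0 elim by linarith
          then show ?thesis using M by (simp only: pos_divide_le_eq)
        qed
        have "\<bar>k \<bullet> i\<bar> \<le> real n * M" if "i \<in> Basis" for i
          using Basis_le_norm[OF that, of k] nk by linarith
        then have "k \<in> S n" using k by (simp add: S_def)
        then have "x \<in> (\<Union>k\<in>S n. cube M k)" using k by blast
        then show ?case by (simp add: T)
      qed
      then show ?case by (rule tendsto_eventually)
    qed
  qed measurable
  then show ?thesis unfolding I_def[symmetric]
    by (rule LIMSEQ_le_const2) (intro exI allI impI bound)
qed

section \<open>Uniqueness of weak derivatives\<close>

text \<open>Outside the box some factor has a nonpositive argument and vanishes. Inside, each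
  argument tends to infinity with n, where \<open>expk 0\<close> tends to 1. Thus indicators of
  boxes are bounded pointwise limits of test functions.\<close>

lemma box_cutoff_test_fun:
  fixes a b :: "'a::euclidean_space"
  assumes ab: "\<And>i. i \<in> Basis \<Longrightarrow> a \<bullet> i < b \<bullet> i"
  defines "(\<beta> :: nat \<Rightarrow> 'a \<Rightarrow> real) \<equiv> \<lambda>n x. \<Prod>i\<in>Basis. expk 0 (real (Suc n) * ((x \<bullet> i - a \<bullet> i) * (b \<bullet> i - x \<bullet> i)))"
  shows "test_fun (\<beta> n)" "0 \<le> \<beta> n x" "\<beta> n x \<le> 1" "x \<notin> box a b \<Longrightarrow> \<beta> n x = 0" "x \<in> box a b \<Longrightarrow> 0 < \<beta> n x"
    "(\<lambda>n. \<beta> n x) \<longlonglongrightarrow> indicator (box a b) x" "continuous_on UNIV (\<beta> n)"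
proof -
  have e1: "expk 0 t \<le> 1" for t by (simp add: expk_def)
  show nn: "0 \<le> \<beta> n x" "\<beta> n x \<le> 1" unfolding \<beta>_def by (auto intro!: prod_nonneg prod_le_1 simp: expk_nonneg e1)
  have out: "\<beta> n x = 0" if x: "x \<notin> box a b" for n x
  proof -
    obtain i where i: "i \<in> Basis" "x \<bullet> i \<le> a \<bullet> i \<or> b \<bullet> i \<le> x \<bullet> i"
      using x by (force simp: mem_box not_less)
    have "(x \<bullet> i - a \<bullet> i) * (b \<bullet> i - x \<bullet> i) \<le> 0"
      using i(2)
    proof
      assume "x \<bullet> i \<le> a \<bullet> i"
      then show ?thesis using ab[OF i(1)] by (intro mult_nonpos_nonneg) linarith+
    next
      assume "b \<bullet> i \<le> x \<bullet> i"
      then show ?thesis using ab[OF i(1)] by (intro mult_nonneg_nonpos) linarith+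
    qed
    then have "real (Suc n) * ((x \<bullet> i - a \<bullet> i) * (b \<bullet> i - x \<bullet> i)) \<le> 0"
      by (rule mult_nonneg_nonpos[rotated]) simp
    then have "expk 0 (real (Suc n) * ((x \<bullet> i - a \<bullet> i) * (b \<bullet> i - x \<bullet> i))) = 0" by (simp only: expk_def not_less[symmetric] if_False)
    then show ?thesis unfolding \<beta>_def using i(1) by (intro prod_zero) auto
  qed
  then show "x \<notin> box a b \<Longrightarrow> \<beta> n x = 0" .
  have pos: "0 < (x \<bullet> i - a \<bullet> i) * (b \<bullet> i - x \<bullet> i)" if "x \<in> box a b" "i \<in> Basis" for x i
    using that by (auto simp: mem_box)
  show "x \<in> box a b \<Longrightarrow> 0 < \<beta> n x" unfolding \<beta>_def
  proof (rule prod_pos)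
    fix i :: 'a assume x: "x \<in> box a b" and i: "i \<in> Basis"
    have "0 < real (Suc n) * ((x \<bullet> i - a \<bullet> i) * (b \<bullet> i - x \<bullet> i))"
      by (rule mult_pos_pos[OF _ pos[OF x i]]) simp
    then show "0 < expk 0 (real (Suc n) * ((x \<bullet> i - a \<bullet> i) * (b \<bullet> i - x \<bullet> i)))" unfolding expk_def by (simp only: if_True) simp
  qed
  show c: "continuous_on UNIV (\<beta> n)" unfolding \<beta>_def
    by (intro continuous_on_prod continuous_on_compose2[OF expk_continuous[of UNIV]] continuous_intros) auto
  have "smooth_algebra (\<lambda>x. \<Prod>i\<in>Basis. expk 0 (real (Suc n) * ((x \<bullet> i + - (a \<bullet> i)) * (b \<bullet> i + (-1) * (x \<bullet> i)))))"
    by (intro smooth_algebra_prod smooth_algebra.intros finite_Basis)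
  then have "smooth_fun (\<beta> n)" unfolding \<beta>_def using smooth_algebra_smooth by force
  moreover have "bounded {x. \<beta> n x \<noteq> 0}"
    by (rule bounded_subset[OF bounded_box[of a b]]) (use out in auto)
  ultimately show "test_fun (\<beta> n)" unfolding test_fun_def by (simp only: compact_closure)
  show "(\<lambda>n. \<beta> n x) \<longlonglongrightarrow> indicator (box a b) x"
  proof (cases "x \<in> box a b")
    case False
    then show ?thesis using out[OF False] by simp
  next
    case True
    have one: "(\<lambda>n. expk 0 (real (Suc n) * t)) \<longlonglongrightarrow> 1" if t: "t > 0" for t
    proof -
      have "(\<lambda>n. (1 / t) * (1 / real (Suc n))) \<longlonglongrightarrow> (1 / t) * 0"
        by (intro tendsto_mult_left LIMSEQ_Suc[OF lim_1_over_n])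
      then have "(\<lambda>n. exp (- ((1 / t) * (1 / real (Suc n))))) \<longlonglongrightarrow> exp (- ((1 / t) * 0))"
        by (intro tendsto_exp tendsto_minus)
      moreover have "exp (- ((1 / t) * (1 / real (Suc n)))) = expk 0 (real (Suc n) * t)" for n
      proof -
        have "0 < real (Suc n) * t" using t by simp
        moreover have "- ((1 / t) * (1 / real (Suc n))) = - 1 / (real (Suc n) * t)" by simp
        ultimately show ?thesis unfolding expk_def by (simp only: if_True power_0 div_by_1)
      qed
      ultimately show ?thesis by simp
    qed
    have "(\<lambda>n. \<beta> n x) \<longlonglongrightarrow> (\<Prod>i\<in>(Basis::'a set). 1)"
      unfolding \<beta>_def by (intro tendsto_prod one pos[OF True])
    then show ?thesis using True by simp
  qed
qed

text \<open>Measurability and integrability of u on compact boxes are recovered by dividing u psi by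
  a test function psi positive there. The box cutoffs then show that u has integral 0 over every
  box, and by Lebesgue differentiation u is almost everywhere the limit of its vanishing averages
  over small cubes.\<close>

lemma weak_zero_imp_AE_zero:
  fixes u :: "'a::euclidean_space \<Rightarrow> real"
  assumes i: "\<And>\<psi>. test_fun \<psi> \<Longrightarrow> integrable lebesgue (\<lambda>x. u x * \<psi> x)"
    and z: "\<And>\<psi>. test_fun \<psi> \<Longrightarrow> (\<integral>x. u x * \<psi> x \<partial>lebesgue) = 0"
  shows "AE x in lebesgue. u x = 0"
proof -
  define \<beta> where "\<beta> a b n x = (\<Prod>i\<in>Basis. expk 0 (real (Suc n) * ((x \<bullet> i - a \<bullet> i) * (b \<bullet> i - x \<bullet> i))))" for a b x :: 'a and n
  have intg: "set_integrable lebesgue (cbox a b) u" for a b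
  proof (cases "cbox a b = {}")
    case True
    then show ?thesis by (simp add: set_integrable_def)
  next
    case False
    \<comment> \<open>The margin places the closed box inside the open one where the cutoff is
      positive, so the cutoff has a positive minimum c on it.\<close>
    define a' b' where "a' = a - One" and "b' = b + One"
    have le: "a \<bullet> i \<le> b \<bullet> i" if "i \<in> Basis" for i using False that by (force simp: box_eq_empty not_less)
    have ab: "a' \<bullet> i < b' \<bullet> i" if "i \<in> Basis" for i
      using le[OF that] that by (simp add: a'_def b'_def inner_diff_left inner_add_left)
    note \<beta> = box_cutoff_test_fun[of a' b', OF ab, folded \<beta>_def]
    have sub: "cbox a b \<subseteq> box a' b'"
      by (auto simp: mem_box a'_def b'_def inner_diff_left inner_add_left) force+
    have m\<beta>: "\<beta> a' b' 0 \<in> borel_measurable lebesgue"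
      using borel_measurable_continuous_onI[OF \<beta>(7)] by (intro measurable_completion) simp
    obtain x0 where x0: "x0 \<in> cbox a b" "\<And>x. x \<in> cbox a b \<Longrightarrow> \<beta> a' b' 0 x0 \<le> \<beta> a' b' 0 x"
      using continuous_attains_inf[OF compact_cbox False continuous_on_subset[OF \<beta>(7) subset_UNIV]] by blast
    define c where "c = \<beta> a' b' 0 x0"
    have c: "c > 0" unfolding c_def using x0(1) sub by (intro \<beta>(5)) auto
    note iu = i[OF \<beta>(1)[of 0]]
    show ?thesis unfolding set_integrable_def
    proof (rule Bochner_Integration.integrable_bound)
      show "integrable lebesgue (\<lambda>x. (1 / c) * (u x * \<beta> a' b' 0 x))" using iu by (rule integrable_mult_right)
      have eq: "indicator (cbox a b) x *\<^sub>R u x = indicator (cbox a b) x * ((u x * \<beta> a' b' 0 x) / \<beta> a' b' 0 x)" for x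
      proof (cases "x \<in> cbox a b")
        case True
        then have "\<beta> a' b' 0 x > 0" using sub by (intro \<beta>(5)) auto
        then show ?thesis by simp
      qed simp
      have mu: "(\<lambda>x. u x * \<beta> a' b' 0 x) \<in> borel_measurable lebesgue"
        using iu by (rule borel_measurable_integrable)
      show "(\<lambda>x. indicator (cbox a b) x *\<^sub>R u x) \<in> borel_measurable lebesgue" unfolding eq
        by (intro borel_measurable_times borel_measurable_divide borel_measurable_indicator mu m\<beta>) simp
      have "norm (indicator (cbox a b) x *\<^sub>R u x) \<le> norm ((1 / c) * (u x * \<beta> a' b' 0 x))" for x
      proof (cases "x \<in> cbox a b")
        case True
        have "c * \<bar>u x\<bar> \<le> \<bar>\<beta> a' b' 0 x\<bar> * \<bar>u x\<bar>"
          using x0(2)[OF True] by (intro mult_right_mono) (auto simp: c_def)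
        then have "\<bar>u x\<bar> \<le> (\<bar>\<beta> a' b' 0 x\<bar> * \<bar>u x\<bar>) / c" using c by (simp only: pos_le_divide_eq mult.commute)
        then show ?thesis using True c by (simp add: abs_mult mult.commute)
      qed simp
      then show "AE x in lebesgue. norm (indicator (cbox a b) x *\<^sub>R u x) \<le> norm ((1 / c) * (u x * \<beta> a' b' 0 x))" by simp
    qed
  qed
  have zero: "integral (cbox a b) u = 0" for a b :: 'a
  proof (cases "box a b = {}")
    case True
    then show ?thesis using integral_open_interval[of a b u] by simp
  next
    case False
    have ab: "a \<bullet> i < b \<bullet> i" if "i \<in> Basis" for i using False that by (force simp: box_eq_empty not_less)
    note \<beta> = box_cutoff_test_fun[of a b, OF ab, folded \<beta>_def]
    have si: "set_integrable lebesgue (box a b) u"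
      by (rule set_integrable_subset[OF intg[of a b]]) (auto simp: box_subset_cbox)
    have m: "(\<lambda>x. indicator (box a b) x * u x) \<in> borel_measurable lebesgue"
      using borel_measurable_integrable[OF si[unfolded set_integrable_def]] by simp
    have "(\<lambda>n. \<integral>x. u x * \<beta> a b n x \<partial>lebesgue) \<longlonglongrightarrow> (\<integral>x. indicator (box a b) x * u x \<partial>lebesgue)"
    proof (rule integral_dominated_convergence[where w="\<lambda>x. norm (indicator (box a b) x *\<^sub>R u x)"])
      show "(\<lambda>x. indicator (box a b) x * u x) \<in> borel_measurable lebesgue" by (rule m)
      show "(\<lambda>x. u x * \<beta> a b n x) \<in> borel_measurable lebesgue" for n
        by (rule borel_measurable_integrable[OF i[OF \<beta>(1)]])
      show "integrable lebesgue (\<lambda>x. norm (indicator (box a b) x *\<^sub>R u x))"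
        using si unfolding set_integrable_def by (rule integrable_norm)
      have "(\<lambda>n. u x * \<beta> a b n x) \<longlonglongrightarrow> u x * indicator (box a b) x" for x
        by (intro tendsto_mult_left \<beta>(6))
      then show "AE x in lebesgue. (\<lambda>n. u x * \<beta> a b n x) \<longlonglongrightarrow> indicator (box a b) x * u x"
        by (simp only: mult.commute[of "indicator _ _"]) simp
      have "norm (u x * \<beta> a b n x) \<le> norm (indicator (box a b) x *\<^sub>R u x)" for x n
      proof (cases "x \<in> box a b")
        case True
        have "\<bar>u x\<bar> * \<bar>\<beta> a b n x\<bar> \<le> \<bar>u x\<bar> * 1" using \<beta>(2,3)[of n x] by (intro mult_left_mono) auto
        then show ?thesis using True by (simp add: abs_mult)
      qed (simp add: \<beta>(4))
      then show "AE x in lebesgue. norm (u x * \<beta> a b n x) \<le> norm (indicator (box a b) x *\<^sub>R u x)" for n by simp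
    qed
    then have "(\<integral>x. indicator (box a b) x * u x \<partial>lebesgue) = 0" by (simp add: z[OF \<beta>(1)] LIMSEQ_const_iff)
    then have "(LINT x:box a b|lebesgue. u x) = 0" by (simp add: set_lebesgue_integral_def)
    then show ?thesis using set_lebesgue_integral_eq_integral(2)[OF si] integral_open_interval[of a b u] by simp
  qed
  have "u integrable_on cbox a b" for a b using set_lebesgue_integral_eq_integral(1)[OF intg] .
  then obtain N where N: "negligible N" "\<And>x e. \<lbrakk>x \<notin> N; 0 < e\<rbrakk> \<Longrightarrow>
      \<exists>d>0. \<forall>h. 0 < h \<and> h < d \<longrightarrow> norm (integral (cbox x (x + h *\<^sub>R One)) u /\<^sub>R h ^ DIM('a) - u x) < e"
    using integrable_ccontinuous_explicit[of u] by auto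
  have "u x = 0" if "x \<notin> N" for x
  proof (rule ccontr)
    assume "u x \<noteq> 0"
    then have "\<bar>u x\<bar> > 0" by simp
    from N(2)[OF that this] obtain d where d: "d > 0"
      "\<And>h. 0 < h \<and> h < d \<Longrightarrow> norm (integral (cbox x (x + h *\<^sub>R One)) u /\<^sub>R h ^ DIM('a) - u x) < \<bar>u x\<bar>" by auto
    from d(2)[of "d / 2"] d(1) show False by (simp add: zero)
  qed
  moreover have "AE x in lebesgue. x \<notin> N" using N(1) by (simp add: negligible_iff_null_sets AE_not_in)
  ultimately show ?thesis by auto
qed

text \<open>A mollification of phi is affine along direction i. By Jensen its square is at most the
  kernel average of phi^2, which tends to 0 along that line because phi is square integrable. So
  every mollification vanishes, and phi is their limit.\<close>

lemma weak_second_derivative_zero: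
  fixes \<phi> :: "'a::euclidean_space \<Rightarrow> real"
  assumes \<phi>: "square_integrable \<phi>" and i: "i \<in> Basis"
    and weak: "\<And>\<psi>. test_fun \<psi> \<Longrightarrow> (\<integral>x. \<phi> x * deriv_iter [i, i] \<psi> x \<partial>lborel) = 0"
  shows "(\<integral>x. (\<phi> x)\<^sup>2 \<partial>lborel) = 0"
proof -
  note [measurable] = square_integrableD(1)[OF \<phi>]
  note l\<phi> = square_integrable_imp_locally_integrable[OF \<phi>]
  have "(\<integral>x. (\<phi> x)\<^sup>2 \<partial>lborel) \<le> 0 + e" if e: "e > 0" for e
  proof -
    obtain d where d: "d > 0" "\<And>z. norm z < d \<Longrightarrow> (\<integral>x. (\<phi> (x + z) - \<phi> x)\<^sup>2 \<partial>lborel) \<le> e"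
      using translation_continuous_L2[OF \<phi> e] by auto
    obtain \<rho> :: "'a \<Rightarrow> real" and g H where \<rho>: "C2_fun \<rho> g H" "\<And>x. 0 \<le> \<rho> x" "\<And>x. norm x \<ge> d \<Longrightarrow> \<rho> x = 0"
      "integrable lborel \<rho>" "(\<integral>x. \<rho> x \<partial>lborel) = 1" "\<And>x. \<rho> (- x) = \<rho> x" "\<And>y. test_fun (\<lambda>x. \<rho> (y - x))"
      using mollifier_exists[OF d(1)] by auto
    note c\<rho> = C2_funD(7)[OF \<rho>(1)]
    have [measurable]: "\<rho> \<in> borel_measurable borel" by (rule borel_measurable_continuous_onI[OF c\<rho>])
    define F where "F y = (\<integral>x. \<phi> x * \<rho> (y - x) \<partial>lborel)" for y
    define G where "G y = (\<integral>x. \<phi> x *\<^sub>R g (y - x) \<partial>lborel)" for y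
    define K where "K y k = (\<integral>x. \<phi> x *\<^sub>R H (y - x) k \<partial>lborel)" for y k
    have C: "C2_fun F G K" unfolding F_def[abs_def] G_def[abs_def] K_def[abs_def]
      by (rule mollified_C2_fun(1)[OF l\<phi> \<rho>(1), of d], rule \<rho>(3), assumption)
    have op: "open {x::'a. norm x > d}" by (intro open_Collect_less continuous_intros)
    have H0: "H x k = 0" if "norm x > d" for x k
      using C2_fun_zero_on_open(2)[OF \<rho>(1) op, of x k] that \<rho>(3) by auto
    have K0: "K y i \<bullet> i = 0" for y
    proof -
      have "integrable lborel (\<lambda>x. \<phi> x *\<^sub>R H (y - x) i)"
        by (rule convolution_integrable[OF l\<phi> C2_funD(4)[OF \<rho>(1)], of d]) (rule H0)
      then have "K y i \<bullet> i = (\<integral>x. (\<phi> x *\<^sub>R H (y - x) i) \<bullet> i \<partial>lborel)"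
        unfolding K_def by (intro integral_inner_left[symmetric]) auto
      also have "\<dots> = (\<integral>x. \<phi> x * deriv_iter [i, i] (\<lambda>x. \<rho> (y - x)) x \<partial>lborel)"
        unfolding deriv_iter_twice_reflected[OF \<rho>(1)] by simp
      also have "\<dots> = 0" by (rule weak[OF \<rho>(7)])
      finally show ?thesis .
    qed
    have F0: "F y = 0" for y
    proof -
      have line: "((\<lambda>t. y + t *\<^sub>R i) has_derivative (\<lambda>s. s *\<^sub>R i)) (at t)" for t
        by (auto intro!: derivative_eq_intros)
      have dF: "((\<lambda>t. F (y + t *\<^sub>R i)) has_real_derivative G (y + t *\<^sub>R i) \<bullet> i) (at t)" for t
        using has_derivative_compose[OF line C2_funD(1)[OF C]]
        by (simp add: has_field_derivative_def mult_commute_abs)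
      have dG: "((\<lambda>t. G (y + t *\<^sub>R i) \<bullet> i) has_real_derivative 0) (at t)" for t
      proof -
        have "((\<lambda>t. G (y + t *\<^sub>R i) \<bullet> i) has_derivative (\<lambda>s. K (y + t *\<^sub>R i) (s *\<^sub>R i) \<bullet> i)) (at t)"
          by (intro has_derivative_inner_left has_derivative_compose[OF line C2_funD(2)[OF C]])
        moreover have "K (y + t *\<^sub>R i) (s *\<^sub>R i) \<bullet> i = 0" for s
          using linear_cmul[OF C2_funD(5)[OF C]] K0 by simp
        ultimately show ?thesis unfolding has_field_derivative_def lambda_zero[symmetric] by simp
      qed
      define p where "p = G y \<bullet> i"
      have Gp: "G (y + t *\<^sub>R i) \<bullet> i = p" for t
        using DERIV_isconst_all[of "\<lambda>t. G (y + t *\<^sub>R i) \<bullet> i" t 0] dG by (simp add: p_def)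
      have "((\<lambda>t. F (y + t *\<^sub>R i) - p * t) has_real_derivative 0) (at t)" for t
        by (rule derivative_eq_intros dF refl)+ (simp add: Gp)
      then have aff: "F (y + t *\<^sub>R i) = F y + p * t" for t
        using DERIV_isconst_all[of "\<lambda>t. F (y + t *\<^sub>R i) - p * t" t 0] by simp
      have ref: "\<rho> (w - x) = \<rho> (- w + x)" for x w using \<rho>(6)[of "w - x"] by simp
      have nn1: "(\<integral>\<^sup>+x. ennreal (\<rho> (w - x)) \<partial>lborel) = 1" for w
        unfolding ref using nn_integral_lborel_translate[of "\<lambda>x. ennreal (\<rho> x)" "- w"]
          nn_integral_eq_integral[OF \<rho>(4)] \<rho>(2,5) by simp
      have "bounded (\<rho> ` cball 0 d)"
        by (intro compact_imp_bounded compact_continuous_image continuous_on_subset[OF c\<rho>]) auto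
      then obtain B where B: "\<forall>z\<in>cball 0 d. norm (\<rho> z) \<le> B" by (auto simp: bounded_iff)
      then have "norm (\<rho> 0) \<le> B" using d(1) by auto
      then have B0: "B \<ge> 0" using norm_ge_zero order_trans by blast
      have \<rho>B: "\<rho> z \<le> B" for z
      proof (cases "norm z \<le> d")
        case True
        then have "norm (\<rho> z) \<le> B" using B by simp
        then show ?thesis by simp
      next
        case False then show ?thesis using \<rho>(3)[of z] B0 by simp
      qed
      have i\<phi>\<rho>: "integrable lborel (\<lambda>x. \<rho> (w - x) * (\<phi> x)\<^sup>2)" for w
        by (rule integrable_weighted_square[OF \<phi>, where B=B]) (use \<rho>B \<rho>(2) in auto)
      have sq: "(F w)\<^sup>2 \<le> (\<integral>x. \<rho> (w - x) * (\<phi> x)\<^sup>2 \<partial>lborel)" for w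
      proof -
        have i1: "integrable lborel (\<lambda>x. \<phi> x * \<rho> (w - x))"
        proof -
          have "integrable lborel (\<lambda>x. \<phi> x *\<^sub>R \<rho> (w - x))"
            by (rule convolution_integrable[OF l\<phi> c\<rho>, of d]) (use \<rho>(3) in auto)
          then show ?thesis by simp
        qed
        have "ennreal ((F w)\<^sup>2) \<le> (\<integral>\<^sup>+x. ennreal ((\<phi> x)\<^sup>2 * \<rho> (w - x)) \<partial>lborel)"
          unfolding F_def by (rule square_integral_le_weighted[OF _ _ _ nn1 i1]) (use \<rho>(2) in auto)
        also have "\<dots> = (\<integral>\<^sup>+x. ennreal (\<rho> (w - x) * (\<phi> x)\<^sup>2) \<partial>lborel)" by (simp only: mult.commute)
        also have "\<dots> = ennreal (\<integral>x. \<rho> (w - x) * (\<phi> x)\<^sup>2 \<partial>lborel)"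
          using \<rho>(2) by (intro nn_integral_eq_integral i\<phi>\<rho>) auto
        finally show ?thesis
          by (subst (asm) ennreal_le_iff) (auto intro!: Bochner_Integration.integral_nonneg simp: \<rho>(2))
      qed
      \<comment> \<open>The compactly supported kernel eventually leaves each fixed x as its centre
        moves to infinity along i.\<close>
      have "(\<lambda>n. \<integral>x. \<rho> ((y + real n *\<^sub>R i) - x) * (\<phi> x)\<^sup>2 \<partial>lborel) \<longlonglongrightarrow> (\<integral>x. 0 \<partial>(lborel :: 'a measure))"
      proof (rule integral_dominated_convergence[where w="\<lambda>x. B * (\<phi> x)\<^sup>2"])
        show "integrable lborel (\<lambda>x. B * (\<phi> x)\<^sup>2)" using square_integrableD(2)[OF \<phi>] by (rule integrable_mult_right)
        show "(\<lambda>x. \<rho> ((y + real n *\<^sub>R i) - x) * (\<phi> x)\<^sup>2) \<in> borel_measurable lborel" for n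
          using i\<phi>\<rho> by (rule borel_measurable_integrable)
        show "AE x in lborel. norm (\<rho> ((y + real n *\<^sub>R i) - x) * (\<phi> x)\<^sup>2) \<le> B * (\<phi> x)\<^sup>2" for n
          using \<rho>(2) \<rho>B by (intro AE_I2) (auto simp: abs_mult intro!: mult_right_mono)
        have "(\<lambda>n. \<rho> ((y + real n *\<^sub>R i) - x) * (\<phi> x)\<^sup>2) \<longlonglongrightarrow> 0" for x
        proof (rule tendsto_eventually)
          obtain n0 :: nat where n0: "real n0 \<ge> d + norm (y - x)" using real_arch_simple by blast
          show "eventually (\<lambda>n. \<rho> ((y + real n *\<^sub>R i) - x) * (\<phi> x)\<^sup>2 = 0) sequentially"
            using eventually_ge_at_top[of n0]
          proof eventually_elim
            case (elim n)
            have "norm (real n *\<^sub>R i) \<le> norm ((y + real n *\<^sub>R i) - x) + norm (y - x)"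
              using norm_triangle_ineq4[of "(y + real n *\<^sub>R i) - x" "y - x"] by simp
            then have "norm ((y + real n *\<^sub>R i) - x) \<ge> d" using n0 elim i by simp
            then show ?case using \<rho>(3) by simp
          qed
        qed
        then show "AE x in lborel. (\<lambda>n. \<rho> ((y + real n *\<^sub>R i) - x) * (\<phi> x)\<^sup>2) \<longlonglongrightarrow> 0" by simp
      qed auto
      then have "(\<lambda>n. \<integral>x. \<rho> ((y + real n *\<^sub>R i) - x) * (\<phi> x)\<^sup>2 \<partial>lborel) \<longlonglongrightarrow> 0" by simp
      then have "(\<lambda>n. (F (y + real n *\<^sub>R i))\<^sup>2) \<longlonglongrightarrow> 0"
        by (rule tendsto_sandwich[OF _ _ tendsto_const, rotated 2]) (auto intro!: always_eventually sq)
      then have "(\<lambda>n. sqrt ((F (y + real n *\<^sub>R i))\<^sup>2)) \<longlonglongrightarrow> sqrt 0" by (rule tendsto_real_sqrt)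
      then have lim: "(\<lambda>n. F y + p * real n) \<longlonglongrightarrow> 0"
        unfolding aff real_sqrt_abs real_sqrt_zero by (rule tendsto_rabs_zero_cancel)
      \<comment> \<open>Consecutive terms differ by p, so convergence forces p = 0, and then F y =
        0.\<close>
      have "(\<lambda>n. (F y + p * real (Suc n)) - (F y + p * real n)) \<longlonglongrightarrow> 0 - 0"
        by (intro tendsto_diff lim LIMSEQ_Suc[OF lim])
      then have "p = 0" by (simp add: algebra_simps LIMSEQ_const_iff)
      then show ?thesis using lim by (simp add: LIMSEQ_const_iff)
    qed
    have "(\<integral>y. ((\<integral>x. \<phi> x * \<rho> (y - x) \<partial>lborel) - \<phi> y)\<^sup>2 \<partial>lborel) \<le> e"
      by (rule mollification_L2_error(2)[OF \<phi> c\<rho> \<rho>(2-6) d(2)]) (use e in auto)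
    then show ?thesis using F0 unfolding F_def by simp
  qed
  then have "(\<integral>x. (\<phi> x)\<^sup>2 \<partial>lborel) \<le> 0" by (rule field_le_epsilon)
  moreover have "0 \<le> (\<integral>x. (\<phi> x)\<^sup>2 \<partial>lborel)" by (rule Bochner_Integration.integral_nonneg) simp
  ultimately show ?thesis by simp
qed

section \<open>The main estimate\<close>

text \<open>Lets multiplicative constants pass into the exponent of M / delta: x <= exp x, and exp 1
  is below 4 <= q^2.\<close>

lemma le_powr_two_times:
  fixes q x :: real
  assumes "q \<ge> 2" "x \<ge> 0"
  shows "x \<le> q powr (2 * x)"
proof -
  have "exp (1 :: real) \<le> 2 powr 2" using exp_le by simp
  also have "(2 :: real) powr 2 \<le> q powr 2" using assms by (intro powr_mono2) auto
  finally have "exp 1 powr x \<le> (q powr 2) powr x" using assms(2) by (intro powr_mono2) auto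
  moreover have "x \<le> exp x" using exp_ge_add_one_self[of x] by linarith
  ultimately show ?thesis by (simp add: powr_powr powr_def[of "exp 1"])
qed

text \<open>Two points of a cube differ by less than M in each coordinate, which gives d M^2. The
  larger ball has radius 4 sqrt(d) M <= 4 d M, and z is within M / 2 of k coordinatewise; rounding
  up gives the integer multiple 4 d + 1 needed for counting.\<close>

lemma cube_subset_sq_ball:
  fixes z k :: "'a::euclidean_space"
  assumes M: "M > 0" and z: "z \<in> cube M k"
  shows "cube M k \<subseteq> {x. (x - z) \<bullet> (x - z) \<le> real DIM('a) * M\<^sup>2}"
    and "{x. (x - z) \<bullet> (x - z) \<le> 16 * (real DIM('a) * M\<^sup>2)}
      \<subseteq> {x. \<forall>i\<in>Basis. \<bar>x \<bullet> i - k \<bullet> i\<bar> \<le> real (4 * DIM('a) + 1) * M}"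
proof -
  define d where "d = real DIM('a)"
  have d: "d \<ge> 1" by (simp add: d_def Suc_leI)
  show "cube M k \<subseteq> {x. (x - z) \<bullet> (x - z) \<le> real DIM('a) * M\<^sup>2}"
  proof
    fix x assume x: "x \<in> cube M k"
    have "(x - z) \<bullet> (x - z) = (\<Sum>i\<in>Basis. ((x - z) \<bullet> i) * ((x - z) \<bullet> i))" by (rule euclidean_inner)
    also have "\<dots> \<le> (\<Sum>i\<in>(Basis::'a set). M\<^sup>2)"
    proof (rule sum_mono)
      fix i :: 'a assume i: "i \<in> Basis"
      have "\<bar>x \<bullet> i - k \<bullet> i\<bar> < M / 2" "\<bar>z \<bullet> i - k \<bullet> i\<bar> < M / 2" using x z i by (auto simp only: cube_iff)
      then have "\<bar>(x - z) \<bullet> i\<bar> \<le> \<bar>M\<bar>" unfolding inner_diff_left by linarith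
      then have "((x - z) \<bullet> i)\<^sup>2 \<le> M\<^sup>2" by (simp only: abs_le_square_iff)
      then show "((x - z) \<bullet> i) * ((x - z) \<bullet> i) \<le> M\<^sup>2" by (simp only: power2_eq_square)
    qed
    finally show "x \<in> {x. (x - z) \<bullet> (x - z) \<le> real DIM('a) * M\<^sup>2}" by simp
  qed
  show "{x. (x - z) \<bullet> (x - z) \<le> 16 * (real DIM('a) * M\<^sup>2)}
      \<subseteq> {x. \<forall>i\<in>Basis. \<bar>x \<bullet> i - k \<bullet> i\<bar> \<le> real (4 * DIM('a) + 1) * M}"
  proof safe
    fix x i :: 'a
    assume x: "(x - z) \<bullet> (x - z) \<le> 16 * (real DIM('a) * M\<^sup>2)" and i: "i \<in> Basis"
    have "(norm (x - z))\<^sup>2 \<le> 16 * (d * M\<^sup>2)" using x by (simp only: power2_norm_eq_inner d_def)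
    also have "\<dots> \<le> 16 * (d * d * M\<^sup>2)" using d by (intro mult_left_mono mult_right_mono) auto
    also have "\<dots> = (4 * d * M)\<^sup>2" by (simp add: power2_eq_square)
    finally have "norm (x - z) \<le> 4 * d * M" by (rule power2_le_imp_le) (use d M in simp)
    then have "\<bar>(x - z) \<bullet> i\<bar> \<le> 4 * d * M" using Basis_le_norm[OF i, of "x - z"] by linarith
    moreover have "\<bar>z \<bullet> i - k \<bullet> i\<bar> < M / 2" using z i by (auto simp only: cube_iff)
    moreover have "real (4 * DIM('a) + 1) * M = 4 * d * M + M" by (simp add: d_def distrib_right)
    ultimately show "\<bar>x \<bullet> i - k \<bullet> i\<bar> \<le> real (4 * DIM('a) + 1) * M" using M unfolding inner_diff_left by linarith
  qed
qed

text \<open>The two parts of alpha have separate tasks: 8 d M^(4/3) N^(2/3) absorbs the potential,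
  and the dimensional part A makes the far contributions, summed over the lattice, at most half the
  total mass.\<close>

lemma equidistribution_mass_bound:
  fixes \<phi> :: "'a::euclidean_space \<Rightarrow> real"
  assumes M: "M > 0" and \<delta>: "0 < \<delta>" "\<delta> \<le> M / 2" and Z: "equidistributed M \<delta> Z" and N: "N \<ge> 0"
    and \<phi>: "square_integrable \<phi>" and h: "\<And>i. i \<in> Basis \<Longrightarrow> square_integrable (h i)"
    and weak: "\<And>i \<psi>. i \<in> Basis \<Longrightarrow> test_fun \<psi> \<Longrightarrow>
      (\<integral>x. \<phi> x * deriv_iter [i, i] \<psi> x \<partial>lborel) = (\<integral>x. h i x * \<psi> x \<partial>lborel)"
    and LN: "AE x in lborel. \<bar>\<Sum>i\<in>Basis. h i x\<bar> \<le> N * \<bar>\<phi> x\<bar>"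
    and d: "d = real DIM('a)" and K: "K = 8 * (18 * d + 576)\<^sup>2 * (9 * d + 291)"
    and A: "A = 2 * d + 4 * K * real ((2 * (4 * DIM('a) + 1) + 1) ^ DIM('a))"
    and \<alpha>: "\<alpha> = A + 8 * d * (M powr (4/3) * N powr (2/3))"
  shows "(\<integral>x. (\<phi> x)\<^sup>2 \<partial>lborel) \<le> 2 * (1 + 8 * K) * (8 * d * (M / \<delta>)\<^sup>2) powr (\<alpha> + 1) * mass \<phi> (S_set M \<delta> Z)"
proof -
  define R where "R = 4 * DIM('a) + 1"
  define Cd where "Cd = real ((2 * R + 1) ^ DIM('a))"
  define \<rho> where "\<rho> = d * M\<^sup>2"
  \<comment> \<open>With this choice 4 a = delta^2 / 2, so the closed ball of squared radius 4 a
    lies in the open ball of radius delta.\<close>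
  define a where "a = \<delta>\<^sup>2 / 8"
  define X where "X = M powr (4/3) * N powr (2/3)"
  have d1: "d \<ge> 1" by (simp add: d Suc_leI)
  have K0: "K \<ge> 0" using d1 by (simp add: K)
  have X0: "X \<ge> 0" by (simp add: X_def)
  have Cd0: "Cd \<ge> 0" by (simp add: Cd_def)
  have A': "A = 2 * d + 4 * K * Cd" by (simp add: A Cd_def R_def)
  have A0: "A \<ge> 2 * d" "A \<ge> 4 * K * Cd" "A \<ge> 0" using K0 Cd0 d1 by (simp_all add: A')
  have \<alpha>': "\<alpha> = A + 8 * d * X" by (simp add: \<alpha> X_def)
  have "0 \<le> 8 * d * X" using X0 d1 by simp
  then have \<alpha>ge: "\<alpha> \<ge> A" "\<alpha> \<ge> 2 * d" "\<alpha> \<ge> 8 * d * X" using A0 unfolding \<alpha>' by linarith+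
  have a0: "a > 0" using \<delta> by (simp add: a_def)
  have \<delta>M: "\<delta>\<^sup>2 \<le> (M / 2)\<^sup>2" using \<delta> by (intro power_mono) auto
  have \<rho>M: "M\<^sup>2 \<le> \<rho>" using d1 mult_right_mono[OF d1, of "M\<^sup>2"] by (simp add: \<rho>_def)
  have a\<rho>: "2 * a \<le> \<rho>"
  proof -
    have "\<delta>\<^sup>2 \<le> M\<^sup>2 / 4" using \<delta>M by (simp add: power_divide)
    then show ?thesis using \<rho>M zero_le_power2[of M] unfolding a_def by linarith
  qed
  have X3: "X ^ 3 = M ^ 4 * N\<^sup>2"
  proof -
    have "(M powr (4/3)) ^ 3 = M powr (of_nat 3 * (4/3))" using M by (intro powr_power) simp
    also have "\<dots> = M ^ 4" using M by simp
    finally have M4: "(M powr (4/3)) ^ 3 = M ^ 4" .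
    have "(N powr (2/3)) ^ 3 = N\<^sup>2"
    proof (cases "N = 0")
      case False
      then have "(N powr (2/3)) ^ 3 = N powr (of_nat 3 * (2/3))" by (rule powr_power)
      then show ?thesis using N False by simp
    qed simp
    then show ?thesis unfolding X_def power_mult_distrib M4 by simp
  qed
  \<comment> \<open>The cube of 8 d X is 512 d^3 M^4 N^2, while rho^2 = d^2 M^4; this is where the 8
    and the exponents 4/3 and 2/3 come from.\<close>
  have \<alpha>N: "\<alpha> ^ 3 \<ge> 512 * \<rho>\<^sup>2 * N\<^sup>2"
  proof -
    have "512 * \<rho>\<^sup>2 * N\<^sup>2 = 512 * d\<^sup>2 * (M ^ 4 * N\<^sup>2)" by (simp add: \<rho>_def power_mult_distrib)
    also have "\<dots> \<le> 512 * d ^ 3 * (M ^ 4 * N\<^sup>2)"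
      using d1 by (intro mult_right_mono mult_left_mono power_increasing) auto
    also have "\<dots> = (8 * d * X) ^ 3" by (simp add: power_mult_distrib X3)
    also have "\<dots> \<le> \<alpha> ^ 3" using \<alpha>ge(3) d1 X0 by (intro power_mono) auto
    finally show ?thesis .
  qed
  define C where "C = (1 + 8 * K) * (\<rho> / a) powr (\<alpha> + 1)"
  define e where "e = 2 * K * 3 powr (-\<alpha>)"
  have C0: "C \<ge> 0" and e0: "e \<ge> 0" using K0 by (simp_all add: C_def e_def)
  have K': "K = 8 * (18 * real DIM('a) + 576)\<^sup>2 * (9 * real DIM('a) + 291)" by (simp only: K d)
  have sqb: "{x. (x - z) \<bullet> (x - z) \<le> t} \<in> sets borel" for z :: 'a and t
    by (intro borel_closed closed_Collect_le continuous_intros)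
  have loc: "mass \<phi> (cube M k) \<le> C * mass \<phi> (ball (Z k) \<delta>)
        + e * mass \<phi> {x. \<forall>i\<in>Basis. \<bar>x \<bullet> i - k \<bullet> i\<bar> \<le> real R * M}" if k: "k \<in> lattice M" for k
  proof -
    have "Z k \<in> ball (Z k) \<delta>" using \<delta> by simp
    then have zk: "Z k \<in> cube M k" using Z k unfolding equidistributed_def by blast
    note sub = cube_subset_sq_ball[OF M zk, folded d, folded \<rho>_def, folded R_def]
    have mB: "{x. \<forall>i\<in>Basis. \<bar>x \<bullet> i - k \<bullet> i\<bar> \<le> real R * M} \<in> sets borel"
    proof -
      have "{x. \<forall>i\<in>Basis. \<bar>x \<bullet> i - k \<bullet> i\<bar> \<le> real R * M} = (\<Inter>i\<in>Basis. {x. \<bar>x \<bullet> i - k \<bullet> i\<bar> \<le> real R * M})" by auto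
      also have "\<dots> \<in> sets borel"
        by (intro borel_closed closed_INT ballI closed_Collect_le continuous_intros)
      finally show ?thesis .
    qed
    have "mass \<phi> (cube M k) \<le> mass \<phi> {x. (x - Z k) \<bullet> (x - Z k) \<le> \<rho>}"
      by (rule mass_mono[OF \<phi> _ sqb sub(1)]) (simp add: cube_def)
    also have "\<dots> \<le> C * mass \<phi> {x. (x - Z k) \<bullet> (x - Z k) \<le> 4 * a} + e * mass \<phi> {x. (x - Z k) \<bullet> (x - Z k) \<le> 16 * \<rho>}"
      unfolding C_def e_def K'
      by (rule local_estimate_at[OF a0 a\<rho> \<alpha>ge(2)[unfolded d] \<alpha>N \<phi> h weak LN])
    also have "\<dots> \<le> C * mass \<phi> (ball (Z k) \<delta>) + e * mass \<phi> {x. \<forall>i\<in>Basis. \<bar>x \<bullet> i - k \<bullet> i\<bar> \<le> real R * M}"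
    proof (intro add_mono mult_left_mono C0 e0)
      have "{x. (x - Z k) \<bullet> (x - Z k) \<le> 4 * a} \<subseteq> ball (Z k) \<delta>"
      proof
        fix x assume "x \<in> {x. (x - Z k) \<bullet> (x - Z k) \<le> 4 * a}"
        then have "(norm (x - Z k))\<^sup>2 \<le> 4 * a" by (simp add: power2_norm_eq_inner)
        also have "4 * a < \<delta>\<^sup>2" using \<delta> by (simp add: a_def)
        finally have "norm (x - Z k) < \<delta>" using \<delta> by (simp add: power2_less_imp_less)
        then show "x \<in> ball (Z k) \<delta>" by (simp add: dist_norm norm_minus_commute)
      qed
      then show "mass \<phi> {x. (x - Z k) \<bullet> (x - Z k) \<le> 4 * a} \<le> mass \<phi> (ball (Z k) \<delta>)"
        by (intro mass_mono[OF \<phi> sqb]) auto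
      show "mass \<phi> {x. (x - Z k) \<bullet> (x - Z k) \<le> 16 * \<rho>} \<le> mass \<phi> {x. \<forall>i\<in>Basis. \<bar>x \<bullet> i - k \<bullet> i\<bar> \<le> real R * M}"
        by (rule mass_mono[OF \<phi> sqb mB sub(2)])
    qed
    finally show ?thesis .
  qed
  define I where "I = (\<integral>x. (\<phi> x)\<^sup>2 \<partial>lborel)"
  define S where "S = mass \<phi> (S_set M \<delta> Z)"
  have I0: "I \<ge> 0" unfolding I_def by (rule Bochner_Integration.integral_nonneg) simp
  have glob: "I \<le> C * S + e * Cd * I"
    unfolding I_def S_def Cd_def by (rule global_from_local[OF M \<phi> Z C0 e0 loc])
  \<comment> \<open>This is what the second summand of A is for: 4 K Cd <= A <= exp A <=
    3^alpha.\<close>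
  have "e * Cd \<le> 1 / 2"
  proof -
    have "4 * K * Cd \<le> exp A" using A0(2) exp_ge_add_one_self[of A] by linarith
    also have "exp A = exp 1 powr A" by (simp add: powr_def)
    also have "\<dots> \<le> 3 powr A" using exp_le A0 by (intro powr_mono2) auto
    also have "\<dots> \<le> 3 powr \<alpha>" using \<alpha>ge by (intro powr_mono) auto
    finally have "4 * K * Cd * 3 powr (-\<alpha>) \<le> 3 powr \<alpha> * 3 powr (-\<alpha>)" by (intro mult_right_mono) auto
    also have "\<dots> = 1" by (simp add: powr_minus)
    finally show ?thesis by (simp add: e_def mult_ac)
  qed
  then have "e * Cd * I \<le> 1 / 2 * I" using I0 by (rule mult_right_mono)
  then have "I \<le> 2 * (C * S)" using glob by linarith
  moreover have ra: "\<rho> / a = 8 * d * (M / \<delta>)\<^sup>2" using \<delta> by (simp add: \<rho>_def a_def power_divide)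
  ultimately show ?thesis unfolding I_def S_def C_def ra by (simp only: mult.assoc)
qed

section \<open>Borel representatives, test functions and the comparison of weak derivatives\<close>

lemma L2_borel_representative:
  fixes f :: "'a::euclidean_space \<Rightarrow> real"
  assumes "L2 f"
  obtains f' where "square_integrable f'" "AE x in lebesgue. f x = f' x"
proof -
  have f: "f \<in> borel_measurable lebesgue" "integrable lebesgue (\<lambda>x. (f x)\<^sup>2)" using assms by (auto simp: L2_def)
  obtain f' where f': "f' \<in> borel_measurable lborel" "AE x in lborel. f x = f' x"
    using completion_ex_borel_measurable_real[OF f(1)] by blast
  have ae: "AE x in lebesgue. f x = f' x" using f'(2) by (rule AE_completion)
  have m: "(\<lambda>x. (f' x)\<^sup>2) \<in> borel_measurable lborel" using f'(1) by measurable
  have "integrable lebesgue (\<lambda>x. (f' x)\<^sup>2)"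
  proof (rule integrable_cong_AE_imp[OF f(2)])
    show "(\<lambda>x. (f' x)\<^sup>2) \<in> borel_measurable lebesgue" using m by (rule measurable_completion)
    show "AE x in lebesgue. (f x)\<^sup>2 = (f' x)\<^sup>2" using ae by eventually_elim simp
  qed
  then have "integrable lborel (\<lambda>x. (f' x)\<^sup>2)" using integrable_completion[OF m] by simp
  then have "square_integrable f'" using f'(1) by (simp add: square_integrable_def)
  then show thesis using ae by (rule that)
qed

lemma deriv_iter_continuous:
  assumes "test_fun \<psi>" "set bs \<subseteq> Basis"
  shows "continuous_on UNIV (deriv_iter bs \<psi>)"
proof -
  have "\<forall>x. deriv_iter bs \<psi> differentiable at x" using assms unfolding test_fun_def smooth_fun_def by blast
  then show ?thesis
    by (intro continuous_at_imp_continuous_on ballI differentiable_imp_continuous_within) simp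
qed

lemma deriv_iter_borel:
  assumes "test_fun \<psi>" "set bs \<subseteq> Basis"
  shows "deriv_iter bs \<psi> \<in> borel_measurable borel"
  by (rule borel_measurable_continuous_onI[OF deriv_iter_continuous[OF assms]])

lemma test_fun_borel: "test_fun \<psi> \<Longrightarrow> \<psi> \<in> borel_measurable borel"
  using deriv_iter_borel[of \<psi> "[]"] by simp

lemma integral_lebesgue_representative:
  fixes f f' w :: "'a::euclidean_space \<Rightarrow> real"
  assumes f: "f \<in> borel_measurable lebesgue" and f': "f' \<in> borel_measurable borel" and w: "w \<in> borel_measurable borel"
    and ae: "AE x in lebesgue. f x = f' x"
  shows "(\<integral>x. f x * w x \<partial>lebesgue) = (\<integral>x. f' x * w x \<partial>lborel)"
proof -
  have w': "w \<in> borel_measurable lebesgue" and f'': "f' \<in> borel_measurable lebesgue"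
    using w f' by (auto intro: measurable_completion)
  have "(\<integral>x. f x * w x \<partial>lebesgue) = (\<integral>x. f' x * w x \<partial>lebesgue)"
  proof (rule integral_cong_AE)
    show "AE x in lebesgue. f x * w x = f' x * w x" using ae by eventually_elim simp
  qed (intro borel_measurable_times f f'' w')+
  also have "\<dots> = (\<integral>x. f' x * w x \<partial>lborel)"
    by (rule integral_completion) (use f' w in simp)
  finally show ?thesis .
qed

text \<open>Ensures that the integrals against a square integrable weak derivative are genuine and
  not the default value 0.\<close>

lemma integrable_L2_test_fun:
  fixes h :: "'a::euclidean_space \<Rightarrow> real"
  assumes h: "L2 h" and \<psi>: "test_fun \<psi>"
  shows "integrable lebesgue (\<lambda>x. h x * \<psi> x)"
proof -
  have "continuous_on UNIV \<psi>" using deriv_iter_continuous[OF \<psi>, of "[]"] by simp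
  moreover obtain R where R: "\<And>x. norm x > R \<Longrightarrow> \<psi> x = 0"
  proof -
    have "bounded (closure {x. \<psi> x \<noteq> 0})" using \<psi> unfolding test_fun_def by (intro compact_imp_bounded) simp
    then obtain R where "\<forall>x\<in>closure {x. \<psi> x \<noteq> 0}. norm x \<le> R" by (auto simp: bounded_iff)
    then have R: "norm x \<le> R" if "\<psi> x \<noteq> 0" for x
      using subsetD[OF closure_subset[of "{x. \<psi> x \<noteq> 0}"], of x] that by simp
    show thesis
    proof (rule that)
      show "\<psi> x = 0" if "norm x > R" for x using R[of x] that by linarith
    qed
  qed
  ultimately have "square_integrable \<psi>" by (rule square_integrable_continuous)
  note sq = square_integrableD[OF this]
  have "(\<lambda>x. (\<psi> x)\<^sup>2) \<in> borel_measurable lborel" using sq(1) by simp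
  from integrable_completion[OF this] sq(2) have "integrable lebesgue (\<lambda>x. (\<psi> x)\<^sup>2)" by simp
  moreover have "integrable lebesgue (\<lambda>x. (h x)\<^sup>2)" using h by (simp add: L2_def)
  ultimately have "integrable lebesgue (\<lambda>x. (h x)\<^sup>2 + (\<psi> x)\<^sup>2)" by (rule Bochner_Integration.integrable_add[rotated])
  then show ?thesis
  proof (rule Bochner_Integration.integrable_bound)
    show "(\<lambda>x. h x * \<psi> x) \<in> borel_measurable lebesgue"
    proof (rule borel_measurable_times)
      show "h \<in> borel_measurable lebesgue" using h by (simp add: L2_def)
      show "\<psi> \<in> borel_measurable lebesgue" by (rule measurable_completion) (simp add: test_fun_borel[OF \<psi>])
    qed
    have st: "\<bar>s * t\<bar> \<le> s\<^sup>2 + t\<^sup>2" for s t :: real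
    proof -
      have "2 * \<bar>s\<bar> * \<bar>t\<bar> \<le> \<bar>s\<bar>\<^sup>2 + \<bar>t\<bar>\<^sup>2" by (rule sum_squares_bound)
      moreover have "0 \<le> \<bar>s\<bar> * \<bar>t\<bar>" by simp
      ultimately show ?thesis unfolding abs_mult power2_abs by linarith
    qed
    show "AE x in lebesgue. norm (h x * \<psi> x) \<le> norm ((h x)\<^sup>2 + (\<psi> x)\<^sup>2)"
      unfolding real_norm_def by (intro AE_I2 order_trans[OF st abs_ge_self])
  qed
qed

lemma test_fun_add:
  assumes "test_fun \<psi>" "test_fun \<theta>"
  shows "test_fun (\<lambda>x. \<psi> x + \<theta> x)"
proof -
  have d: "deriv_iter bs \<psi> differentiable at x" "deriv_iter bs \<theta> differentiable at x" if "set bs \<subseteq> Basis" for bs x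
    using assms that unfolding test_fun_def smooth_fun_def by blast+
  have eq: "deriv_iter bs (\<lambda>x. \<psi> x + \<theta> x) = (\<lambda>x. deriv_iter bs \<psi> x + deriv_iter bs \<theta> x)" if "set bs \<subseteq> Basis" for bs
    using that
  proof (induction bs)
    case (Cons b bs)
    then have s: "set bs \<subseteq> Basis" by simp
    have "frechet_derivative (\<lambda>x. deriv_iter bs \<psi> x + deriv_iter bs \<theta> x) (at x)
        = (\<lambda>h. frechet_derivative (deriv_iter bs \<psi>) (at x) h + frechet_derivative (deriv_iter bs \<theta>) (at x) h)" for x
      by (rule frechet_derivative_at[symmetric], rule has_derivative_add)
        (use d[OF s] in \<open>simp_all only: frechet_derivative_works[symmetric]\<close>)
    then show ?case using Cons.IH[OF s] by simp
  qed simp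
  have "smooth_fun (\<lambda>x. \<psi> x + \<theta> x)" unfolding smooth_fun_def
    by (auto simp: eq intro!: differentiable_add d)
  moreover have "compact (closure {x. \<psi> x + \<theta> x \<noteq> 0})"
  proof -
    have "bounded (closure {x. \<psi> x \<noteq> 0} \<union> closure {x. \<theta> x \<noteq> 0})"
      using assms unfolding test_fun_def by (intro compact_imp_bounded compact_Un) auto
    then have "bounded {x. \<psi> x + \<theta> x \<noteq> 0}"
    proof (rule bounded_subset, intro subsetI)
      fix x assume "x \<in> {x. \<psi> x + \<theta> x \<noteq> 0}"
      then have "x \<in> {x. \<psi> x \<noteq> 0} \<or> x \<in> {x. \<theta> x \<noteq> 0}" by auto
      then show "x \<in> closure {x. \<psi> x \<noteq> 0} \<union> closure {x. \<theta> x \<noteq> 0}"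
      proof
        assume "x \<in> {x. \<psi> x \<noteq> 0}"
        then show ?thesis by (rule UnI1[OF subsetD[OF closure_subset]])
      next
        assume "x \<in> {x. \<theta> x \<noteq> 0}"
        then show ?thesis by (rule UnI2[OF subsetD[OF closure_subset]])
      qed
    qed
    then show ?thesis by (simp only: compact_closure)
  qed
  ultimately show ?thesis by (simp add: test_fun_def)
qed

lemma L2norm_indicator_representative:
  fixes \<phi> \<phi>' :: "'a::euclidean_space \<Rightarrow> real"
  assumes \<phi>: "\<phi> \<in> borel_measurable lebesgue" and \<phi>': "square_integrable \<phi>'"
    and ae: "AE x in lebesgue. \<phi> x = \<phi>' x" and A: "A \<in> sets borel"
  shows "L2norm (\<lambda>x. indicator A x * \<phi> x) = sqrt (mass \<phi>' A)"
proof -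
  note [measurable] = square_integrableD(1)[OF \<phi>'] A
  have m: "(\<lambda>x. indicator A x * (\<phi>' x)\<^sup>2) \<in> borel_measurable lborel"
    by (intro borel_measurable_times borel_measurable_indicator borel_measurable_power) (use A square_integrableD(1)[OF \<phi>'] in simp_all)
  have A': "A \<in> sets lebesgue" using A by simp
  have "(\<integral>x. (indicator A x * \<phi> x)\<^sup>2 \<partial>lebesgue) = (\<integral>x. indicator A x * (\<phi>' x)\<^sup>2 \<partial>lebesgue)"
  proof (rule integral_cong_AE)
    show "(\<lambda>x. (indicator A x * \<phi> x)\<^sup>2) \<in> borel_measurable lebesgue"
      by (intro borel_measurable_power borel_measurable_times borel_measurable_indicator A' \<phi>)
    show "(\<lambda>x. indicator A x * (\<phi>' x)\<^sup>2) \<in> borel_measurable lebesgue"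
      using m by (rule measurable_completion)
    show "AE x in lebesgue. (indicator A x * \<phi> x)\<^sup>2 = indicator A x * (\<phi>' x)\<^sup>2"
      using ae by eventually_elim (auto simp: indicator_def)
  qed
  also have "\<dots> = mass \<phi>' A" unfolding mass_def by (rule integral_completion[OF m])
  finally show ?thesis by (simp only: L2norm_def)
qed

lemma mass_UNIV: "mass \<phi> UNIV = (\<integral>x. (\<phi> x)\<^sup>2 \<partial>lborel)"
  by (simp add: mass_def)

text \<open>In \<^const>\<open>weak_deriv\<close> a product that is not integrable has integral \<open>0\<close>, so a competitor \<open>g\<close> of the
  true weak derivative \<open>h\<close> need not be locally integrable; but if it is not, then \<open>h\<close> is orthogonal
  to all test functions.\<close>
lemma weak_deriv_competitor:
  fixes g h :: "'a::euclidean_space \<Rightarrow> real"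
  assumes h: "L2 h"
    and eq: "\<And>\<psi>. test_fun \<psi> \<Longrightarrow> (\<integral>x. g x * \<psi> x \<partial>lebesgue) = (\<integral>x. h x * \<psi> x \<partial>lebesgue)"
  shows "(AE x in lebesgue. g x = h x) \<or> (\<forall>\<psi>. test_fun \<psi> \<longrightarrow> (\<integral>x. h x * \<psi> x \<partial>lebesgue) = 0)"
proof (cases "\<forall>\<psi>. test_fun \<psi> \<longrightarrow> integrable lebesgue (\<lambda>x. g x * \<psi> x)")
  case True
  have i: "integrable lebesgue (\<lambda>x. g x * \<psi> x)" "integrable lebesgue (\<lambda>x. h x * \<psi> x)" if "test_fun \<psi>" for \<psi>
    using True that integrable_L2_test_fun[OF h that] by auto
  have e: "(g x - h x) * \<psi> x = g x * \<psi> x - h x * \<psi> x" for \<psi> :: "'a \<Rightarrow> real" and x by (rule left_diff_distrib)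
  have "AE x in lebesgue. g x - h x = 0"
  proof (rule weak_zero_imp_AE_zero)
    fix \<psi> :: "'a \<Rightarrow> real" assume t: "test_fun \<psi>"
    show "integrable lebesgue (\<lambda>x. (g x - h x) * \<psi> x)" unfolding e by (intro Bochner_Integration.integrable_diff i t)
    show "(\<integral>x. (g x - h x) * \<psi> x \<partial>lebesgue) = 0" unfolding e using eq[OF t] i[OF t] by simp
  qed
  then show ?thesis by simp
next
  case False
  then obtain \<psi>0 where \<psi>0: "test_fun \<psi>0" "\<not> integrable lebesgue (\<lambda>x. g x * \<psi>0 x)" by blast
  have z0: "(\<integral>x. h x * \<psi>0 x \<partial>lebesgue) = 0"
    using eq[OF \<psi>0(1)] not_integrable_integral_eq[OF \<psi>0(2)] by simp
  have "(\<integral>x. h x * \<psi> x \<partial>lebesgue) = 0" if t: "test_fun \<psi>" for \<psi>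
  proof (cases "integrable lebesgue (\<lambda>x. g x * \<psi> x)")
    case False
    then show ?thesis using eq[OF t] not_integrable_integral_eq[OF False] by simp
  next
    case True
    \<comment> \<open>The sum of a test function with integrable product and one without again has a
      nonintegrable product. So h is orthogonal to \<open>\<psi>0\<close> and to
      \<open>\<psi>0 + \<psi>\<close>, hence to \<open>\<psi>\<close>.\<close>
    have "\<not> integrable lebesgue (\<lambda>x. g x * (\<psi>0 x + \<psi> x))"
    proof
      assume "integrable lebesgue (\<lambda>x. g x * (\<psi>0 x + \<psi> x))"
      then have "integrable lebesgue (\<lambda>x. g x * (\<psi>0 x + \<psi> x) - g x * \<psi> x)"
        using True by (rule Bochner_Integration.integrable_diff)
      then show False using \<psi>0(2) by (simp add: distrib_left)
    qed
    then have "(\<integral>x. h x * (\<psi>0 x + \<psi> x) \<partial>lebesgue) = 0"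
      using eq[OF test_fun_add[OF \<psi>0(1) t]] not_integrable_integral_eq by metis
    moreover have "(\<integral>x. h x * (\<psi>0 x + \<psi> x) \<partial>lebesgue) = (\<integral>x. h x * \<psi>0 x \<partial>lebesgue) + (\<integral>x. h x * \<psi> x \<partial>lebesgue)"
      unfolding distrib_left by (intro Bochner_Integration.integral_add integrable_L2_test_fun h t \<psi>0(1))
    ultimately show ?thesis using z0 by simp
  qed
  then show ?thesis by blast
qed

text \<open>All constants become powers of q by \<open>le_powr_two_times\<close>: the prefactor
  contributes 4 (1 + 8 K) to the exponent and 8 d q^2 is at most q^(16 d + 2). The 2 in front of K1
  is the one a square root will remove later.\<close>

lemma exponent_bound:
  fixes d K A X \<alpha> q :: real
  assumes d: "d \<ge> 1" and K: "K \<ge> 0" and A: "A \<ge> 0" and X: "X \<ge> 0" and q: "q \<ge> 2"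
    and \<alpha>: "\<alpha> = A + 8 * d * X" and K1: "K1 = 4 * (1 + 8 * K) + (16 * d + 2) * (A + 1 + 8 * d)"
  shows "2 * (1 + 8 * K) * (8 * d * q\<^sup>2) powr (\<alpha> + 1) \<le> q powr (2 * (K1 * (1 + X)))"
proof -
  have \<alpha>0: "\<alpha> + 1 \<ge> 0" using A X d by (simp add: \<alpha>)
  have 1: "2 * (1 + 8 * K) \<le> q powr (2 * (2 * (1 + 8 * K)))" by (rule le_powr_two_times[OF q]) (use K in simp)
  have "8 * d \<le> q powr (2 * (8 * d))" by (rule le_powr_two_times[OF q]) (use d in simp)
  then have "8 * d * q\<^sup>2 \<le> q powr (2 * (8 * d)) * q\<^sup>2" by (rule mult_right_mono) simp
  also have "\<dots> = q powr (16 * d + 2)" using q by (simp add: powr_add)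
  finally have "(8 * d * q\<^sup>2) powr (\<alpha> + 1) \<le> (q powr (16 * d + 2)) powr (\<alpha> + 1)"
    using \<alpha>0 d by (intro powr_mono2) auto
  also have "\<dots> = q powr ((16 * d + 2) * (\<alpha> + 1))" by (rule powr_powr)
  finally have "2 * (1 + 8 * K) * (8 * d * q\<^sup>2) powr (\<alpha> + 1) \<le> q powr (2 * (2 * (1 + 8 * K))) * q powr ((16 * d + 2) * (\<alpha> + 1))"
    using 1 K by (intro mult_mono) auto
  also have "\<dots> = q powr (4 * (1 + 8 * K) + (16 * d + 2) * (\<alpha> + 1))" by (simp add: powr_add[symmetric])
  also have "\<dots> \<le> q powr (2 * (K1 * (1 + X)))"
  proof (rule powr_mono)
    define B where "B = 16 * d + 2"
    have B: "B \<ge> 0" using d by (simp add: B_def)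
    have "A + 8 * d * X + 1 \<le> (A + 1 + 8 * d) * (1 + X)"
    proof -
      have "(A + 1 + 8 * d) * (1 + X) = A + 8 * d * X + 1 + (8 * d + A * X + X)" by (simp add: algebra_simps)
      moreover have "0 \<le> 8 * d + A * X + X" using d A X by simp
      ultimately show ?thesis by linarith
    qed
    then have "B * (\<alpha> + 1) \<le> B * ((A + 1 + 8 * d) * (1 + X))" unfolding \<alpha> using B by (rule mult_left_mono)
    moreover have "4 * (1 + 8 * K) * 1 \<le> 4 * (1 + 8 * K) * (1 + X)" using K X by (intro mult_left_mono) auto
    moreover have "K1 * (1 + X) = 4 * (1 + 8 * K) * (1 + X) + B * ((A + 1 + 8 * d) * (1 + X))"
      unfolding K1 B_def by (simp only: distrib_right[of "4 * (1 + 8 * K)"] mult.assoc)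
    moreover have "0 \<le> K1 * (1 + X)" using d A K X by (simp add: K1)
    ultimately show "4 * (1 + 8 * K) + (16 * d + 2) * (\<alpha> + 1) \<le> 2 * (K1 * (1 + X))"
      unfolding B_def[symmetric] by linarith
  qed (use q in simp)
  finally show ?thesis .
qed

lemma equidistribution_estimate:
  fixes \<phi> V :: "'a::euclidean_space \<Rightarrow> real" and M \<delta> E :: real
  assumes M: "M > 0" and \<delta>: "0 < \<delta>" "\<delta> \<le> M / 2" and Z: "equidistributed M \<delta> Z"
    and V: "bounded (range V)" and \<phi>: "sobolev22 \<phi>"
    and g: "\<And>i. i \<in> Basis \<Longrightarrow> weak_deriv [i, i] \<phi> (g i)"
    and le: "AE x in lebesgue. \<bar>\<Sum>i\<in>Basis. g i x\<bar> \<le> \<bar>(V x - E) * \<phi> x\<bar>"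
    and d: "d = real DIM('a)" and K: "K = 8 * (18 * d + 576)\<^sup>2 * (9 * d + 291)"
    and A: "A = 2 * d + 4 * K * real ((2 * (4 * DIM('a) + 1) + 1) ^ DIM('a))"
    and K1: "K1 = 4 * (1 + 8 * K) + (16 * d + 2) * (A + 1 + 8 * d)"
  shows "(\<delta> / M) powr (K1 * (1 + M powr (4/3) * (SUP x. \<bar>V x - E\<bar>) powr (2/3))) * L2norm \<phi>
      \<le> L2norm (\<lambda>x. indicator (S_set M \<delta> Z) x * \<phi> x)"
    and "L2norm (\<lambda>x. indicator (S_set M \<delta> Z) x * \<phi> x) \<le> L2norm \<phi>"
proof -
  define N where "N = (SUP x. \<bar>V x - E\<bar>)"
  have bdd: "bdd_above (range (\<lambda>x. \<bar>V x - E\<bar>))"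
  proof -
    obtain B where B: "\<And>x. \<bar>V x\<bar> \<le> B" using V by (auto simp: bounded_iff)
    show ?thesis
    proof (rule bdd_aboveI2)
      show "\<bar>V x - E\<bar> \<le> B + \<bar>E\<bar>" for x using B[of x] by linarith
    qed
  qed
  have VN: "\<bar>V x - E\<bar> \<le> N" for x unfolding N_def by (rule cSUP_upper[OF UNIV_I bdd])
  have N0: "N \<ge> 0" using VN[of undefined] by linarith
  have L2\<phi>: "L2 \<phi>" using \<phi> by (simp add: sobolev22_def)
  obtain f where f: "square_integrable f" "AE x in lebesgue. \<phi> x = f x" by (rule L2_borel_representative[OF L2\<phi>])
  have m\<phi>: "\<phi> \<in> borel_measurable lebesgue" using L2\<phi> by (simp add: L2_def)
  have opS: "open (S_set M \<delta> Z)" unfolding S_set_def by auto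
  then have bS: "S_set M \<delta> Z \<in> sets borel" by simp
  define I where "I = mass f UNIV"
  define S where "S = mass f (S_set M \<delta> Z)"
  have nI: "L2norm \<phi> = sqrt I"
    using L2norm_indicator_representative[OF m\<phi> f, of UNIV] by (simp add: I_def)
  have nS: "L2norm (\<lambda>x. indicator (S_set M \<delta> Z) x * \<phi> x) = sqrt S"
    unfolding S_def by (rule L2norm_indicator_representative[OF m\<phi> f bS])
  have "S \<le> I" unfolding S_def I_def by (rule mass_mono[OF f(1) bS]) auto
  then show "L2norm (\<lambda>x. indicator (S_set M \<delta> Z) x * \<phi> x) \<le> L2norm \<phi>" unfolding nI nS by simp
  have S0: "S \<ge> 0" unfolding S_def by (rule mass_nonneg)
  have "\<exists>h h'. L2 h \<and> weak_deriv [i, i] \<phi> h \<and> square_integrable h' \<and> (AE x in lebesgue. h x = h' x)"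
    if i: "i \<in> Basis" for i
  proof -
    have "set [i, i] \<subseteq> Basis \<and> length [i, i] \<le> 2" using i by simp
    then obtain h where h: "L2 h" "weak_deriv [i, i] \<phi> h" using \<phi> unfolding sobolev22_def by blast
    obtain h' where "square_integrable h'" "AE x in lebesgue. h x = h' x" by (rule L2_borel_representative[OF h(1)])
    then show ?thesis using h by blast
  qed
  then have "\<forall>i\<in>Basis. \<exists>p. L2 (fst p) \<and> weak_deriv [i, i] \<phi> (fst p) \<and> square_integrable (snd p) \<and> (AE x in lebesgue. fst p x = snd p x)"
    by fastforce
  from bchoice[OF this] obtain p where p: "\<And>i. i \<in> Basis \<Longrightarrow> L2 (fst (p i))" "\<And>i. i \<in> Basis \<Longrightarrow> weak_deriv [i, i] \<phi> (fst (p i))"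
    "\<And>i. i \<in> Basis \<Longrightarrow> square_integrable (snd (p i))" "\<And>i. i \<in> Basis \<Longrightarrow> AE x in lebesgue. fst (p i) x = snd (p i) x"
    by blast
  define h where "h i = snd (p i)" for i
  have int_h: "(\<integral>x. fst (p i) x * \<psi> x \<partial>lebesgue) = (\<integral>x. h i x * \<psi> x \<partial>lborel)"
    if i: "i \<in> Basis" and t: "test_fun \<psi>" for i \<psi>
    unfolding h_def
    by (rule integral_lebesgue_representative[OF _ square_integrableD(1)[OF p(3)[OF i]] test_fun_borel[OF t] p(4)[OF i]])
      (use p(1)[OF i] in \<open>simp add: L2_def\<close>)
  have int_\<phi>: "(\<integral>x. \<phi> x * deriv_iter [i, i] \<psi> x \<partial>lebesgue) = (\<integral>x. f x * deriv_iter [i, i] \<psi> x \<partial>lborel)"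
    if i: "i \<in> Basis" and t: "test_fun \<psi>" for i \<psi>
    by (rule integral_lebesgue_representative[OF m\<phi> square_integrableD(1)[OF f(1)] deriv_iter_borel[OF t] f(2)]) (use i in simp)
  have weak: "(\<integral>x. f x * deriv_iter [i, i] \<psi> x \<partial>lborel) = (\<integral>x. h i x * \<psi> x \<partial>lborel)"
    if i: "i \<in> Basis" and t: "test_fun \<psi>" for i \<psi>
  proof -
    have "(\<integral>x. \<phi> x * deriv_iter [i, i] \<psi> x \<partial>lebesgue) = (\<integral>x. fst (p i) x * \<psi> x \<partial>lebesgue)"
      using p(2)[OF i] t by (simp add: weak_deriv_def del: deriv_iter.simps)
    then show ?thesis unfolding int_\<phi>[OF i t] int_h[OF i t] .
  qed
  have compare: "(\<integral>x. g i x * \<psi> x \<partial>lebesgue) = (\<integral>x. fst (p i) x * \<psi> x \<partial>lebesgue)"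
    if i: "i \<in> Basis" and t: "test_fun \<psi>" for i \<psi>
    using p(2)[OF i] g[OF i] t by (simp add: weak_deriv_def del: deriv_iter.simps)
  define X where "X = M powr (4/3) * N powr (2/3)"
  define T where "T = K1 * (1 + X)"
  \<comment> \<open>The functions \<open>g i\<close> need not be the square integrable derivatives
    provided by \<open>sobolev22\<close>. If all agree with those almost everywhere, the main
    estimate applies. Otherwise \<open>weak_deriv_competitor\<close> makes some second derivative
    orthogonal to all test functions, so phi has norm zero and the inequality is trivial.\<close>
  have IS: "I \<le> (M / \<delta>) powr (2 * T) * S"
  proof (cases "\<forall>i\<in>Basis. AE x in lebesgue. g i x = fst (p i) x")
    case False
    then obtain i where i: "i \<in> Basis" and "\<not> (AE x in lebesgue. g i x = fst (p i) x)" by blast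
    then have z: "(\<integral>x. fst (p i) x * \<psi> x \<partial>lebesgue) = 0" if "test_fun \<psi>" for \<psi>
      using weak_deriv_competitor[OF p(1)[OF i] compare[OF i]] that by blast
    have "(\<integral>x. (f x)\<^sup>2 \<partial>lborel) = 0"
    proof (rule weak_second_derivative_zero[OF f(1) i])
      fix \<psi> :: "'a \<Rightarrow> real" assume t: "test_fun \<psi>"
      show "(\<integral>x. f x * deriv_iter [i, i] \<psi> x \<partial>lborel) = 0"
        unfolding weak[OF i t] int_h[OF i t, symmetric] by (rule z[OF t])
    qed
    then have "I = 0" by (simp only: I_def mass_UNIV)
    then show ?thesis using S0 by simp
  next
    case True
    have ae: "AE x in lebesgue. \<forall>i\<in>Basis. g i x = h i x"
    proof (rule AE_finite_allI[OF finite_Basis])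
      fix i :: 'a assume i: "i \<in> Basis"
      have "AE x in lebesgue. g i x = fst (p i) x" using True i by blast
      then show "AE x in lebesgue. g i x = h i x" using p(4)[OF i] unfolding h_def by eventually_elim simp
    qed
    have "AE x in lebesgue. \<bar>\<Sum>i\<in>Basis. h i x\<bar> \<le> N * \<bar>f x\<bar>"
      using ae le f(2)
    proof eventually_elim
      case (elim x)
      have "(\<Sum>i\<in>Basis. h i x) = (\<Sum>i\<in>Basis. g i x)" using elim(1) by (intro sum.cong) auto
      then have "\<bar>\<Sum>i\<in>Basis. h i x\<bar> \<le> \<bar>V x - E\<bar> * \<bar>f x\<bar>" using elim(2,3) by (simp only: abs_mult)
      also have "\<dots> \<le> N * \<bar>f x\<bar>" by (rule mult_right_mono[OF VN]) simp
      finally show ?case .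
    qed
    then have LN: "AE x in lborel. \<bar>\<Sum>i\<in>Basis. h i x\<bar> \<le> N * \<bar>f x\<bar>" by (simp only: AE_completion_iff)
    have hs: "square_integrable (h i)" if "i \<in> Basis" for i unfolding h_def by (rule p(3)[OF that])
    define \<alpha> where "\<alpha> = A + 8 * d * (M powr (4/3) * N powr (2/3))"
    have "I \<le> 2 * (1 + 8 * K) * (8 * d * (M / \<delta>)\<^sup>2) powr (\<alpha> + 1) * S"
      unfolding I_def S_def mass_UNIV
      by (rule equidistribution_mass_bound[OF M \<delta> Z N0 f(1) hs weak LN d K A \<alpha>_def])
    also have "\<dots> \<le> (M / \<delta>) powr (2 * T) * S"
    proof (rule mult_right_mono[OF _ S0], unfold T_def, rule exponent_bound[OF _ _ _ _ _ _ K1])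
      show d1: "d \<ge> 1" by (simp add: d Suc_leI)
      show K0: "K \<ge> 0" using d1 by (simp add: K)
      show "A \<ge> 0" using d1 K0 by (simp add: A)
      show "X \<ge> 0" by (simp add: X_def)
      show "M / \<delta> \<ge> 2" using \<delta> by (simp add: pos_le_divide_eq)
      show "\<alpha> = A + 8 * d * X" by (simp only: \<alpha>_def X_def)
    qed
    finally show ?thesis .
  qed
  have q: "M / \<delta> > 0" using M \<delta> by simp
  \<comment> \<open>Passing from masses to norms halves the exponent 2 T.\<close>
  have "sqrt I \<le> sqrt ((M / \<delta>) powr (2 * T) * S)" using IS by (rule real_sqrt_le_mono)
  also have "\<dots> = (M / \<delta>) powr T * sqrt S"
  proof -
    have "(M / \<delta>) powr (2 * T) = ((M / \<delta>) powr T)\<^sup>2"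
      unfolding power2_eq_square powr_add[symmetric] by simp
    then show ?thesis by (simp add: real_sqrt_mult)
  qed
  finally have "(\<delta> / M) powr T * sqrt I \<le> (\<delta> / M) powr T * ((M / \<delta>) powr T * sqrt S)" by (rule mult_left_mono) simp
  also have "\<dots> = sqrt S"
  proof -
    have "(\<delta> / M) powr T * (M / \<delta>) powr T = ((\<delta> / M) * (M / \<delta>)) powr T"
      using M \<delta> by (intro powr_mult[symmetric])
    also have "\<dots> = 1" using M \<delta> by simp
    finally show ?thesis by (simp add: mult.assoc[symmetric])
  qed
  finally show "(\<delta> / M) powr (K1 * (1 + M powr (4/3) * (SUP x. \<bar>V x - E\<bar>) powr (2/3))) * L2norm \<phi>
      \<le> L2norm (\<lambda>x. indicator (S_set M \<delta> Z) x * \<phi> x)"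
    unfolding nI nS T_def X_def N_def .
qed

theorem theorem1:
  shows "\<exists>K0::real. K0 > 0 \<and>
    (\<forall>(M::real) (\<delta>::real) (Z::'a::euclidean_space \<Rightarrow> 'a) (V::'a \<Rightarrow> real) (E::real) (\<phi>::'a \<Rightarrow> real).
       M > 0 \<and> 0 < \<delta> \<and> \<delta> \<le> M / 2 \<and> equidistributed M \<delta> Z \<and>
       V \<in> borel_measurable lebesgue \<and> bounded (range V) \<and>
       sobolev22 \<phi> \<and>
       (\<exists>g. (\<forall>i\<in>Basis. weak_deriv [i, i] \<phi> (g i)) \<and>
            (AE x in lebesgue. \<bar>\<Sum>i\<in>Basis. g i x\<bar> \<le> \<bar>(V x - E) * \<phi> x\<bar>))
     \<longrightarrow>
       (\<delta> / M) powr (K0 * (1 + M powr (4/3) * (SUP x. \<bar>V x - E\<bar>) powr (2/3))) * L2norm \<phi>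
         \<le> L2norm (\<lambda>x. indicator (S_set M \<delta> Z) x * \<phi> x)
       \<and> L2norm (\<lambda>x. indicator (S_set M \<delta> Z) x * \<phi> x) \<le> L2norm \<phi>)"
proof -
  define d where "d = real DIM('a)"
  define K where "K = 8 * (18 * d + 576)\<^sup>2 * (9 * d + 291)"
  define A where "A = 2 * d + 4 * K * real ((2 * (4 * DIM('a) + 1) + 1) ^ DIM('a))"
  define K1 where "K1 = 4 * (1 + 8 * K) + (16 * d + 2) * (A + 1 + 8 * d)"
  have "d \<ge> 0" by (simp add: d_def)
  then have "K \<ge> 0" by (simp add: K_def)
  then have "A \<ge> 0" using \<open>d \<ge> 0\<close> by (simp add: A_def)
  then have "0 \<le> (16 * d + 2) * (A + 1 + 8 * d)" using \<open>d \<ge> 0\<close> by (intro mult_nonneg_nonneg) auto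
  then have "K1 > 0" using \<open>K \<ge> 0\<close> unfolding K1_def by (intro add_pos_nonneg) auto
  show ?thesis
  proof (intro exI[of _ K1] conjI allI impI \<open>K1 > 0\<close>; elim conjE exE)
    fix M \<delta> E :: real and Z :: "'a \<Rightarrow> 'a" and V \<phi> :: "'a \<Rightarrow> real" and g
    assume M: "M > 0" "0 < \<delta>" "\<delta> \<le> M / 2" "equidistributed M \<delta> Z" "bounded (range V)" "sobolev22 \<phi>"
      and g: "\<forall>i\<in>Basis. weak_deriv [i, i] \<phi> (g i)"
      and le: "AE x in lebesgue. \<bar>\<Sum>i\<in>Basis. g i x\<bar> \<le> \<bar>(V x - E) * \<phi> x\<bar>"
    note est = equidistribution_estimate[OF M bspec[OF g] le d_def K_def A_def K1_def]
    show "(\<delta> / M) powr (K1 * (1 + M powr (4/3) * (SUP x. \<bar>V x - E\<bar>) powr (2/3))) * L2norm \<phi>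
        \<le> L2norm (\<lambda>x. indicator (S_set M \<delta> Z) x * \<phi> x)" by (rule est(1))
    show "L2norm (\<lambda>x. indicator (S_set M \<delta> Z) x * \<phi> x) \<le> L2norm \<phi>" by (rule est(2))
  qed
qed

end
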